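(* Let $k$ be an algebraically closed field of characteristic zero. If $n \geq 3$, the category $\mathcal{W}(n)$ separates points of $\mathcal{U}(\mathfrak{ym}(n))$; that is, for every nonzero $a \in \mathcal{U}(\mathfrak{ym}(n))$ there exists a module $M \in \mathcal{W}(n)$ such that $a$ acts on $M$ as a nonzero endomorphism.
   Context: For an integer $n \geq 2$, let $\mathfrak{f}(n)$ be the free Lie algebra over $k$ on generators $x_1,\dots,x_n$. The Lie Yang-Mills algebra is the quotient $\mathfrak{ym}(n) = \mathfrak{f}(n)/\langle \sum_{i=1}^n [x_i,[x_i,x_j]] : 1 \leq j \leq n\rangle$ by the Lie ideal generated by the indicated elements. $\mathcal{U}(\mathfrak{g})$ denotes the universal enveloping algebra of $\mathfrak{g}$. The lower central series of a Lie algebra $\mathfrak{g}$ is $\mathcal{C}^0(\mathfrak{g})=\mathfrak{g}$, $\mathcal{C}^{m+1}(\mathfrak{g}) = [\mathfrak{g},\mathcal{C}^m(\mathfrak{g})]$. $A_r(k)$ is the $r$-th Weyl algebra, generated by $p_1,\dots,p_r,q_1,\dots,q_r$ with the canonical commutation relations ($[p_i,q_j]=\delta_{ij}$, $[p_i,p_j]=[q_i,q_j]=0$). $\mathbb{N}$ denotes the positive integers. $\mathcal{W}(n)$ is the full subcategory of the category of left $\mathcal{U}(\mathfrak{ym}(n))$-modules consisting of all modules $M$ for which there exist $r,l\in\mathbb{N}$ such that the action $\phi:\mathcal{U}(\mathfrak{ym}(n)) \to \mathrm{End}_k(M)$ factors as a composition of $k$-algebra homomorphisms $\mathcal{U}(\mathfrak{ym}(n))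 \twoheadrightarrow \mathcal{U}(\mathfrak{ym}(n)/\mathcal{C}^l(\mathfrak{ym}(n))) \to A_r(k) \to \mathrm{End}_k(M)$, the first one being the canonical surjection. *)

theory Defs
  imports
    "HOL-Algebra.Module"
    "HOL-Algebra.QuotRing"
    "HOL-Algebra.Algebraic_Closure_Type"
    "HOL-Library.Poly_Mapping"
begin

text \<open>
  The base field is a type \<open>'k\<close>. Algebras over it, associative or not, are records of type
  \<open>('k, 'a) module\<close>; in a Lie algebra the field \<open>mult\<close> is the bracket and the
  field \<open>one\<close> is irrelevant.
\<close>

section \<open>Algebras, ideals and quotients\<close>

definition alg_ideal :: "'a set \<Rightarrow> ('k::field, 'a) module \<Rightarrow> bool" where
  "alg_ideal I A \<longleftrightarrow> submodule I (ring_of_type_algebra :: 'k ring) A \<and>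
     (\<forall>x\<in>I. \<forall>a\<in>carrier A. a \<otimes>\<^bsub>A\<^esub> x \<in> I \<and> x \<otimes>\<^bsub>A\<^esub> a \<in> I)"

definition gen_ideal :: "('k::field, 'a) module \<Rightarrow> 'a set \<Rightarrow> 'a set" where
  "gen_ideal A S = \<Inter>{I. alg_ideal I A \<and> S \<subseteq> I}"

definition lin_span :: "('k::field, 'a) module \<Rightarrow> 'a set \<Rightarrow> 'a set" where
  "lin_span V S = \<Inter>{H. submodule H (ring_of_type_algebra :: 'k ring) V \<and> S \<subseteq> H}"

definition quot_alg :: "('k::field, 'a) module \<Rightarrow> 'a set \<Rightarrow> ('k, 'a set) module" where
  "quot_alg A I =
     \<lparr>carrier = a_rcosets\<^bsub>A\<^esub> I,
      monoid.mult = rcoset_mult A I,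
      one = I +>\<^bsub>A\<^esub> \<one>\<^bsub>A\<^esub>,
      zero = I,
      add = set_add A,
      module.smult = (\<lambda>c B. \<Union>x\<in>B. I +>\<^bsub>A\<^esub> (c \<odot>\<^bsub>A\<^esub> x))\<rparr>"

text \<open>Homomorphisms of unital associative algebras.\<close>

definition alg_hom :: "('k::field, 'a) module \<Rightarrow> ('k, 'b) module \<Rightarrow> ('a \<Rightarrow> 'b) set" where
  "alg_hom A B = {h \<in> ring_hom A B. \<forall>c. \<forall>x\<in>carrier A. h (c \<odot>\<^bsub>A\<^esub> x) = c \<odot>\<^bsub>B\<^esub> h x}"

section \<open>Free algebras\<close>

definition pm_scale :: "'k::field \<Rightarrow> ('x \<Rightarrow>\<^sub>0 'k) \<Rightarrow> ('x \<Rightarrow>\<^sub>0 'k)" where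
  "pm_scale c f = Poly_Mapping.map (\<lambda>b. c * b) f"

text \<open>Linear extension of a map of basis elements, and bilinear extension of an operation on them.\<close>

definition pm_lin :: "('x \<Rightarrow> 'y) \<Rightarrow> ('x \<Rightarrow>\<^sub>0 'k::field) \<Rightarrow> ('y \<Rightarrow>\<^sub>0 'k)" where
  "pm_lin t f = (\<Sum>u\<in>Poly_Mapping.keys f. Poly_Mapping.single (t u) (Poly_Mapping.lookup f u))"

definition pm_bilin :: "('x \<Rightarrow> 'x \<Rightarrow> 'x) \<Rightarrow> ('x \<Rightarrow>\<^sub>0 'k::field) \<Rightarrow> ('x \<Rightarrow>\<^sub>0 'k) \<Rightarrow> ('x \<Rightarrow>\<^sub>0 'k)" where
  "pm_bilin t f g = (\<Sum>u\<in>Poly_Mapping.keys f. \<Sum>v\<in>Poly_Mapping.keys g.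
     Poly_Mapping.single (t u v) (Poly_Mapping.lookup f u * Poly_Mapping.lookup g v))"

definition free_assoc :: "'x set \<Rightarrow> ('k::field, 'x list \<Rightarrow>\<^sub>0 'k) module" where
  "free_assoc S =
     \<lparr>carrier = {f. Poly_Mapping.keys f \<subseteq> lists S},
      monoid.mult = pm_bilin (@),
      one = Poly_Mapping.single [] 1,
      zero = 0,
      add = (+),
      module.smult = pm_scale\<rparr>"

definition letter :: "'x \<Rightarrow> ('x list \<Rightarrow>\<^sub>0 'k::field)" where
  "letter x = Poly_Mapping.single [x] 1"

datatype 'x bracketing = Gen 'x | Br "'x bracketing" "'x bracketing"

definition free_nonassoc :: "'x set \<Rightarrow> ('k::field, 'x bracketing \<Rightarrow>\<^sub>0 'k) module" where
  "free_nonassoc S =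
     \<lparr>carrier = {f. Poly_Mapping.keys f \<subseteq> {t. set_bracketing t \<subseteq> S}},
      monoid.mult = pm_bilin Br,
      one = undefined,
      zero = 0,
      add = (+),
      module.smult = pm_scale\<rparr>"

section \<open>Lie algebras\<close>

definition lie_relations :: "('k::field, 'a) module \<Rightarrow> 'a set" where
  "lie_relations A =
     {a \<otimes>\<^bsub>A\<^esub> a | a. a \<in> carrier A} \<union>
     {a \<otimes>\<^bsub>A\<^esub> (b \<otimes>\<^bsub>A\<^esub> c) \<oplus>\<^bsub>A\<^esub> b \<otimes>\<^bsub>A\<^esub> (c \<otimes>\<^bsub>A\<^esub> a) \<oplus>\<^bsub>A\<^esub> c \<otimes>\<^bsub>A\<^esub> (a \<otimes>\<^bsub>A\<^esub> b) | a b c.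
        a \<in> carrier A \<and> b \<in> carrier A \<and> c \<in> carrier A}"

definition free_lie :: "'x set \<Rightarrow> ('k::field, ('x bracketing \<Rightarrow>\<^sub>0 'k) set) module" where
  "free_lie S = quot_alg (free_nonassoc S) (gen_ideal (free_nonassoc S) (lie_relations (free_nonassoc S)))"

definition lie_gen :: "'x set \<Rightarrow> 'x \<Rightarrow> ('x bracketing \<Rightarrow>\<^sub>0 'k::field) set" where
  "lie_gen S x =
     gen_ideal (free_nonassoc S) (lie_relations (free_nonassoc S))
       +>\<^bsub>(free_nonassoc S :: ('k, _) module)\<^esub> Poly_Mapping.single (Gen x) 1"

primrec lower_central :: "('k::field, 'a) module \<Rightarrow> nat \<Rightarrow> 'a set" where
  "lower_central L 0 = carrier L"
| "lower_central L (Suc m) =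
     lin_span L {x \<otimes>\<^bsub>L\<^esub> y | x y. x \<in> carrier L \<and> y \<in> lower_central L m}"

section \<open>Universal enveloping algebras\<close>

text \<open>
  The quotient of the tensor algebra of a Lie algebra \<open>L\<close> by the ideal generated by the elements
  \<open>x y - y x - [x, y]\<close>. The tensor algebra is itself presented on the letters
  \<open>x \<in> L\<close>; the first two families of relations express that \<open>letter\<close> is linear.
\<close>

definition uenv_relations :: "('k::field, 'a) module \<Rightarrow> ('a list \<Rightarrow>\<^sub>0 'k) set" where
  "uenv_relations L =
     {letter (x \<oplus>\<^bsub>L\<^esub> y) - letter x - letter y | x y. x \<in> carrier L \<and> y \<in> carrier L} \<union>
     {letter (c \<odot>\<^bsub>L\<^esub> x) - pm_scale c (letter x) | c x. x \<in> carrier L} \<union>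
     {pm_bilin (@) (letter x) (letter y) - pm_bilin (@) (letter y) (letter x) - letter (x \<otimes>\<^bsub>L\<^esub> y) | x y.
        x \<in> carrier L \<and> y \<in> carrier L}"

definition uenv_ideal :: "('k::field, 'a) module \<Rightarrow> ('a list \<Rightarrow>\<^sub>0 'k) set" where
  "uenv_ideal L = gen_ideal (free_assoc (carrier L)) (uenv_relations L)"

definition uenv :: "('k::field, 'a) module \<Rightarrow> ('k, ('a list \<Rightarrow>\<^sub>0 'k) set) module" where
  "uenv L = quot_alg (free_assoc (carrier L)) (uenv_ideal L)"

text \<open>
  The algebra map \<open>uenv L \<rightarrow> uenv L'\<close> induced by a Lie algebra homomorphism
  \<open>h : L \<rightarrow> L'\<close>, on cosets; it sends the class of a word \<open>x\<^sub>1 \<dots> x\<^sub>m\<close> to that of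
  \<open>h x\<^sub>1 \<dots> h x\<^sub>m\<close>.
\<close>

definition uenv_map ::
  "('k::field, 'b) module \<Rightarrow> ('a \<Rightarrow> 'b) \<Rightarrow> ('a list \<Rightarrow>\<^sub>0 'k) set \<Rightarrow> ('b list \<Rightarrow>\<^sub>0 'k) set" where
  "uenv_map L' h B = (\<Union>f\<in>B. uenv_ideal L' +>\<^bsub>(free_assoc (carrier L') :: ('k, _) module)\<^esub> pm_lin (map h) f)"

definition uenv_quot_map ::
  "('k::field, 'a) module \<Rightarrow> 'a set \<Rightarrow> ('a list \<Rightarrow>\<^sub>0 'k) set \<Rightarrow> ('a set list \<Rightarrow>\<^sub>0 'k) set" where
  "uenv_quot_map L I = uenv_map (quot_alg L I) (\<lambda>x. I +>\<^bsub>L\<^esub> x)"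

section \<open>Weyl algebras\<close>

datatype weyl_gen = Weyl_P nat | Weyl_Q nat

definition weyl_relations :: "nat \<Rightarrow> (weyl_gen list \<Rightarrow>\<^sub>0 'k::field) set" where
  "weyl_relations r =
     (let comm = (\<lambda>x y. pm_bilin (@) (letter x) (letter y) - pm_bilin (@) (letter y) (letter x)) in
       {comm (Weyl_P i) (Weyl_Q j) - (if i = j then Poly_Mapping.single [] 1 else 0) | i j. i \<in> {1..r} \<and> j \<in> {1..r}} \<union>
       {comm (Weyl_P i) (Weyl_P j) | i j. i \<in> {1..r} \<and> j \<in> {1..r}} \<union>
       {comm (Weyl_Q i) (Weyl_Q j) | i j. i \<in> {1..r} \<and> j \<in> {1..r}})"

definition weyl_algebra :: "nat \<Rightarrow> ('k::field, (weyl_gen list \<Rightarrow>\<^sub>0 'k) set) module" where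
  "weyl_algebra r =
     (let F = free_assoc (Weyl_P ` {1..r} \<union> Weyl_Q ` {1..r}) in quot_alg F (gen_ideal F (weyl_relations r)))"

section \<open>Modules over associative algebras\<close>

text \<open>The locale \<^locale>\<open>module\<close> requires a commutative ring of scalars.\<close>

locale left_module = R?: ring R + M?: abelian_group M
  for R :: "('a, 'y) ring_scheme" (structure) and M :: "('a, 'm, 'z) module_scheme" (structure) +
  assumes smult_closed: "\<lbrakk>a \<in> carrier R; x \<in> carrier M\<rbrakk> \<Longrightarrow> a \<odot>\<^bsub>M\<^esub> x \<in> carrier M"
    and smult_l_distr: "\<lbrakk>a \<in> carrier R; b \<in> carrier R; x \<in> carrier M\<rbrakk>
      \<Longrightarrow> (a \<oplus>\<^bsub>R\<^esub> b) \<odot>\<^bsub>M\<^esub> x = a \<odot>\<^bsub>M\<^esub> x \<oplus>\<^bsub>M\<^esub> b \<odot>\<^bsub>M\<^esub> x"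
    and smult_r_distr: "\<lbrakk>a \<in> carrier R; x \<in> carrier M; y \<in> carrier M\<rbrakk>
      \<Longrightarrow> a \<odot>\<^bsub>M\<^esub> (x \<oplus>\<^bsub>M\<^esub> y) = a \<odot>\<^bsub>M\<^esub> x \<oplus>\<^bsub>M\<^esub> a \<odot>\<^bsub>M\<^esub> y"
    and smult_assoc: "\<lbrakk>a \<in> carrier R; b \<in> carrier R; x \<in> carrier M\<rbrakk>
      \<Longrightarrow> (a \<otimes>\<^bsub>R\<^esub> b) \<odot>\<^bsub>M\<^esub> x = a \<odot>\<^bsub>M\<^esub> (b \<odot>\<^bsub>M\<^esub> x)"
    and smult_one: "x \<in> carrier M \<Longrightarrow> \<one>\<^bsub>R\<^esub> \<odot>\<^bsub>M\<^esub> x = x"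

text \<open>The vector space underlying a left module over a unital algebra.\<close>

definition underlying_space :: "('k::field, 'a) module \<Rightarrow> ('a, 'm) module \<Rightarrow> ('k, 'm) module" where
  "underlying_space A M =
     \<lparr>carrier = carrier M, monoid.mult = monoid.mult M, one = one M, zero = zero M, add = add M,
      module.smult = (\<lambda>c x. (c \<odot>\<^bsub>A\<^esub> \<one>\<^bsub>A\<^esub>) \<odot>\<^bsub>M\<^esub> x)\<rparr>"

definition End_alg :: "('k::field, 'm) module \<Rightarrow> ('k, 'm \<Rightarrow> 'm) module" where
  "End_alg V =
     \<lparr>carrier = {f \<in> carrier V \<rightarrow>\<^sub>E carrier V.
        (\<forall>x\<in>carrier V. \<forall>y\<in>carrier V. f (x \<oplus>\<^bsub>V\<^esub> y) = f x \<oplus>\<^bsub>V\<^esub> f y) \<and>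
        (\<forall>c. \<forall>x\<in>carrier V. f (c \<odot>\<^bsub>V\<^esub> x) = c \<odot>\<^bsub>V\<^esub> f x)},
      monoid.mult = compose (carrier V),
      one = (\<lambda>x\<in>carrier V. x),
      zero = (\<lambda>x\<in>carrier V. \<zero>\<^bsub>V\<^esub>),
      add = (\<lambda>f g. \<lambda>x\<in>carrier V. f x \<oplus>\<^bsub>V\<^esub> g x),
      module.smult = (\<lambda>c f. \<lambda>x\<in>carrier V. c \<odot>\<^bsub>V\<^esub> f x)\<rparr>"

definition module_action :: "('a, 'm) module \<Rightarrow> 'a \<Rightarrow> 'm \<Rightarrow> 'm" where
  "module_action M a = (\<lambda>x\<in>carrier M. a \<odot>\<^bsub>M\<^esub> x)"

section \<open>Yang-Mills algebras\<close>

type_synonym 'k ym_elem = "(nat bracketing \<Rightarrow>\<^sub>0 'k) set set"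
type_synonym 'k uym_elem = "('k ym_elem list \<Rightarrow>\<^sub>0 'k) set"

definition ym_relations :: "nat \<Rightarrow> (nat bracketing \<Rightarrow>\<^sub>0 'k::field) set set" where
  "ym_relations n =
     (let L = (free_lie {1..n} :: ('k, _) module); x = lie_gen {1..n} in
       {\<Oplus>\<^bsub>L\<^esub>i\<in>{1..n}. x i \<otimes>\<^bsub>L\<^esub> (x i \<otimes>\<^bsub>L\<^esub> x j) | j. j \<in> {1..n}})"

definition ym :: "nat \<Rightarrow> ('k::field, 'k ym_elem) module" where
  "ym n = quot_alg (free_lie {1..n}) (gen_ideal (free_lie {1..n}) (ym_relations n))"

text \<open>
  The objects of the full subcategory \<open>\<W>(n)\<close> whose elements lie in the type \<open>'m\<close>. To test
  whether \<open>\<W>(n)\<close> separates points one may take \<open>'m\<close> to be \<open>nat \<Rightarrow>\<^sub>0 'k\<close>: if \<open>a\<close> does not kill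
  \<open>x \<in> M\<close>, it does not act by zero on the Weyl algebra submodule of \<open>M\<close> generated by \<open>x\<close>, which
  is again an object of \<open>\<W>(n)\<close> and has countable dimension.
\<close>

definition YM_W :: "nat \<Rightarrow> ('k::field uym_elem, 'm) module set" where
  "YM_W n = {M. left_module (uenv (ym n :: ('k, _) module)) M \<and>
     (\<exists>r\<ge>1. \<exists>l\<ge>1.
        \<exists>\<alpha> \<in> alg_hom (uenv (quot_alg (ym n) (lower_central (ym n) l))) (weyl_algebra r :: ('k, _) module).
        \<exists>\<beta> \<in> alg_hom (weyl_algebra r) (End_alg (underlying_space (uenv (ym n)) M)).
          \<forall>u\<in>carrier (uenv (ym n)).
            module_action M u = \<beta> (\<alpha> (uenv_quot_map (ym n) (lower_central (ym n) l) u)))}"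

end

theory Submission
  imports Defs "HOL-Computational_Algebra.Primes" "HOL-Library.Infinite_Set"
begin

text \<open>
  The proof reduces the separation of points to finite-dimensional representations, and then embeds these
  into modules over Weyl algebras.

  Let \<open>T\<close> be the algebra of words in \<open>x\<^sub>1, \<dots>, x\<^sub>n\<close> and \<open>R\<close> the ideal generated by the elements
  \<open>\<Sum>\<^sub>i [x\<^sub>i, [x\<^sub>i, x\<^sub>j]]\<close>. Expanding brackets into commutators gives a map from the enveloping algebra of the
  Yang-Mills algebra to \<open>T / R\<close>, and it is injective, since substituting the generators for the letters is a
  left inverse (\<open>uenv_ym_separation\<close>). The ideal \<open>R\<close> is homogeneous, so an element outside \<open>R\<close> is
  outside \<open>R + T\<^sub>>\<^sub>m\<close> for some \<open>m\<close>, where \<open>T\<^sub>>\<^sub>m\<close> is spanned by the words longer than \<open>m\<close>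
  (\<open>trunc_ideal_separates\<close>). The quotient \<open>V\<close> of \<open>T\<close> by \<open>R + T\<^sub>>\<^sub>m\<close> has finite dimension \<open>N\<close>, and the
  element acts on \<open>V\<close> by a nonzero matrix, because it does not kill the class of \<open>1\<close>
  (\<open>two_sided_matrix_rep\<close>). The \<open>m\<close>-th term of the lower central series acts on \<open>V\<close> by zero, since
  its elements expand into words longer than \<open>m\<close> modulo \<open>R\<close> (\<open>lower_central_expand\<close>).

  The Jordan-Schwinger map \<open>M \<mapsto> \<Sum>\<^sub>a\<^sub>,\<^sub>b M\<^sub>a\<^sub>b q\<^sub>a p\<^sub>b\<close> is a homomorphism of Lie algebras from the matrices on \<open>V\<close> to the
  Weyl algebra \<open>A\<^sub>N\<close> (\<open>jordan_schwinger_commutator\<close>). Composed with the representation on \<open>V\<close> it is a Lie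
  homomorphism from the nilpotent quotient of the Yang-Mills algebra to \<open>A\<^sub>N\<close>, and so it extends to the
  enveloping algebra of that quotient. Let \<open>A\<^sub>N\<close> act on polynomials in the \<open>q\<^sub>a\<close>, with \<open>p\<^sub>a\<close> as partial
  derivatives. The linear polynomials form a copy of \<open>V\<close> as a module over the enveloping algebra
  (\<open>weyl_act_linear_part\<close>), so the given element acts on the module of polynomials by a nonzero
  endomorphism.
\<close>

section \<open>Linear maps of finitely supported functions\<close>

lemma lookup_pm_scale [simp]:
  "Poly_Mapping.lookup (pm_scale c f) x = c * Poly_Mapping.lookup f x"
  by (simp add: pm_scale_def Poly_Mapping.map.rep_eq when_def)

lemma vector_space_pm_scale: "vector_space (pm_scale :: 'k::field \<Rightarrow> ('x \<Rightarrow>\<^sub>0 'k) \<Rightarrow> _)"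
  by standard (auto intro!: poly_mapping_eqI simp: lookup_add algebra_simps)

interpretation pm: vector_space "pm_scale :: 'k::field \<Rightarrow> ('x \<Rightarrow>\<^sub>0 'k) \<Rightarrow> _"
  by (rule vector_space_pm_scale)

interpretation pm: vector_space_pair
  "pm_scale :: 'k::field \<Rightarrow> ('x \<Rightarrow>\<^sub>0 'k) \<Rightarrow> _" "pm_scale :: 'k::field \<Rightarrow> ('y \<Rightarrow>\<^sub>0 'k) \<Rightarrow> _"
  by unfold_locales

abbreviation pm_linear :: "(('x \<Rightarrow>\<^sub>0 'k::field) \<Rightarrow> ('y \<Rightarrow>\<^sub>0 'k)) \<Rightarrow> bool" where
  "pm_linear \<equiv> Vector_Spaces.linear pm_scale pm_scale"

lemma pm_linearI:
  assumes "\<And>f g. h (f + g) = h f + h g" "\<And>c f. h (pm_scale c f) = pm_scale c (h f)"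
  shows "pm_linear h"
  unfolding Vector_Spaces.linear_iff using assms by (auto intro: vector_space_pm_scale)

lemma pm_scale_single [simp]:
  "pm_scale c (Poly_Mapping.single u b) = Poly_Mapping.single u (c * b)"
  by (simp add: pm_scale_def)

lemma keys_pm_scale: "Poly_Mapping.keys (pm_scale c f) \<subseteq> Poly_Mapping.keys f"
  by (auto simp: in_keys_iff)

lemma sum_singles:
  "(\<Sum>u\<in>Poly_Mapping.keys f. pm_scale (Poly_Mapping.lookup f u) (Poly_Mapping.single u 1)) = f"
  by (rule poly_mapping_eqI)
    (auto simp: lookup_sum lookup_single when_def in_keys_iff)

text \<open>
  Linear induction: the predicate need only be checked on basis elements and be closed under
  sums and scalars. The support is tracked because the carriers of the free algebras are given by it.
\<close>

lemma pm_induct [consumes 1, case_names zero basis add scale]: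
  assumes "Poly_Mapping.keys f \<subseteq> S"
    and "P 0"
    and "\<And>u. u \<in> S \<Longrightarrow> P (Poly_Mapping.single u 1)"
    and "\<And>f g. Poly_Mapping.keys f \<subseteq> S \<Longrightarrow> Poly_Mapping.keys g \<subseteq> S \<Longrightarrow> P f \<Longrightarrow> P g \<Longrightarrow> P (f + g)"
    and "\<And>c f. Poly_Mapping.keys f \<subseteq> S \<Longrightarrow> P f \<Longrightarrow> P (pm_scale c f)"
  shows "P f"
proof -
  define s where "s u = pm_scale (Poly_Mapping.lookup f u) (Poly_Mapping.single u 1)" for u
  have "Poly_Mapping.keys (sum s A) \<subseteq> S \<and> P (sum s A)" if "finite A" "A \<subseteq> Poly_Mapping.keys f" for A
    using that
  proof (induction A)
    case empty then show ?case using assms(2) by simp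
  next
    case (insert u A)
    then have u: "u \<in> S" using assms(1) by auto
    have "Poly_Mapping.keys (s u) \<subseteq> S" unfolding s_def using u by auto
    moreover have "P (s u)" unfolding s_def using assms(3)[OF u] u by (intro assms(5)) auto
    ultimately show ?case using insert assms(4) keys_add[of "s u" "sum s A"]
      by (simp) blast
  qed
  from this[of "Poly_Mapping.keys f"] show ?thesis by (simp add: s_def sum_singles del: pm_scale_single)
qed

lemma pm_linear_eqI:
  assumes "pm_linear h" "pm_linear h'" "Poly_Mapping.keys f \<subseteq> S"
    and "\<And>u. u \<in> S \<Longrightarrow> h (Poly_Mapping.single u 1) = h' (Poly_Mapping.single u 1)"
  shows "h f = h' f"
  using assms(3)
  by (induction rule: pm_induct)
    (simp_all add: assms(4) pm.linear_0[OF assms(1)] pm.linear_0[OF assms(2)] pm.linear_add[OF assms(1)]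
       pm.linear_add[OF assms(2)] pm.linear_scale[OF assms(1)] pm.linear_scale[OF assms(2)])

definition lin_ext :: "('x \<Rightarrow> ('y \<Rightarrow>\<^sub>0 'k::field)) \<Rightarrow> ('x \<Rightarrow>\<^sub>0 'k) \<Rightarrow> ('y \<Rightarrow>\<^sub>0 'k)" where
  "lin_ext b f = (\<Sum>u\<in>Poly_Mapping.keys f. pm_scale (Poly_Mapping.lookup f u) (b u))"

lemma linear_lin_ext: "pm_linear (lin_ext (b :: 'x \<Rightarrow> ('y \<Rightarrow>\<^sub>0 'k::field)))"
proof (rule pm_linearI)
  fix f g :: "'x \<Rightarrow>\<^sub>0 'k"
  show "lin_ext b (f + g) = lin_ext b f + lin_ext b g" unfolding lin_ext_def
    by (rule setsum_keys_plus_distrib) (simp_all add: pm.scale_left_distrib)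
next
  fix c and f :: "'x \<Rightarrow>\<^sub>0 'k"
  show "lin_ext b (pm_scale c f) = pm_scale c (lin_ext b f)"
    by (cases "c = 0")
      (auto simp: lin_ext_def pm.scale_sum_right in_keys_iff intro!: sum.cong)
qed

lemma lin_ext_single [simp]: "lin_ext b (Poly_Mapping.single u c) = pm_scale c (b u)"
  by (simp add: lin_ext_def)

lemmas lin_ext_simps [simp] = pm.linear_0[OF linear_lin_ext] pm.linear_add[OF linear_lin_ext]
  pm.linear_scale[OF linear_lin_ext] pm.linear_diff[OF linear_lin_ext] pm.linear_sum[OF linear_lin_ext]

lemma linear_lin_ext_param:
  assumes "\<And>u. pm_linear (B u)"
  shows "pm_linear (\<lambda>g. lin_ext (\<lambda>u. B u g) f)"
  by (rule pm_linearI)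
    (simp_all add: lin_ext_def pm.linear_add[OF assms] pm.linear_scale[OF assms]
       pm.scale_right_distrib sum.distrib pm.scale_sum_right mult.commute)

lemma pm_linear_compose: "pm_linear f \<Longrightarrow> pm_linear g \<Longrightarrow> pm_linear (\<lambda>x. f (g x))"
  by (rule pm_linearI) (simp_all add: pm.linear_add pm.linear_scale)

lemma pm_bilin_lin_ext:
  "pm_bilin t f g = lin_ext (\<lambda>u. lin_ext (\<lambda>v. Poly_Mapping.single (t u v) 1) g) f"
  by (simp add: pm_bilin_def lin_ext_def pm.scale_sum_right)

lemma pm_bilin_simps [simp]:
  "pm_bilin t (Poly_Mapping.single u a) (Poly_Mapping.single v b) = Poly_Mapping.single (t u v) (a * b)"
  "pm_bilin t (f + f') g = pm_bilin t f g + pm_bilin t f' g"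
  "pm_bilin t f (g + g') = pm_bilin t f g + pm_bilin t f g'"
  "pm_bilin t (pm_scale c f) g = pm_scale c (pm_bilin t f g)"
  "pm_bilin t f (pm_scale c g) = pm_scale c (pm_bilin t f g)"
  "pm_bilin t 0 g = 0"
  "pm_bilin t f 0 = 0"
proof -
  have l: "pm_linear (\<lambda>g. pm_bilin t f g)"
    unfolding pm_bilin_lin_ext by (intro linear_lin_ext_param linear_lin_ext)
  show "pm_bilin t (Poly_Mapping.single u a) (Poly_Mapping.single v b) = Poly_Mapping.single (t u v) (a * b)"
    by (simp add: pm_bilin_lin_ext)
  show "pm_bilin t (f + f') g = pm_bilin t f g + pm_bilin t f' g"
    "pm_bilin t (pm_scale c f) g = pm_scale c (pm_bilin t f g)" "pm_bilin t 0 g = 0"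
    by (simp_all add: pm_bilin_lin_ext)
  show  "pm_bilin t f (g + g') = pm_bilin t f g + pm_bilin t f g'"
    "pm_bilin t f (pm_scale c g) = pm_scale c (pm_bilin t f g)" "pm_bilin t f 0 = 0"
    by (rule pm.linear_add[OF l] pm.linear_scale[OF l] pm.linear_0[OF l])+
qed

section \<open>The free associative algebra as a ring\<close>

text \<open>
  Words form a monoid under concatenation. With this instance the convolution product on finitely
  supported functions of words, already present for monoids, is the product of the free associative
  algebra, so that computations in it become computations in a type of class \<open>ring_1\<close>.
\<close>

instantiation list :: (type) monoid_add
begin
definition zero_list_def: "0 = []"
definition plus_list_def: "u + v = u @ v"
instance by standard (simp_all add: zero_list_def plus_list_def)
end

lemma pm_scale_eq_mult: "pm_scale c f = Poly_Mapping.single 0 c * (f :: 'x list \<Rightarrow>\<^sub>0 'k::field)"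
  unfolding pm_scale_def by (rule mult_map_scale_conv_mult)

lemma pm_scale_mult_left [simp]: "pm_scale c f * g = pm_scale c (f * (g :: 'x list \<Rightarrow>\<^sub>0 'k::field))"
  by (simp add: pm_scale_eq_mult mult.assoc)

lemma pm_scale_mult_right [simp]: "f * pm_scale c g = pm_scale c (f * (g :: 'x list \<Rightarrow>\<^sub>0 'k::field))"
proof -
  have "f * Poly_Mapping.single 0 c = pm_scale c f"
  proof (rule pm_linear_eqI[where S = UNIV and f = f])
    show "pm_linear (\<lambda>f :: 'x list \<Rightarrow>\<^sub>0 'k. f * Poly_Mapping.single 0 c)"
      by (rule pm_linearI) (simp_all add: algebra_simps)
    show "pm_linear (pm_scale c :: ('x list \<Rightarrow>\<^sub>0 'k) \<Rightarrow> _)"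
      by (rule pm_linearI) (simp_all add: pm.scale_right_distrib mult.commute)
  qed (simp_all add: mult_single)
  then have "f * Poly_Mapping.single 0 c * g = pm_scale c f * g" by simp
  then show ?thesis by (simp add: pm_scale_eq_mult[of c g] mult.assoc)
qed

lemma single_Nil_one [simp]: "Poly_Mapping.single [] 1 = (1 :: 'x list \<Rightarrow>\<^sub>0 'k::field)"
  by (simp add: zero_list_def flip: single_one)

lemma linear_times: 
  "pm_linear (\<lambda>f :: 'x list \<Rightarrow>\<^sub>0 'k::field. f * g)" "pm_linear (\<lambda>g :: 'x list \<Rightarrow>\<^sub>0 'k::field. f * g)"
  by (rule pm_linearI; simp add: algebra_simps)+

lemma pm_bilin_append [simp]: "pm_bilin (@) f g = f * (g :: 'x list \<Rightarrow>\<^sub>0 'k::field)"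
proof -
  have 1: "pm_bilin (@) (Poly_Mapping.single u 1) g = Poly_Mapping.single u 1 * g" for u
  proof (rule pm_linear_eqI[where S = UNIV and f = g])
    show "pm_linear (pm_bilin (@) (Poly_Mapping.single u (1::'k)))" by (rule pm_linearI) simp_all
  qed (simp_all add: linear_times mult_single plus_list_def)
  show ?thesis
  proof (rule pm_linear_eqI[where S = UNIV and f = f])
    show "pm_linear (\<lambda>f. pm_bilin (@) f g)" by (rule pm_linearI) simp_all
  qed (simp_all add: linear_times 1)
qed

lemma single_Cons: "Poly_Mapping.single (x # u) 1 = letter x * (Poly_Mapping.single u 1 :: 'x list \<Rightarrow>\<^sub>0 'k::field)"
  by (simp add: letter_def mult_single plus_list_def)

text \<open>
  The homomorphism of free associative algebras that sends each letter \<open>x\<close> to \<open>\<phi> x\<close>.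
  All maps between enveloping algebras and Weyl algebras below are induced by maps of this form, so
  that multiplicativity is proved once, for words.
\<close>

definition word_hom :: "('x \<Rightarrow> ('y list \<Rightarrow>\<^sub>0 'k::field)) \<Rightarrow> ('x list \<Rightarrow>\<^sub>0 'k) \<Rightarrow> ('y list \<Rightarrow>\<^sub>0 'k)" where
  "word_hom \<phi> = lin_ext (\<lambda>u. prod_list (map \<phi> u))"

lemma linear_word_hom: "pm_linear (word_hom \<phi>)"
  unfolding word_hom_def by (rule linear_lin_ext)

lemmas word_hom_simps [simp] = pm.linear_0[OF linear_word_hom] pm.linear_add[OF linear_word_hom]
  pm.linear_scale[OF linear_word_hom] pm.linear_diff[OF linear_word_hom] pm.linear_sum[OF linear_word_hom]

lemma word_hom_single: "word_hom \<phi> (Poly_Mapping.single u c) = pm_scale c (prod_list (map \<phi> u))"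
  by (simp add: word_hom_def)

lemma word_hom_letter [simp]: "word_hom \<phi> (letter x) = \<phi> x"
  by (simp add: letter_def word_hom_single)

lemma word_hom_mult [simp]: "word_hom \<phi> (f * g) = word_hom \<phi> f * word_hom \<phi> g"
proof -
  have 1: "word_hom \<phi> (Poly_Mapping.single u 1 * g) = word_hom \<phi> (Poly_Mapping.single u 1) * word_hom \<phi> g" for u
    by (rule pm_linear_eqI[where S = UNIV and f = g])
      (auto intro!: pm_linear_compose[OF linear_word_hom] linear_times
       simp: mult_single word_hom_single plus_list_def pm_linear_compose[OF linear_times(2) linear_word_hom])
  show ?thesis
    by (rule pm_linear_eqI[where S = UNIV and f = f])
      (auto intro!: pm_linear_compose[OF linear_times(1) linear_word_hom] pm_linear_compose[OF linear_word_hom linear_times(1)] simp: 1)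
qed

lemma word_hom_one [simp]: "word_hom \<phi> 1 = 1"
  using word_hom_single[of \<phi> "[]" 1] by simp

lemma pm_lin_eq_word_hom: "pm_lin (map h) f = word_hom (\<lambda>x. letter (h x)) (f :: 'x list \<Rightarrow>\<^sub>0 'k::field)"
proof -
  have "prod_list (map (\<lambda>x. letter (h x)) u) = Poly_Mapping.single (map h u) (1::'k)" for u
    by (induction u)
      (simp_all add: letter_def mult_single plus_list_def)
  then show ?thesis by (simp add: pm_lin_def word_hom_def lin_ext_def)
qed

section \<open>Nonassociative algebras, ideals and epimorphisms\<close>

text \<open>
  Bilinear multiplication with no further law. This covers the free bracket algebra, all the Lie
  algebras and the associative algebras at once.
\<close>

locale nonassoc_algebra = abelian_group A for A :: "('k::field, 'a) module" (structure) +
  assumes mult_closed [simp]: "x \<in> carrier A \<Longrightarrow> y \<in> carrier A \<Longrightarrow> x \<otimes> y \<in> carrier A"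
    and smult_closed [simp]: "x \<in> carrier A \<Longrightarrow> c \<odot> x \<in> carrier A"
    and add_mult: "x \<in> carrier A \<Longrightarrow> y \<in> carrier A \<Longrightarrow> z \<in> carrier A \<Longrightarrow> (x \<oplus> y) \<otimes> z = x \<otimes> z \<oplus> y \<otimes> z"
    and mult_add: "x \<in> carrier A \<Longrightarrow> y \<in> carrier A \<Longrightarrow> z \<in> carrier A \<Longrightarrow> z \<otimes> (x \<oplus> y) = z \<otimes> x \<oplus> z \<otimes> y"
    and smult_mult: "x \<in> carrier A \<Longrightarrow> y \<in> carrier A \<Longrightarrow> (c \<odot> x) \<otimes> y = c \<odot> (x \<otimes> y)"
    and mult_smult: "x \<in> carrier A \<Longrightarrow> y \<in> carrier A \<Longrightarrow> x \<otimes> (c \<odot> y) = c \<odot> (x \<otimes> y)"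
    and smult_add: "x \<in> carrier A \<Longrightarrow> y \<in> carrier A \<Longrightarrow> c \<odot> (x \<oplus> y) = c \<odot> x \<oplus> c \<odot> y"
    and add_smult: "x \<in> carrier A \<Longrightarrow> (c + d) \<odot> x = c \<odot> x \<oplus> d \<odot> x"
    and smult_smult: "x \<in> carrier A \<Longrightarrow> c \<odot> (d \<odot> x) = (c * d) \<odot> x"
    and one_smult: "x \<in> carrier A \<Longrightarrow> 1 \<odot> x = x"
begin

lemma zero_smult: assumes "x \<in> carrier A" shows "0 \<odot> x = \<zero>"
proof -
  have "0 \<odot> x \<oplus> 0 \<odot> x = 0 \<odot> x" using add_smult[OF assms, of 0 0] by simp
  then show ?thesis using assms add.l_cancel_one' by (metis smult_closed)
qed

lemma minus_eq_smult: assumes "x \<in> carrier A" shows "\<ominus> x = (- 1) \<odot> x"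
proof -
  have "(- 1) \<odot> x \<oplus> x = \<zero>"
    using add_smult[OF assms, of "-1" 1] zero_smult[OF assms] by (simp add: one_smult assms)
  then show ?thesis using assms by (simp add: minus_equality)
qed

lemma submodule_iff:
  "submodule H (ring_of_type_algebra :: 'k ring) A \<longleftrightarrow>
     H \<subseteq> carrier A \<and> \<zero> \<in> H \<and> (\<forall>x\<in>H. \<forall>y\<in>H. x \<oplus> y \<in> H) \<and> (\<forall>c. \<forall>x\<in>H. c \<odot> x \<in> H)"
    (is "?L \<longleftrightarrow> ?R")
proof
  assume ?L
  then interpret submodule H "ring_of_type_algebra :: 'k ring" A .
  show ?R using subset one_closed m_closed smult_closed by (auto simp: ring_of_type_algebra_def)
next
  assume R: ?R
  show ?L
    by unfold_locales
      (use R minus_eq_smult in \<open>auto simp: ring_of_type_algebra_def subset_iff simp flip: a_inv_def\<close>)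
qed

lemma alg_ideal_iff:
  "alg_ideal I A \<longleftrightarrow>
     I \<subseteq> carrier A \<and> \<zero> \<in> I \<and> (\<forall>x\<in>I. \<forall>y\<in>I. x \<oplus> y \<in> I) \<and> (\<forall>c. \<forall>x\<in>I. c \<odot> x \<in> I) \<and>
     (\<forall>x\<in>I. \<forall>a\<in>carrier A. a \<otimes> x \<in> I \<and> x \<otimes> a \<in> I)"
  by (auto simp: alg_ideal_def submodule_iff)

lemma alg_ideal_carrier: "alg_ideal (carrier A) A"
  by (simp add: alg_ideal_iff)

lemma alg_ideal_gen_ideal:
  assumes "S \<subseteq> carrier A" shows "alg_ideal (gen_ideal A S) A"
proof -
  have "gen_ideal A S \<subseteq> carrier A"
    using alg_ideal_carrier assms by (auto simp: gen_ideal_def)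
  then show ?thesis unfolding alg_ideal_iff[of "gen_ideal A S"]
    by (auto simp: gen_ideal_def alg_ideal_iff)
qed

lemma ideal_abelian_subgroup:
  assumes "alg_ideal I A" shows "abelian_subgroup I A"
proof -
  have "submodule I (ring_of_type_algebra :: 'k ring) A" using assms by (simp add: alg_ideal_def)
  then have "subgroup I (add_monoid A)" by (rule submodule.axioms)
  then show ?thesis by (intro abelian_subgroupI3 additive_subgroupI abelian_group_axioms)
qed

text \<open>
  The translation \<open>i \<oplus> y\<close> is used instead of a difference, because elements of an ideal will be
  given as images of known elements, and then \<open>i\<close> can be lifted along an epimorphism.
\<close>

lemma coset_eq_iff:
  assumes I: "alg_ideal I A" and "x \<in> carrier A" "y \<in> carrier A"
  shows "I +> x = I +> y \<longleftrightarrow> (\<exists>i\<in>I. x = i \<oplus> y)"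
proof -
  interpret abelian_subgroup I A by (rule ideal_abelian_subgroup[OF I])
  show ?thesis
    using a_rcos_self[OF assms(2)] a_repr_independence[OF _ assms(3) a_subgroup, of x]
    by (auto simp: a_r_coset_def')
qed

end

lemma gen_ideal_least: "alg_ideal I A \<Longrightarrow> S \<subseteq> I \<Longrightarrow> gen_ideal A S \<subseteq> I"
  by (auto simp: gen_ideal_def)

lemma gen_ideal_superset: "S \<subseteq> gen_ideal A S"
  by (auto simp: gen_ideal_def)

lemma coset_of_member:
  assumes A: "nonassoc_algebra A" and I: "alg_ideal I A" and x: "x \<in> I"
  shows "I +>\<^bsub>A\<^esub> x = I"
proof -
  interpret nonassoc_algebra A by fact
  interpret abelian_subgroup I A by (rule ideal_abelian_subgroup[OF I])
  show ?thesis using x a_subset a_subgroup by (intro a_coset_join2) auto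
qed

context nonassoc_algebra
begin

lemma ideal_zero: "alg_ideal I A \<Longrightarrow> \<zero> \<in> I"
  using alg_ideal_iff by blast

text \<open>
  A left ideal is two-sided once \<open>x \<otimes> a = - (a \<otimes> x)\<close>, which follows from \<open>x \<otimes> x = \<zero>\<close>
  by polarisation. The inclusion of each term in the previous one, needed for the left ideal property
  of the span, is the ideal property of the previous term.
\<close>

lemma alternating_lower_central:
  assumes alt: "\<And>x. x \<in> carrier A \<Longrightarrow> x \<otimes> x = \<zero>"
  shows "alg_ideal (lower_central A m) A"
proof (induction m)
  case 0
  then show ?case by (simp add: alg_ideal_carrier)
next
  case (Suc m)
  let ?C = "lower_central A m"
  let ?S = "{x \<otimes> y | x y. x \<in> carrier A \<and> y \<in> ?C}"
  have C: "submodule ?C (ring_of_type_algebra :: 'k ring) A" "?C \<subseteq> carrier A"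
    using Suc alg_ideal_iff[of ?C] by (auto simp: alg_ideal_def)
  have CI: "\<And>x a. x \<in> ?C \<Longrightarrow> a \<in> carrier A \<Longrightarrow> a \<otimes> x \<in> ?C"
    using Suc by (simp add: alg_ideal_iff)
  have "?S \<subseteq> ?C" using CI by blast
  with C(1) have sub: "lin_span A ?S \<subseteq> ?C" unfolding lin_span_def by blast
  have S: "?S \<subseteq> lin_span A ?S" unfolding lin_span_def by blast
  have span: "lin_span A ?S \<subseteq> carrier A" "\<zero> \<in> lin_span A ?S"
     "\<And>x y. x \<in> lin_span A ?S \<Longrightarrow> y \<in> lin_span A ?S \<Longrightarrow> x \<oplus> y \<in> lin_span A ?S"
     "\<And>c x. x \<in> lin_span A ?S \<Longrightarrow> c \<odot> x \<in> lin_span A ?S"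
    using sub C(2) by (auto simp: lin_span_def submodule_iff)
  have mult: "a \<otimes> x \<in> lin_span A ?S" if "x \<in> lin_span A ?S" "a \<in> carrier A" for a x
    using that sub S by blast
  moreover have "x \<otimes> a \<in> lin_span A ?S" if x: "x \<in> lin_span A ?S" and a: "a \<in> carrier A" for a x
  proof -
    have xc: "x \<in> carrier A" using x span(1) by blast
    have "\<zero> = (x \<oplus> a) \<otimes> (x \<oplus> a)" using alt xc a by simp
    also have "\<dots> = x \<otimes> x \<oplus> a \<otimes> x \<oplus> (x \<otimes> a \<oplus> a \<otimes> a)"
      using xc a by (simp only: add_mult mult_add add.m_closed)
    also have "\<dots> = x \<otimes> a \<oplus> a \<otimes> x"
      using xc a by (simp add: alt a_comm)
    finally have "x \<otimes> a \<oplus> a \<otimes> x = \<zero>" by (rule sym)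
    then have "x \<otimes> a = (- 1) \<odot> (a \<otimes> x)"
      using xc a by (simp add: minus_equality flip: minus_eq_smult)
    then show ?thesis using span(4)[OF mult[OF x a]] by simp
  qed
  ultimately show ?case using span by (simp add: alg_ideal_iff)
qed

end

text \<open>
  A surjection that carries the operations of \<open>A\<close> to those of \<open>B\<close>. Nothing is assumed of
  \<open>B\<close>, which is why \<open>\<zero>\<close> is mentioned: the laws of \<open>B\<close> are to be inherited from \<open>A\<close>. Quotients are
  handled through this notion only, and a quotient of a quotient becomes a composite epimorphism.
\<close>

definition alg_epi :: "('k::field, 'a) module \<Rightarrow> ('k, 'b) module \<Rightarrow> ('a \<Rightarrow> 'b) \<Rightarrow> bool" where
  "alg_epi A B h \<longleftrightarrow> carrier B = h ` carrier A \<and> \<zero>\<^bsub>B\<^esub> = h \<zero>\<^bsub>A\<^esub> \<and>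
     (\<forall>x\<in>carrier A. \<forall>y\<in>carrier A. h (x \<oplus>\<^bsub>A\<^esub> y) = h x \<oplus>\<^bsub>B\<^esub> h y \<and> h (x \<otimes>\<^bsub>A\<^esub> y) = h x \<otimes>\<^bsub>B\<^esub> h y) \<and>
     (\<forall>c. \<forall>x\<in>carrier A. h (c \<odot>\<^bsub>A\<^esub> x) = c \<odot>\<^bsub>B\<^esub> h x)"

lemma alg_epi_compose: "alg_epi A B h \<Longrightarrow> alg_epi B C h' \<Longrightarrow> alg_epi A C (\<lambda>x. h' (h x))"
  by (auto simp: alg_epi_def)

lemma alg_epi_algebra:
  assumes "nonassoc_algebra A" and h: "alg_epi A B h"
  shows "nonassoc_algebra B"
proof -
  interpret nonassoc_algebra A by fact
  have c: "carrier B = h ` carrier A" "\<zero>\<^bsub>B\<^esub> = h \<zero>\<^bsub>A\<^esub>" using h by (auto simp: alg_epi_def)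
  have s [symmetric, simp]: "x \<in> carrier A \<Longrightarrow> y \<in> carrier A \<Longrightarrow> h (x \<oplus>\<^bsub>A\<^esub> y) = h x \<oplus>\<^bsub>B\<^esub> h y"
     "x \<in> carrier A \<Longrightarrow> y \<in> carrier A \<Longrightarrow> h (x \<otimes>\<^bsub>A\<^esub> y) = h x \<otimes>\<^bsub>B\<^esub> h y"
     "x \<in> carrier A \<Longrightarrow> h (c \<odot>\<^bsub>A\<^esub> x) = c \<odot>\<^bsub>B\<^esub> h x" for x y c using h by (auto simp: alg_epi_def)
  have B: "abelian_group B"
  proof (rule abelian_groupI)
    fix x assume "x \<in> carrier B"
    then obtain a where a: "a \<in> carrier A" "x = h a" by (auto simp: c)
    then show "\<exists>y\<in>carrier B. y \<oplus>\<^bsub>B\<^esub> x = \<zero>\<^bsub>B\<^esub>"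
      by (intro bexI[of _ "h (\<ominus>\<^bsub>A\<^esub> a)"]) (auto simp: c l_neg)
  qed (auto simp: c a_ac)
  show ?thesis
    by (rule nonassoc_algebra.intro[OF B], rule nonassoc_algebra_axioms.intro)
      (auto simp: c add_mult mult_add smult_mult mult_smult smult_add add_smult smult_smult one_smult)
qed

lemma alg_epi_ideal:
  assumes "nonassoc_algebra A" and h: "alg_epi A B h" and P: "alg_ideal P A"
  shows "alg_ideal (h ` P) B"
proof -
  interpret A: nonassoc_algebra A by fact
  interpret B: nonassoc_algebra B by (rule alg_epi_algebra[OF assms(1,2)])
  have P': "P \<subseteq> carrier A" "\<zero>\<^bsub>A\<^esub> \<in> P" using P by (auto simp: A.alg_ideal_iff)
  have s [symmetric, simp]: "x \<in> carrier A \<Longrightarrow> y \<in> carrier A \<Longrightarrow> h (x \<oplus>\<^bsub>A\<^esub> y) = h x \<oplus>\<^bsub>B\<^esub> h y"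
     "x \<in> carrier A \<Longrightarrow> y \<in> carrier A \<Longrightarrow> h (x \<otimes>\<^bsub>A\<^esub> y) = h x \<otimes>\<^bsub>B\<^esub> h y"
     "x \<in> carrier A \<Longrightarrow> h (c \<odot>\<^bsub>A\<^esub> x) = c \<odot>\<^bsub>B\<^esub> h x" for x y c using h by (auto simp: alg_epi_def)
  have c: "carrier B = h ` carrier A" "\<zero>\<^bsub>B\<^esub> = h \<zero>\<^bsub>A\<^esub>" using h by (auto simp: alg_epi_def)
  show ?thesis unfolding B.alg_ideal_iff
    using P P' by (auto simp: c A.alg_ideal_iff subset_iff)
qed

text \<open>
  Well-definedness of the quotient operations: changing \<open>x\<close> and \<open>y\<close> by \<open>i\<close> and \<open>j\<close> in the ideal
  changes \<open>x \<otimes> y\<close> by \<open>i \<otimes> (j \<oplus> y) \<oplus> x \<otimes> j\<close>, which lies in the ideal again.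
\<close>

lemma alg_epi_quot:
  fixes A (structure)
  assumes "nonassoc_algebra A" and I: "alg_ideal I A"
  shows "alg_epi A (quot_alg A I) (\<lambda>x. I +>\<^bsub>A\<^esub> x)"
proof -
  interpret nonassoc_algebra A by fact
  interpret abelian_subgroup I A by (rule ideal_abelian_subgroup[OF I])
  have ic: "I \<subseteq> carrier A" "\<zero> \<in> I" and ia: "\<And>x y. x \<in> I \<Longrightarrow> y \<in> I \<Longrightarrow> x \<oplus> y \<in> I"
    and isc: "\<And>c x. x \<in> I \<Longrightarrow> c \<odot> x \<in> I" 
    and im: "\<And>x y. x \<in> I \<Longrightarrow> y \<in> carrier A \<Longrightarrow> x \<otimes> y \<in> I" "\<And>x y. x \<in> I \<Longrightarrow> y \<in> carrier A \<Longrightarrow> y \<otimes> x \<in> I"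
    using I by (auto simp: alg_ideal_iff)
  have m: "(I +> x) = (\<lambda>i. i \<oplus> x) ` I" for x by (auto simp: a_r_coset_def')
  have mult: "I +> x \<otimes> y = rcoset_mult A I (I +> x) (I +> y)" if xy: "x \<in> carrier A" "y \<in> carrier A" for x y
  proof -
    have "I +> (a \<otimes> b) = I +> x \<otimes> y" if ab: "a \<in> I +> x" "b \<in> I +> y" for a b
    proof -
      obtain i j where ij: "i \<in> I" "j \<in> I" "a = i \<oplus> x" "b = j \<oplus> y" using ab unfolding m by blast
      then have ic': "i \<in> carrier A" "j \<in> carrier A" using ic by auto
      have "a \<otimes> b = i \<otimes> (j \<oplus> y) \<oplus> (x \<otimes> j \<oplus> x \<otimes> y)"
        unfolding ij(3,4) using xy ic' by (simp add: add_mult mult_add a_ac)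
      also have "\<dots> = (i \<otimes> (j \<oplus> y) \<oplus> x \<otimes> j) \<oplus> x \<otimes> y"
        using xy ic' by (simp add: a_assoc)
      finally have "a \<otimes> b = (i \<otimes> (j \<oplus> y) \<oplus> x \<otimes> j) \<oplus> x \<otimes> y" .
      moreover have "i \<otimes> (j \<oplus> y) \<oplus> x \<otimes> j \<in> I" using xy ij(1,2) ic' by (intro ia im) simp_all
      moreover have "a \<otimes> b \<in> carrier A" "x \<otimes> y \<in> carrier A" using xy ic' by (simp_all add: ij(3,4))
      ultimately show ?thesis using coset_eq_iff[OF I] by blast
    qed
    moreover have "x \<in> I +> x" "y \<in> I +> y" using xy by (auto simp: a_rcos_self)
    ultimately show ?thesis unfolding rcoset_mult_def by blast
  qed
  have smult: "I +> c \<odot> x = (\<Union>a\<in>I +> x. I +> c \<odot> a)" if x: "x \<in> carrier A" for c x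
  proof -
    have "I +> (c \<odot> a) = I +> c \<odot> x" if ax: "a \<in> I +> x" for a
    proof -
      obtain i where i: "i \<in> I" "a = i \<oplus> x" using ax unfolding m by blast
      then have "i \<in> carrier A" using ic by auto
      with i x have "c \<odot> a = c \<odot> i \<oplus> c \<odot> x" "a \<in> carrier A" by (simp_all add: smult_add)
      then show ?thesis using x isc[OF i(1), of c] coset_eq_iff[OF I, of "c \<odot> a" "c \<odot> x"] by auto
    qed
    moreover have "x \<in> I +> x" using x by (auto simp: a_rcos_self)
    ultimately show ?thesis by blast
  qed
  show ?thesis
    unfolding alg_epi_def
    by (simp add: quot_alg_def a_rcos_sum mult smult)
      (use ic in \<open>auto simp: A_RCOSETS_def'\<close>)
qed

lemma alg_epi_ring:
  assumes "ring A" and h: "alg_epi A B h" and one: "h \<one>\<^bsub>A\<^esub> = \<one>\<^bsub>B\<^esub>"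
  shows "ring B"
proof -
  interpret A: ring A by fact
  have c: "carrier B = h ` carrier A" "\<zero>\<^bsub>B\<^esub> = h \<zero>\<^bsub>A\<^esub>" "\<one>\<^bsub>B\<^esub> = h \<one>\<^bsub>A\<^esub>" using h one by (auto simp: alg_epi_def)
  have s [symmetric, simp]: "x \<in> carrier A \<Longrightarrow> y \<in> carrier A \<Longrightarrow> h (x \<oplus>\<^bsub>A\<^esub> y) = h x \<oplus>\<^bsub>B\<^esub> h y"
     "x \<in> carrier A \<Longrightarrow> y \<in> carrier A \<Longrightarrow> h (x \<otimes>\<^bsub>A\<^esub> y) = h x \<otimes>\<^bsub>B\<^esub> h y" for x y using h by (auto simp: alg_epi_def)
  show ?thesis
  proof (rule ringI)
    show "abelian_group B"
    proof (rule abelian_groupI)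
      fix x assume "x \<in> carrier B"
      then obtain a where a: "a \<in> carrier A" "x = h a" by (auto simp: c)
      then show "\<exists>y\<in>carrier B. y \<oplus>\<^bsub>B\<^esub> x = \<zero>\<^bsub>B\<^esub>"
        by (intro bexI[of _ "h (\<ominus>\<^bsub>A\<^esub> a)"]) (auto simp: c A.l_neg)
    qed (auto simp: c A.a_ac)
    show "monoid B" by (rule monoidI) (auto simp: c A.m_assoc)
  qed (auto simp: c A.l_distr A.r_distr)
qed

lemma alg_epi_finsum:
  assumes "nonassoc_algebra A" and h: "alg_epi A B h" and "finite S" "\<And>i. i \<in> S \<Longrightarrow> g i \<in> carrier A"
  shows "finsum B (\<lambda>i. h (g i)) S = h (finsum A g S)"
proof -
  interpret A: nonassoc_algebra A by fact
  interpret B: nonassoc_algebra B by (rule alg_epi_algebra[OF assms(1,2)])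
  show ?thesis using assms(3,4)
  proof (induction S)
    case (insert i S)
    have "finsum B (\<lambda>i. h (g i)) (insert i S) = h (g i) \<oplus>\<^bsub>B\<^esub> finsum B (\<lambda>i. h (g i)) S"
      using insert h by (intro B.finsum_insert) (auto simp: alg_epi_def)
    also have "\<dots> = h (g i \<oplus>\<^bsub>A\<^esub> finsum A g S)" using insert h by (simp add: alg_epi_def A.finsum_closed Pi_iff)
    also have "g i \<oplus>\<^bsub>A\<^esub> finsum A g S = finsum A g (insert i S)"
      using insert by (intro A.finsum_insert[symmetric]) auto
    finally show ?case .
  qed (use h in \<open>auto simp: alg_epi_def\<close>)
qed

section \<open>Free algebras\<close>

lemma keys_pm_bilin:
  "Poly_Mapping.keys (pm_bilin t f g) \<subseteq> (\<lambda>(u, v). t u v) ` (Poly_Mapping.keys f \<times> Poly_Mapping.keys g)"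
  unfolding pm_bilin_def
  by (rule order.trans[OF keys_sum] UN_least)+ (auto split: if_splits)

lemma free_assoc_simps [simp]:
  "f \<in> carrier (free_assoc S) \<longleftrightarrow> Poly_Mapping.keys f \<subseteq> lists S"
  "f \<otimes>\<^bsub>free_assoc S\<^esub> g = f * g"
  "\<one>\<^bsub>free_assoc S\<^esub> = 1" "\<zero>\<^bsub>free_assoc S\<^esub> = 0"
  "f \<oplus>\<^bsub>free_assoc S\<^esub> g = f + g"
  "c \<odot>\<^bsub>free_assoc S\<^esub> f = pm_scale c f"
  by (simp_all add: free_assoc_def)

lemma free_nonassoc_simps [simp]:
  "f \<in> carrier (free_nonassoc S) \<longleftrightarrow> Poly_Mapping.keys f \<subseteq> {t. set_bracketing t \<subseteq> S}"
  "f \<otimes>\<^bsub>free_nonassoc S\<^esub> g = pm_bilin Br f g"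
  "\<zero>\<^bsub>free_nonassoc S\<^esub> = 0"
  "f \<oplus>\<^bsub>free_nonassoc S\<^esub> g = f + g"
  "c \<odot>\<^bsub>free_nonassoc S\<^esub> f = pm_scale c f"
  by (simp_all add: free_nonassoc_def)

lemma keys_add_subset: "Poly_Mapping.keys f \<subseteq> S \<Longrightarrow> Poly_Mapping.keys g \<subseteq> S \<Longrightarrow> Poly_Mapping.keys (f + g) \<subseteq> S"
  using keys_add[of f g] by blast

lemma keys_scale_subset: "Poly_Mapping.keys f \<subseteq> S \<Longrightarrow> Poly_Mapping.keys (pm_scale c f) \<subseteq> S"
  using keys_pm_scale[of c f] by blast

lemma keys_mult_subset:
  assumes "Poly_Mapping.keys f \<subseteq> lists S" "Poly_Mapping.keys g \<subseteq> lists S"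
  shows "Poly_Mapping.keys (f * g) \<subseteq> lists S"
proof -
  have "{a + b |a b. a \<in> Poly_Mapping.keys f \<and> b \<in> Poly_Mapping.keys g} \<subseteq> lists S"
    using assms by (auto simp: plus_list_def in_lists_conv_set subset_iff)
  then show ?thesis using keys_mult[of f g] by (rule order.trans[rotated])
qed

lemma keys_minus_subset: "Poly_Mapping.keys f \<subseteq> S \<Longrightarrow> Poly_Mapping.keys (- f) \<subseteq> S"
  by simp

lemma keys_letter: "Poly_Mapping.keys (letter x :: 'x list \<Rightarrow>\<^sub>0 'k::field) = {[x]}"
  by (simp add: letter_def)

lemma zero_in_lists [simp]: "(0 :: 'x list) \<in> lists S"
  by (simp add: zero_list_def)

lemma keys_one_subset: "Poly_Mapping.keys (1 :: 'x list \<Rightarrow>\<^sub>0 'k::field) \<subseteq> lists S"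
  by (simp add: zero_list_def)

lemma keys_diff_subset: "Poly_Mapping.keys f \<subseteq> S \<Longrightarrow> Poly_Mapping.keys g \<subseteq> S \<Longrightarrow> Poly_Mapping.keys (f - g) \<subseteq> S"
  using keys_diff[of f g] by blast

lemma keys_sum_subset: "(\<And>i. i \<in> A \<Longrightarrow> Poly_Mapping.keys (g i) \<subseteq> S) \<Longrightarrow> Poly_Mapping.keys (sum g A) \<subseteq> S"
  using keys_sum[of g A] by blast

lemmas keys_subset = keys_add_subset keys_scale_subset keys_mult_subset keys_minus_subset

lemma abelian_group_pm:
  fixes A :: "('c, 'x \<Rightarrow>\<^sub>0 'k::field) module"
  assumes "carrier A = {f. Poly_Mapping.keys f \<subseteq> S}" "\<zero>\<^bsub>A\<^esub> = 0" "add A = (+)"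
  shows "abelian_group A"
proof (rule abelian_groupI)
  fix f assume "f \<in> carrier A"
  then show "\<exists>g\<in>carrier A. g \<oplus>\<^bsub>A\<^esub> f = \<zero>\<^bsub>A\<^esub>" by (intro bexI[of _ "- f"]) (auto simp: assms)
qed (auto simp: assms keys_add_subset algebra_simps)

lemma ring_free_assoc: "ring (free_assoc S :: ('k::field, _) module)"
proof (rule ringI)
  show "abelian_group (free_assoc S :: ('k, _) module)"
    by (rule abelian_group_pm[where S = "lists S"]) (auto simp: free_assoc_def)
  show "monoid (free_assoc S :: ('k, _) module)"
    by (rule monoidI) (auto simp: keys_mult_subset mult.assoc zero_list_def)
qed (auto simp: algebra_simps)

lemma nonassoc_algebra_free_assoc: "nonassoc_algebra (free_assoc S :: ('k::field, _) module)"
proof (rule nonassoc_algebra.intro)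
  show "abelian_group (free_assoc S :: ('k, _) module)"
    by (rule abelian_group_pm[where S = "lists S"]) (auto simp: free_assoc_def)
qed (rule nonassoc_algebra_axioms.intro,
   simp_all add: keys_subset algebra_simps pm.scale_right_distrib pm.scale_left_distrib)

lemma carrier_free_assoc: "carrier (free_assoc S :: ('k::field, _) module) = {f. Poly_Mapping.keys f \<subseteq> lists S}"
  by (auto simp: free_assoc_def)

lemma alg_ideal_free_assoc:
  assumes "alg_ideal I (free_assoc S :: ('k::field, _) module)"
  shows "I \<subseteq> {f. Poly_Mapping.keys f \<subseteq> lists S}" "0 \<in> I"
    "f \<in> I \<Longrightarrow> g \<in> I \<Longrightarrow> f + g \<in> I" "f \<in> I \<Longrightarrow> pm_scale c f \<in> I"
    "f \<in> I \<Longrightarrow> Poly_Mapping.keys h \<subseteq> lists S \<Longrightarrow> h * f \<in> I"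
    "f \<in> I \<Longrightarrow> Poly_Mapping.keys h \<subseteq> lists S \<Longrightarrow> f * h \<in> I"
    "f \<in> I \<Longrightarrow> - f \<in> I" "f \<in> I \<Longrightarrow> g \<in> I \<Longrightarrow> f - g \<in> I"
    "(\<And>i. i \<in> A \<Longrightarrow> s i \<in> I) \<Longrightarrow> sum s A \<in> I"
proof -
  interpret nonassoc_algebra "free_assoc S :: ('k, _) module" by (rule nonassoc_algebra_free_assoc)
  have c: "carrier (free_assoc S :: ('k, _) module) = {f. Poly_Mapping.keys f \<subseteq> lists S}"
    by (auto simp: free_assoc_def)
  note I = assms[unfolded alg_ideal_iff c]
  show 1: "I \<subseteq> {f. Poly_Mapping.keys f \<subseteq> lists S}" "0 \<in> I" "f \<in> I \<Longrightarrow> g \<in> I \<Longrightarrow> f + g \<in> I"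
      "f \<in> I \<Longrightarrow> pm_scale c f \<in> I" 
      "f \<in> I \<Longrightarrow> Poly_Mapping.keys h \<subseteq> lists S \<Longrightarrow> h * f \<in> I"
      "f \<in> I \<Longrightarrow> Poly_Mapping.keys h \<subseteq> lists S \<Longrightarrow> f * h \<in> I" for f g c h
    using I by simp_all
  show m: "f \<in> I \<Longrightarrow> - f \<in> I" for f using 1(4)[of f "-1"] by simp
  show "f \<in> I \<Longrightarrow> g \<in> I \<Longrightarrow> f - g \<in> I" using 1(3)[of f "- g"] m[of g] by simp
  show "sum s A \<in> I" if "\<And>i. i \<in> A \<Longrightarrow> s i \<in> I"
    using that by (induction A rule: infinite_finite_induct) (auto intro: 1)
qed

lemma nonassoc_algebra_free_nonassoc: "nonassoc_algebra (free_nonassoc S :: ('k::field, _) module)"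
proof (rule nonassoc_algebra.intro)
  show "abelian_group (free_nonassoc S :: ('k, _) module)"
    by (rule abelian_group_pm[where S = "{t. set_bracketing t \<subseteq> S}"]) (auto simp: free_nonassoc_def)
next
  have "Poly_Mapping.keys (pm_bilin Br f g) \<subseteq> {t. set_bracketing t \<subseteq> S}"
    if "Poly_Mapping.keys f \<subseteq> {t. set_bracketing t \<subseteq> S}" "Poly_Mapping.keys g \<subseteq> {t. set_bracketing t \<subseteq> S}"
    for f g :: "'a bracketing \<Rightarrow>\<^sub>0 'k"
    by (rule order.trans[OF keys_pm_bilin]) (use that in \<open>auto dest!: subsetD\<close>)
  then show "nonassoc_algebra_axioms (free_nonassoc S :: ('k, _) module)"
    by (intro nonassoc_algebra_axioms.intro)
     (simp_all add: keys_subset pm.scale_right_distrib pm.scale_left_distrib)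
qed

section \<open>Bracket polynomials as commutators of words\<close>

definition commutator :: "('x list \<Rightarrow>\<^sub>0 'k::field) \<Rightarrow> ('x list \<Rightarrow>\<^sub>0 'k) \<Rightarrow> ('x list \<Rightarrow>\<^sub>0 'k)" where
  "commutator f g = f * g - g * f"

primrec br_word :: "'x bracketing \<Rightarrow> ('x list \<Rightarrow>\<^sub>0 'k::field)" where
  "br_word (Gen x) = letter x"
| "br_word (Br s t) = commutator (br_word s) (br_word t)"

text \<open>
  Evaluation of bracket polynomials as commutators of words, that is, the homomorphism from bracket
  polynomials into the free associative algebra with the commutator as multiplication.
\<close>

definition expand :: "('x bracketing \<Rightarrow>\<^sub>0 'k::field) \<Rightarrow> ('x list \<Rightarrow>\<^sub>0 'k)" where
  "expand = lin_ext br_word"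

lemma linear_expand: "pm_linear expand"
  unfolding expand_def by (rule linear_lin_ext)

lemmas expand_simps [simp] = pm.linear_0[OF linear_expand] pm.linear_add[OF linear_expand]
  pm.linear_scale[OF linear_expand] pm.linear_diff[OF linear_expand] pm.linear_sum[OF linear_expand]

lemma expand_single [simp]: "expand (Poly_Mapping.single t 1) = br_word t"
  by (simp add: expand_def)

lemma linear_comm: "pm_linear (commutator f)" "pm_linear (\<lambda>f. commutator f g)"
  by (rule pm_linearI; simp add: commutator_def algebra_simps pm.scale_right_diff_distrib)+

lemma linear_pm_bilin: "pm_linear (pm_bilin t f)" "pm_linear (\<lambda>f. pm_bilin t f g)"
  by (rule pm_linearI; simp)+

lemma expand_bracket: "expand (pm_bilin Br f g) = commutator (expand f) (expand g)"
proof -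
  have 1: "expand (pm_bilin Br (Poly_Mapping.single s 1) g) = commutator (expand (Poly_Mapping.single s 1)) (expand g)" for s
    by (rule pm_linear_eqI[where S = UNIV and f = g])
      (simp_all add: pm_linear_compose[OF linear_expand linear_pm_bilin(1)] pm_linear_compose[OF linear_comm(1) linear_expand])
  show ?thesis
    by (rule pm_linear_eqI[where S = UNIV and f = f])
      (simp_all add: 1 pm_linear_compose[OF linear_expand linear_pm_bilin(2)] pm_linear_compose[OF linear_comm(2) linear_expand])
qed

section \<open>Two-sided ideals of the algebra of words\<close>

definition two_sided :: "('x list \<Rightarrow>\<^sub>0 'k::field) set \<Rightarrow> bool" where
  "two_sided J \<longleftrightarrow> pm.subspace J \<and> (\<forall>x\<in>J. \<forall>f. f * x \<in> J \<and> x * f \<in> J)"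

lemma two_sided_simps:
  assumes "two_sided J"
  shows "0 \<in> J" "x \<in> J \<Longrightarrow> y \<in> J \<Longrightarrow> x + y \<in> J" "x \<in> J \<Longrightarrow> y \<in> J \<Longrightarrow> x - y \<in> J" "x \<in> J \<Longrightarrow> pm_scale c x \<in> J"
    "x \<in> J \<Longrightarrow> f * x \<in> J" "x \<in> J \<Longrightarrow> x * f \<in> J" "(\<And>i. i \<in> A \<Longrightarrow> g i \<in> J) \<Longrightarrow> sum g A \<in> J"
proof -
  have s: "pm.subspace J" using assms by (simp add: two_sided_def)
  show "0 \<in> J" "x \<in> J \<Longrightarrow> y \<in> J \<Longrightarrow> x + y \<in> J" "x \<in> J \<Longrightarrow> y \<in> J \<Longrightarrow> x - y \<in> J" "x \<in> J \<Longrightarrow> pm_scale c x \<in> J"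
    "(\<And>i. i \<in> A \<Longrightarrow> g i \<in> J) \<Longrightarrow> sum g A \<in> J"
    by (erule pm.subspace_0[OF s] pm.subspace_add[OF s] pm.subspace_diff[OF s] pm.subspace_scale[OF s]
        | rule pm.subspace_0[OF s] pm.subspace_sum[OF s] | assumption)+
  show "x \<in> J \<Longrightarrow> f * x \<in> J" "x \<in> J \<Longrightarrow> x * f \<in> J" using assms by (simp_all add: two_sided_def)
qed

text \<open>
  The two-sided ideal generated by \<open>S\<close>, as the span of all \<open>u r v\<close> with words \<open>u\<close>, \<open>v\<close>. Over the
  whole type this is more convenient than \<^const>\<open>gen_ideal\<close>: a linear map can be tested on the
  spanning elements, and these are homogeneous when the generators are.
\<close>

definition word_ideal :: "('x list \<Rightarrow>\<^sub>0 'k::field) set \<Rightarrow> ('x list \<Rightarrow>\<^sub>0 'k) set" where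
  "word_ideal S = pm.span {Poly_Mapping.single u 1 * r * Poly_Mapping.single v 1 | u r v. r \<in> S}"

lemma two_sided_word_ideal: "two_sided (word_ideal S)"
proof -
  let ?G = "{Poly_Mapping.single u 1 * r * Poly_Mapping.single v 1 | u r v. r \<in> S}"
  have l: "f * x \<in> word_ideal S" if x: "x \<in> word_ideal S" for f x
  proof -
    have "Poly_Mapping.single u 1 * x \<in> word_ideal S" for u
      using x unfolding word_ideal_def
    proof (induction rule: pm.span_induct_alt)
      case (step c y z)
      then have "Poly_Mapping.single u 1 * y \<in> ?G"
        by (force simp: mult_single simp flip: mult.assoc)
      then show ?case using step by (simp add: distrib_left pm.span_add pm.span_scale pm.span_base)
    qed (simp add: pm.span_zero)
    note basis = this
    show ?thesis using subset_UNIV[of "Poly_Mapping.keys f"]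
      by (induction rule: pm_induct)
        (use basis in \<open>auto simp: word_ideal_def distrib_right intro: pm.span_add pm.span_scale pm.span_zero\<close>)
  qed
  have r: "x * f \<in> word_ideal S" if x: "x \<in> word_ideal S" for f x
  proof -
    have "x * Poly_Mapping.single u 1 \<in> word_ideal S" for u
      using x unfolding word_ideal_def
    proof (induction rule: pm.span_induct_alt)
      case (step c y z)
      then have "y * Poly_Mapping.single u 1 \<in> ?G"
        by (force simp: mult_single mult.assoc)
      then show ?case using step by (simp add: distrib_right pm.span_add pm.span_scale pm.span_base)
    qed (simp add: pm.span_zero)
    note basis = this
    show ?thesis using subset_UNIV[of "Poly_Mapping.keys f"]
      by (induction rule: pm_induct)
        (use basis in \<open>auto simp: word_ideal_def distrib_left intro: pm.span_add pm.span_scale pm.span_zero\<close>)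
  qed
  show ?thesis unfolding two_sided_def using l r by (auto simp: word_ideal_def)
qed

lemma word_ideal_base: "S \<subseteq> word_ideal S"
proof
  fix r assume "r \<in> S"
  then have "Poly_Mapping.single [] 1 * r * Poly_Mapping.single [] 1 \<in> word_ideal S"
    unfolding word_ideal_def by (intro pm.span_base) blast
  then show "r \<in> word_ideal S" by simp
qed

section \<open>The grading by word length\<close>

definition homog :: "nat \<Rightarrow> ('x list \<Rightarrow>\<^sub>0 'k::field) \<Rightarrow> bool" where
  "homog d f \<longleftrightarrow> Poly_Mapping.keys f \<subseteq> {u. length u = d}"

definition degree_part :: "nat \<Rightarrow> ('x list \<Rightarrow>\<^sub>0 'k::field) \<Rightarrow> ('x list \<Rightarrow>\<^sub>0 'k)" where
  "degree_part d = lin_ext (\<lambda>u. if length u = d then Poly_Mapping.single u 1 else 0)"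

lemma linear_degree_part: "pm_linear (degree_part d)"
  unfolding degree_part_def by (rule linear_lin_ext)

lemmas degree_part_simps [simp] = pm.linear_0[OF linear_degree_part] pm.linear_add[OF linear_degree_part]
  pm.linear_scale[OF linear_degree_part] pm.linear_diff[OF linear_degree_part] pm.linear_sum[OF linear_degree_part]

lemma degree_part_single: "degree_part d (Poly_Mapping.single u 1) = (if length u = d then Poly_Mapping.single u 1 else 0)"
  by (simp add: degree_part_def)

lemma homog_mult:
  assumes "homog d f" "homog e g" shows "homog (d + e) (f * g)"
  unfolding homog_def
proof
  fix w assume "w \<in> Poly_Mapping.keys (f * g)"
  then obtain u v where "w = u @ v" "u \<in> Poly_Mapping.keys f" "v \<in> Poly_Mapping.keys g"
    using keys_mult[of f g] unfolding plus_list_def by blast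
  then show "w \<in> {w. length w = d + e}" using assms by (auto simp: homog_def)
qed

lemma homog_diff: "homog d f \<Longrightarrow> homog d g \<Longrightarrow> homog d (f - g)"
  using keys_diff[of f g] unfolding homog_def by blast

lemma homog_sum:
  assumes "\<And>i. i \<in> A \<Longrightarrow> homog d (g i)" shows "homog d (sum g A)"
proof -
  have "(\<Union>i\<in>A. Poly_Mapping.keys (g i)) \<subseteq> {u. length u = d}"
    using assms unfolding homog_def by blast
  then show ?thesis unfolding homog_def using keys_sum[of g A] by (rule order.trans[rotated])
qed

lemma homog_letter: "homog 1 (letter x)"
  by (auto simp: homog_def letter_def)

lemma homog_single: "homog (length u) (Poly_Mapping.single u 1)"
  by (auto simp: homog_def)

lemma homog_comm: "homog d f \<Longrightarrow> homog e g \<Longrightarrow> homog (d + e) (commutator f g)"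
  unfolding commutator_def using homog_mult[of d f e g] homog_mult[of e g d f] by (simp add: homog_diff add.commute)

lemma degree_part_homog:
  assumes "homog e f" shows "degree_part d f = (if d = e then f else 0)"
proof -
  have "pm_linear (\<lambda>f. if d = e then f else 0)"
    by (rule pm_linearI) simp_all
  from pm_linear_eqI[OF linear_degree_part this assms[unfolded homog_def]] show ?thesis
    by (simp add: degree_part_single)
qed

lemma degree_part_mult: "degree_part d (f * g) = (\<Sum>a\<le>d. degree_part a f * degree_part (d - a) g)"
proof -
  have 0: "degree_part d (Poly_Mapping.single u 1 * Poly_Mapping.single v 1) =
      (\<Sum>a\<le>d. degree_part a (Poly_Mapping.single u 1) * degree_part (d - a) (Poly_Mapping.single v (1::'b)))" for u v :: "'a list"
  proof (cases "d = length u + length v")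
    case True
    have "(\<Sum>a\<le>d. degree_part a (Poly_Mapping.single u 1) * degree_part (d - a) (Poly_Mapping.single v (1::'b))) =
       (\<Sum>a\<in>{length u}. Poly_Mapping.single u 1 * Poly_Mapping.single v 1)"
      using True by (intro sum.mono_neutral_cong_right) (auto simp: degree_part_single)
    then show ?thesis using True by (simp add: mult_single degree_part_single plus_list_def)
  next
    case False
    then have "degree_part a (Poly_Mapping.single u 1) * degree_part (d - a) (Poly_Mapping.single v (1::'b)) = 0" if "a \<le> d" for a
      using that by (auto simp: degree_part_single)
    then show ?thesis using False by (auto simp: mult_single degree_part_single plus_list_def)
  qed
  have lin: "pm_linear (\<lambda>g. \<Sum>a\<le>d. degree_part a f * degree_part (d - a) g)" "pm_linear (\<lambda>f. \<Sum>a\<le>d. degree_part a f * degree_part (d - a) g)" 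
    for f g :: "'a list \<Rightarrow>\<^sub>0 'b"
    by (rule pm_linearI; simp add: algebra_simps sum.distrib pm.scale_sum_right)+
  have 1: "degree_part d (Poly_Mapping.single u 1 * g) = (\<Sum>a\<le>d. degree_part a (Poly_Mapping.single u 1) * degree_part (d - a) g)" for u
    by (rule pm_linear_eqI[where S = UNIV and f = g])
      (use 0 in \<open>auto intro: lin pm_linear_compose[OF linear_degree_part linear_times(2)]\<close>)
  show ?thesis
    by (rule pm_linear_eqI[where S = UNIV and f = f])
      (use 1 in \<open>auto intro: lin pm_linear_compose[OF linear_degree_part linear_times(1)]\<close>)
qed

lemma sum_degree_part: 
  assumes "Poly_Mapping.keys f \<subseteq> {u. length u \<le> m}"
  shows "(\<Sum>d\<le>m. degree_part d f) = f"
proof (rule pm_linear_eqI[OF _ _ assms])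
  show "pm_linear (\<lambda>f. \<Sum>d\<le>m. degree_part d f)" "pm_linear (\<lambda>f. f)"
    by (rule pm_linearI; simp add: sum.distrib pm.scale_sum_right)+
qed (simp add: degree_part_single)

text \<open>
  An ideal with homogeneous generators is graded: each spanning element \<open>u r v\<close> is itself homogeneous,
  so its homogeneous parts are itself and \<open>0\<close>.
\<close>

lemma word_ideal_degree_part:
  assumes S: "\<And>r. r \<in> S \<Longrightarrow> \<exists>e. homog e r" and "x \<in> word_ideal S"
  shows "degree_part d x \<in> word_ideal S"
  using assms(2) unfolding word_ideal_def
proof (induction rule: pm.span_induct_alt)
  case base
  then show ?case by (simp add: pm.span_zero)
next
  case (step c y z)
  then obtain u r v where y: "y = Poly_Mapping.single u 1 * r * Poly_Mapping.single v 1" "r \<in> S" by blast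
  then obtain e where "homog e r" using S by blast
  then have "homog (length u + e + length v) y" unfolding y by (intro homog_mult homog_single)
  then have "degree_part d y = y \<or> degree_part d y = 0" by (simp add: degree_part_homog)
  then show ?case using step
    by (auto intro!: pm.span_add pm.span_scale pm.span_zero intro: pm.span_base)
qed

text \<open>
  For a graded ideal \<open>J\<close> this is the sum of \<open>J\<close> and the span of the words longer than \<open>m\<close>, in a form
  that makes the ideal laws immediate consequences of the formula for homogeneous parts of products.
\<close>

definition trunc_ideal :: "('x list \<Rightarrow>\<^sub>0 'k::field) set \<Rightarrow> nat \<Rightarrow> ('x list \<Rightarrow>\<^sub>0 'k) set" where
  "trunc_ideal J m = {f. \<forall>d\<le>m. degree_part d f \<in> J}"

lemma two_sided_trunc_ideal:
  assumes J: "two_sided J" shows "two_sided (trunc_ideal J m)"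
proof -
  have "pm.subspace J" using J by (simp add: two_sided_def)
  then have "pm.subspace (trunc_ideal J m)" by (auto simp: trunc_ideal_def pm.subspace_def)
  moreover have "f * x \<in> trunc_ideal J m \<and> x * f \<in> trunc_ideal J m" if "x \<in> trunc_ideal J m" for x f
    using that
    by (auto simp: trunc_ideal_def degree_part_mult intro!: two_sided_simps(7)[OF J]
      intro: two_sided_simps(5,6)[OF J])
  ultimately show ?thesis by (simp add: two_sided_def)
qed

text \<open>
  Multiplication by an element without constant term (modulo \<open>J\<close>) raises the filtration by one; this is
  what makes the lower central series descend.
\<close>

lemma trunc_ideal_mult:
  assumes "two_sided J" "f \<in> trunc_ideal J 0" "g \<in> trunc_ideal J m"
  shows "f * g \<in> trunc_ideal J (Suc m)" "g * f \<in> trunc_ideal J (Suc m)"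
proof -
  have f: "degree_part 0 f \<in> J" using assms(2) by (simp add: trunc_ideal_def)
  have g: "\<And>d. d \<le> m \<Longrightarrow> degree_part d g \<in> J" using assms(3) by (simp add: trunc_ideal_def)
  have "degree_part a f * degree_part (d - a) g \<in> J" if "a \<le> d" "d \<le> Suc m" for a d
  proof (cases "a = 0")
    case False
    then have "degree_part (d - a) g \<in> J" using that by (intro g) auto
    then show ?thesis by (rule two_sided_simps(5)[OF assms(1)])
  qed (auto intro: f two_sided_simps(6)[OF assms(1)])
  moreover have "degree_part a g * degree_part (d - a) f \<in> J" if "a \<le> d" "d \<le> Suc m" for a d
  proof (cases "a = d")
    case False
    then have "degree_part a g \<in> J" using that by (intro g) auto
    then show ?thesis by (rule two_sided_simps(6)[OF assms(1)])
  qed (auto intro: f two_sided_simps(5)[OF assms(1)])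
  ultimately show "f * g \<in> trunc_ideal J (Suc m)" "g * f \<in> trunc_ideal J (Suc m)"
    by (auto simp: trunc_ideal_def degree_part_mult intro!: two_sided_simps(7)[OF assms(1)])
qed

text \<open>
  An element is the sum of its finitely many homogeneous parts, so it lies in \<open>J\<close> if all of them up to
  the length of its longest word do.
\<close>

lemma trunc_ideal_separates:
  assumes J: "two_sided J" and f: "f \<notin> J"
  shows "\<exists>m\<ge>1. f \<notin> trunc_ideal J m"
proof -
  define m where "m = Suc (Max (insert 0 (length ` Poly_Mapping.keys f)))"
  have "length u \<le> m" if "u \<in> Poly_Mapping.keys f" for u
    using that Max_ge[of "insert 0 (length ` Poly_Mapping.keys f)" "length u"] by (auto simp: m_def intro: le_SucI)
  then have "(\<Sum>d\<le>m. degree_part d f) = f" by (intro sum_degree_part) auto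
  then have "f \<notin> trunc_ideal J m" using f two_sided_simps(7)[OF J, of "{..m}" "\<lambda>d. degree_part d f"]
    by (auto simp: trunc_ideal_def)
  then show ?thesis by (intro exI[of _ m]) (auto simp: m_def)
qed

section \<open>Matrix representations from ideals of finite codimension\<close>

text \<open>
  A representation by matrices with rows and columns in \<open>{1..N}\<close>. Matrices are functions of two naturals,
  so that their size can depend on the element to be separated.
\<close>

locale word_matrix_rep =
  fixes N :: nat and \<mu> :: "('x list \<Rightarrow>\<^sub>0 'k::field) \<Rightarrow> nat \<Rightarrow> nat \<Rightarrow> 'k"
  assumes mu_add: "\<mu> (s + t) a b = \<mu> s a b + \<mu> t a b"
    and mu_scale: "\<mu> (pm_scale c t) a b = c * \<mu> t a b"
    and mu_one: "a \<in> {1..N} \<Longrightarrow> b \<in> {1..N} \<Longrightarrow> \<mu> 1 a b = (if a = b then 1 else 0)"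
    and mu_mult: "b \<in> {1..N} \<Longrightarrow> \<mu> (s * t) a b = (\<Sum>c\<in>{1..N}. \<mu> s a c * \<mu> t c b)"

text \<open>
  The matrices of the left multiplications on the quotient by \<open>J\<close>. A basis of \<open>J\<close> is extended to a basis of
  the whole space by finitely many vectors \<open>e 1, \<dots>, e N\<close> from \<open>W\<close>, and \<open>\<mu> t a b\<close> is the coefficient
  of \<open>e a\<close> in \<open>t * e b\<close>. The kernel is exactly \<open>J\<close>: if \<open>t\<close> maps every \<open>e b\<close> into \<open>J\<close>, it maps
  \<open>1\<close> into \<open>J\<close>.
\<close>

lemma two_sided_matrix_rep:
  fixes J :: "('x list \<Rightarrow>\<^sub>0 'k::field) set"
  assumes J: "two_sided J" and proper: "J \<noteq> UNIV" and W: "finite W" "pm.span (J \<union> W) = UNIV"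
  obtains N :: nat and \<mu> :: "('x list \<Rightarrow>\<^sub>0 'k) \<Rightarrow> nat \<Rightarrow> nat \<Rightarrow> 'k" where
    "N \<ge> 1" "word_matrix_rep N \<mu>" "\<And>t. t \<in> J \<longleftrightarrow> (\<forall>a\<in>{1..N}. \<forall>b\<in>{1..N}. \<mu> t a b = 0)"
proof -
  have sJ: "pm.subspace J" using J by (simp add: two_sided_def)
  obtain B0 where B0: "B0 \<subseteq> J" "pm.independent B0" "J \<subseteq> pm.span B0"
    using pm.maximal_independent_subset[of J] by blast
  obtain B where B: "B0 \<subseteq> B" "B \<subseteq> J \<union> W" "pm.independent B" "J \<union> W \<subseteq> pm.span B"
    using pm.maximal_independent_subset_extend[of B0 "J \<union> W"] B0 by blast
  have spanB: "pm.span B = UNIV" using pm.span_mono[OF B(4)] W(2) by (auto simp: pm.span_span)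
  define C where "C = B - B0"
  have "C \<subseteq> W"
  proof
    fix x assume x: "x \<in> C"
    then have "x \<in> B" "x \<notin> pm.span (B - {x})" using B(3) by (auto simp: pm.dependent_def C_def)
    moreover have "pm.span B0 \<subseteq> pm.span (B - {x})" using x B(1) by (intro pm.span_mono) (auto simp: C_def)
    ultimately have "x \<notin> J" using B0(3) by auto
    then show "x \<in> W" using x B(2) by (auto simp: C_def)
  qed
  then have finC: "finite C" using W(1) finite_subset by blast
  define co where "co t c = pm.representation B t c" for t c
  note ind = B(3)
  have inspan: "t \<in> pm.span B" for t using spanB by simp
  have co_add: "co (s + t) c = co s c + co t c" for s t c
    unfolding co_def by (simp add: pm.representation_add[OF ind inspan inspan])
  have co_scale: "co (pm_scale k t) c = k * co t c" for k t c
    unfolding co_def by (simp add: pm.representation_scale[OF ind inspan])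
  have co_sum: "co (sum g A) c = (\<Sum>i\<in>A. co (g i) c)" for g c and A :: "'z set"
    unfolding co_def by (simp add: pm.representation_sum[OF ind inspan])
  have co_diff: "co (s - t) c = co s c - co t c" for s t c
    unfolding co_def by (simp add: pm.representation_diff[OF ind inspan inspan])
  have co_basis: "co b c = (if b = c then 1 else 0)" if "b \<in> C" for b c
    unfolding co_def using that by (subst pm.representation_basis[OF ind]) (auto simp: C_def)
  have co_J: "co t c = 0" if "t \<in> J" "c \<in> C" for t c
  proof -
    have "pm.representation B t = pm.representation B0 t"
      using that B0 B(1) by (intro pm.representation_extend[OF ind]) auto
    then show ?thesis using that pm.representation_ne_zero[of B0 t c] by (auto simp: co_def C_def)
  qed
  have J_if: "t \<in> J" if 0: "\<And>c. c \<in> C \<Longrightarrow> co t c = 0" for t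
  proof -
    \<comment> \<open>a vector without coordinates outside the basis of \<open>J\<close> is a combination of that basis\<close>
    have "(\<Sum>b | pm.representation B t b \<noteq> 0. pm_scale (pm.representation B t b) b) \<in> J"
    proof (rule pm.subspace_sum[OF sJ])
      fix b assume "b \<in> {b. pm.representation B t b \<noteq> 0}"
      then have "b \<in> B0" using 0[of b] pm.representation_ne_zero[of B t b] by (auto simp: co_def C_def)
      then show "pm_scale (pm.representation B t b) b \<in> J" using B0 sJ by (auto intro: pm.subspace_scale)
    qed
    then show ?thesis by (simp add: pm.sum_nonzero_representation_eq[OF ind inspan])
  qed
  have decomp: "t - (\<Sum>c\<in>C. pm_scale (co t c) c) \<in> J" for t
    by (rule J_if) (simp add: co_diff co_sum co_scale co_basis finC if_distrib[of "\<lambda>x. _ * x"] cong: if_cong)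
  define N where "N = card C"
  obtain e where e: "bij_betw e {1..N} C"
    using ex_bij_betw_nat_finite_1[OF finC] by (auto simp: N_def)
  have eC: "e a \<in> C" if "a \<in> {1..N}" for a using e that by (auto simp: bij_betw_def)
  have sum_e: "(\<Sum>c\<in>C. g c) = (\<Sum>a\<in>{1..N}. g (e a))" for g :: "_ \<Rightarrow> 'z::comm_monoid_add"
    by (rule sum.reindex_bij_betw[OF e, symmetric])
  define \<mu> where "\<mu> t a b = (if a \<in> {1..N} then co (t * e b) (e a) else 0)" for t a b
  have mult: "\<mu> (s * t) a b = (\<Sum>c\<in>{1..N}. \<mu> s a c * \<mu> t c b)" if "b \<in> {1..N}" for s t a b
  proof (cases "a \<in> {1..N}")
    case True
    let ?r = "t * e b - (\<Sum>c\<in>C. pm_scale (co (t * e b) c) c)"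
    have "s * t * e b = s * ?r + (\<Sum>c\<in>C. pm_scale (co (t * e b) c) (s * c))"
      by (simp add: algebra_simps sum_distrib_left)
    then have "co (s * t * e b) (e a) = (\<Sum>c\<in>C. co (t * e b) c * co (s * c) (e a))"
      using co_J[OF two_sided_simps(5)[OF J decomp] eC[OF True]] by (simp add: co_add co_sum co_scale)
    also have "\<dots> = (\<Sum>c\<in>{1..N}. co (t * e b) (e c) * co (s * e c) (e a))" by (rule sum_e)
    finally show ?thesis using True by (simp add: \<mu>_def mult.commute)
  next
    case False
    then show ?thesis by (simp add: \<mu>_def del: atLeastAtMost_iff)
  qed
  have ker: "t \<in> J \<longleftrightarrow> (\<forall>a\<in>{1..N}. \<forall>b\<in>{1..N}. \<mu> t a b = 0)" for t
  proof
    assume "t \<in> J"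
    then show "\<forall>a\<in>{1..N}. \<forall>b\<in>{1..N}. \<mu> t a b = 0"
      by (auto simp: \<mu>_def intro!: co_J eC two_sided_simps[OF J])
  next
    assume 0: "\<forall>a\<in>{1..N}. \<forall>b\<in>{1..N}. \<mu> t a b = 0"
    have C: "t * c \<in> J" if c: "c \<in> C" for c
    proof (rule J_if)
      fix d assume "d \<in> C"
      then obtain a where "a \<in> {1..N}" "d = e a" using e by (metis bij_betw_def imageE)
      moreover obtain b where "b \<in> {1..N}" "c = e b" using e c by (metis bij_betw_def imageE)
      ultimately show "co (t * c) d = 0" using 0 by (auto simp: \<mu>_def)
    qed
    have "t * (1 - (\<Sum>c\<in>C. pm_scale (co 1 c) c)) + (\<Sum>c\<in>C. pm_scale (co 1 c) (t * c)) \<in> J"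
      by (intro two_sided_simps(2,4,5,7)[OF J] decomp C)
    then show "t \<in> J" by (simp add: algebra_simps sum_distrib_left)
  qed
  show thesis
  proof (rule that[of N \<mu>])
    show "N \<ge> 1"
    proof (rule ccontr)
      assume "\<not> N \<ge> 1"
      then have "t \<in> J" for t using ker[of t] by simp
      then show False using proper by blast
    qed
    show "word_matrix_rep N \<mu>"
    proof
      show "\<mu> (s + t) a b = \<mu> s a b + \<mu> t a b" "\<mu> (pm_scale c t) a b = c * \<mu> t a b" for s t a b c
        by (simp_all add: \<mu>_def distrib_right co_add co_scale)
      show "\<mu> 1 a b = (if a = b then 1 else 0)" if "a \<in> {1..N}" "b \<in> {1..N}" for a b
      proof -
        have "e b = e a \<longleftrightarrow> b = a"
          by (rule inj_on_eq_iff[OF bij_betw_imp_inj_on[OF e] that(2,1)])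
        moreover have "\<mu> 1 a b = co (e b) (e a)" using that(1) by (simp only: \<mu>_def if_True mult_1_left)
        ultimately show ?thesis using co_basis[OF eC[OF that(2)], of "e a"] by auto
      qed
      show "\<mu> (s * t) a b = (\<Sum>c\<in>{1..N}. \<mu> s a c * \<mu> t c b)" if "b \<in> {1..N}" for s t a b
        by (rule mult[OF that])
    qed
    show "t \<in> J \<longleftrightarrow> (\<forall>a\<in>{1..N}. \<forall>b\<in>{1..N}. \<mu> t a b = 0)" for t by (rule ker)
  qed
qed

section \<open>The Jordan-Schwinger map into the Weyl algebra\<close>

definition weyl_gens :: "nat \<Rightarrow> weyl_gen set" where
  "weyl_gens N = Weyl_P ` {1..N} \<union> Weyl_Q ` {1..N}"

definition weyl_ideal :: "nat \<Rightarrow> (weyl_gen list \<Rightarrow>\<^sub>0 'k::field) set" where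
  "weyl_ideal N = gen_ideal (free_assoc (weyl_gens N)) (weyl_relations N)"

lemma weyl_algebra_eq: "weyl_algebra N = quot_alg (free_assoc (weyl_gens N)) (weyl_ideal N)"
  by (simp add: weyl_algebra_def weyl_ideal_def weyl_gens_def)

lemma weyl_relations_subset: "weyl_relations N \<subseteq> carrier (free_assoc (weyl_gens N) :: ('k::field, _) module)"
proof -
  have "Poly_Mapping.keys (letter x * letter y - letter y * letter x :: weyl_gen list \<Rightarrow>\<^sub>0 'k) \<subseteq> lists (weyl_gens N)"
    if "x \<in> weyl_gens N" "y \<in> weyl_gens N" for x y
    using that by (intro keys_diff_subset keys_mult_subset) (auto simp: keys_letter)
  note commutator = this
  show ?thesis
  proof
    fix f :: "weyl_gen list \<Rightarrow>\<^sub>0 'k" assume "f \<in> weyl_relations N"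
    then consider i j where "i \<in> {1..N}" "j \<in> {1..N}"
        "f = letter (Weyl_P i) * letter (Weyl_Q j) - letter (Weyl_Q j) * letter (Weyl_P i) - (if i = j then 1 else 0)"
      | i j where "i \<in> {1..N}" "j \<in> {1..N}" "f = letter (Weyl_P i) * letter (Weyl_P j) - letter (Weyl_P j) * letter (Weyl_P i)"
      | i j where "i \<in> {1..N}" "j \<in> {1..N}" "f = letter (Weyl_Q i) * letter (Weyl_Q j) - letter (Weyl_Q j) * letter (Weyl_Q i)"
      unfolding weyl_relations_def Let_def pm_bilin_append single_Nil_one by blast
    then have "Poly_Mapping.keys f \<subseteq> lists (weyl_gens N)"
    proof cases
      case 1
      have "Poly_Mapping.keys (if i = j then 1 else 0 :: weyl_gen list \<Rightarrow>\<^sub>0 'k) \<subseteq> lists (weyl_gens N)"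
        by (auto simp: zero_list_def)
      with 1 show ?thesis by (simp only:) (intro keys_diff_subset[OF commutator], auto simp: weyl_gens_def)
    qed (simp_all only:, (intro commutator; simp add: weyl_gens_def)+)
    then show "f \<in> carrier (free_assoc (weyl_gens N))" by simp
  qed
qed

lemma alg_ideal_weyl: "alg_ideal (weyl_ideal N) (free_assoc (weyl_gens N) :: ('k::field, _) module)"
  unfolding weyl_ideal_def
  by (rule nonassoc_algebra.alg_ideal_gen_ideal[OF nonassoc_algebra_free_assoc weyl_relations_subset])

lemmas weyl_ideal_simps = alg_ideal_free_assoc[OF alg_ideal_weyl]

abbreviation (input) wp :: "nat \<Rightarrow> weyl_gen list \<Rightarrow>\<^sub>0 'k::field" where "wp i \<equiv> letter (Weyl_P i)"
abbreviation (input) wq :: "nat \<Rightarrow> weyl_gen list \<Rightarrow>\<^sub>0 'k::field" where "wq i \<equiv> letter (Weyl_Q i)"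

lemma weyl_commutation:
  assumes "i \<in> {1..N}" "j \<in> {1..N}"
  shows "wp i * wq j - wq j * wp i - (if i = j then 1 else 0) \<in> weyl_ideal N"
    "wp i * wp j - wp j * wp i \<in> weyl_ideal N" "wq i * wq j - wq j * wq i \<in> weyl_ideal N"
proof -
  have s: "weyl_relations N \<subseteq> weyl_ideal N" unfolding weyl_ideal_def by (rule gen_ideal_superset)
  show "wp i * wq j - wq j * wp i - (if i = j then 1 else 0) \<in> weyl_ideal N"
    "wp i * wp j - wp j * wp i \<in> weyl_ideal N" "wq i * wq j - wq j * wq i \<in> weyl_ideal N"
    by (rule subsetD[OF s], use assms in \<open>unfold weyl_relations_def Let_def pm_bilin_append single_Nil_one, blast\<close>)+
qed

text \<open>
  The Jordan-Schwinger map: the matrix unit \<open>E\<^sub>a\<^sub>b\<close> goes to \<open>q\<^sub>a p\<^sub>b\<close>. It turns every matrix into a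
  differential operator of order one whose action on the span of the variables \<open>q\<^sub>1, \<dots>, q\<^sub>N\<close> is the
  action of the matrix on column vectors.
\<close>

definition jordan_schwinger :: "nat \<Rightarrow> (nat \<Rightarrow> nat \<Rightarrow> 'k::field) \<Rightarrow> (weyl_gen list \<Rightarrow>\<^sub>0 'k)" where
  "jordan_schwinger N M = (\<Sum>a\<in>{1..N}. \<Sum>b\<in>{1..N}. pm_scale (M a b) (wq a * wp b))"

lemma keys_wpq: "i \<in> {1..N} \<Longrightarrow> Poly_Mapping.keys (wp i) \<subseteq> lists (weyl_gens N)" "i \<in> {1..N} \<Longrightarrow> Poly_Mapping.keys (wq i) \<subseteq> lists (weyl_gens N)"
  by (auto simp: keys_letter weyl_gens_def)

lemma keys_jordan_schwinger: "Poly_Mapping.keys (jordan_schwinger N M) \<subseteq> lists (weyl_gens N)"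
  unfolding jordan_schwinger_def by (intro keys_sum_subset keys_scale_subset keys_mult_subset keys_wpq)

text \<open>
  The relation \<open>[E\<^sub>a\<^sub>b, E\<^sub>c\<^sub>d] = \<delta>\<^sub>b\<^sub>c E\<^sub>a\<^sub>d - \<delta>\<^sub>a\<^sub>d E\<^sub>c\<^sub>b\<close> holds for \<open>q\<^sub>a p\<^sub>b\<close> modulo the Weyl
  relations: move \<open>p\<^sub>b\<close> past \<open>q\<^sub>c\<close> and \<open>p\<^sub>d\<close> past \<open>q\<^sub>a\<close>, then interchange the commuting factors.
\<close>

lemma weyl_matrix_units:
  assumes "a \<in> {1..N}" "b \<in> {1..N}" "c \<in> {1..N}" "d \<in> {1..N}"
  shows "commutator (wq a * wp b) (wq c * wp d) - (if b = c then wq a * wp d else 0) + (if a = d then wq c * wp b else 0)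
    \<in> weyl_ideal N"
proof -
  \<comment> \<open>the left-hand side of the claim, as a combination of the defining relations\<close>
  have "wq a * (wp b * wq c - wq c * wp b - (if b = c then 1 else 0)) * wp d
     - wq c * (wp d * wq a - wq a * wp d - (if d = a then 1 else 0)) * wp b
     + (wq a * wq c - wq c * wq a) * (wp b * wp d) + (wq c * wq a) * (wp b * wp d - wp d * wp b) \<in> weyl_ideal N"
    by (intro weyl_ideal_simps weyl_commutation keys_mult_subset keys_wpq assms)
  also have "wq a * (wp b * wq c - wq c * wp b - (if b = c then 1 else 0)) * wp d
     - wq c * (wp d * wq a - wq a * wp d - (if d = a then 1 else 0)) * wp b
     + (wq a * wq c - wq c * wq a) * (wp b * wp d) + (wq c * wq a) * (wp b * wp d - wp d * wp b)
    = commutator (wq a * wp b) (wq c * wp d) - (if b = c then wq a * wp d else 0) + (if a = d then wq c * wp b else 0)"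
    by (auto simp: commutator_def algebra_simps)
  finally show ?thesis .
qed

definition mat_mult :: "nat \<Rightarrow> (nat \<Rightarrow> nat \<Rightarrow> 'k::field) \<Rightarrow> (nat \<Rightarrow> nat \<Rightarrow> 'k) \<Rightarrow> nat \<Rightarrow> nat \<Rightarrow> 'k" where
  "mat_mult N M M' a b = (\<Sum>c\<in>{1..N}. M a c * M' c b)"

text \<open>
  The previous relation extended bilinearly. So the Jordan-Schwinger map is a homomorphism of Lie
  algebras into the Weyl algebra, although it does not respect products.
\<close>

lemma jordan_schwinger_commutator:
  fixes M M' :: "nat \<Rightarrow> nat \<Rightarrow> 'k::field"
  shows "commutator (jordan_schwinger N M) (jordan_schwinger N M') - jordan_schwinger N (\<lambda>a b. mat_mult N M M' a b - mat_mult N M' M a b) \<in> weyl_ideal N"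
proof -
  let ?I = "{1..N}"
  define E :: "nat \<Rightarrow> nat \<Rightarrow> weyl_gen list \<Rightarrow>\<^sub>0 'k" where "E a b = wq a * wp b" for a b
  have units: "jordan_schwinger N M = (\<Sum>a\<in>?I. \<Sum>b\<in>?I. pm_scale (M a b) (E a b))" for M
    by (simp add: jordan_schwinger_def E_def)
  define T where "T a b c d = commutator (E a b) (E c d) - (if b = c then E a d else 0) + (if a = d then E c b else 0)" for a b c d
  have T: "(\<Sum>a\<in>?I. \<Sum>b\<in>?I. \<Sum>c\<in>?I. \<Sum>d\<in>?I. pm_scale (M a b * M' c d) (T a b c d)) \<in> weyl_ideal N"
    unfolding T_def E_def by (intro weyl_ideal_simps(9,4) weyl_matrix_units)
  have 1: "commutator (jordan_schwinger N M) (jordan_schwinger N M') = (\<Sum>a\<in>?I. \<Sum>b\<in>?I. \<Sum>c\<in>?I. \<Sum>d\<in>?I. pm_scale (M a b * M' c d) (commutator (E a b) (E c d)))"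
  proof -
    have "commutator (jordan_schwinger N M) (jordan_schwinger N M') = (\<Sum>a\<in>?I. \<Sum>b\<in>?I. pm_scale (M a b) (commutator (E a b) (jordan_schwinger N M')))"
      by (simp only: units[of M] pm.linear_sum[OF linear_comm(2)] pm.linear_scale[OF linear_comm(2)])
    then show ?thesis
      by (simp only: units[of M'] pm.linear_sum[OF linear_comm(1)] pm.linear_scale[OF linear_comm(1)]
         pm.scale_sum_right pm.scale_scale)
  qed
  have 2: "jordan_schwinger N (mat_mult N M M') = (\<Sum>a\<in>?I. \<Sum>b\<in>?I. \<Sum>c\<in>?I. \<Sum>d\<in>?I. pm_scale (M a b * M' c d) (if b = c then E a d else 0))"
  proof -
    have "(\<Sum>b\<in>?I. \<Sum>c\<in>?I. \<Sum>d\<in>?I. pm_scale (M a b * M' c d) (if b = c then E a d else 0)) =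
        (\<Sum>d\<in>?I. pm_scale (mat_mult N M M' a d) (E a d))" for a
    proof -
      have "(\<Sum>c\<in>?I. \<Sum>d\<in>?I. pm_scale (M a b * M' c d) (if b = c then E a d else 0)) =
        (\<Sum>d\<in>?I. pm_scale (M a b * M' b d) (E a d))" if "b \<in> ?I" for b
        by (subst sum.swap, rule sum.cong[OF refl])
           (use that in \<open>simp add: if_distrib[of "pm_scale _"] cong: if_cong\<close>)
      note eq = this
      have "(\<Sum>b\<in>?I. \<Sum>c\<in>?I. \<Sum>d\<in>?I. pm_scale (M a b * M' c d) (if b = c then E a d else 0)) =
        (\<Sum>b\<in>?I. \<Sum>d\<in>?I. pm_scale (M a b * M' b d) (E a d))" by (rule sum.cong[OF refl], rule eq)
      also have "\<dots> = (\<Sum>d\<in>?I. \<Sum>b\<in>?I. pm_scale (M a b * M' b d) (E a d))" by (rule sum.swap)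
      finally show ?thesis by (simp add: mat_mult_def pm.scale_sum_left)
    qed
    then show ?thesis by (simp add: units)
  qed
  have 3: "jordan_schwinger N (mat_mult N M' M) = (\<Sum>a\<in>?I. \<Sum>b\<in>?I. \<Sum>c\<in>?I. \<Sum>d\<in>?I. pm_scale (M a b * M' c d) (if a = d then E c b else 0))"
  proof -
    have "(\<Sum>c\<in>?I. \<Sum>d\<in>?I. pm_scale (M a b * M' c d) (if a = d then E c b else 0)) =
       (\<Sum>c\<in>?I. pm_scale (M' c a * M a b) (E c b))" if "a \<in> ?I" for a b
      by (rule sum.cong[OF refl]) (use that in \<open>simp add: if_distrib[of "pm_scale _"] mult.commute cong: if_cong\<close>)
    note eq = this
    have "(\<Sum>a\<in>?I. \<Sum>b\<in>?I. \<Sum>c\<in>?I. \<Sum>d\<in>?I. pm_scale (M a b * M' c d) (if a = d then E c b else 0)) =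
       (\<Sum>a\<in>?I. \<Sum>b\<in>?I. \<Sum>c\<in>?I. pm_scale (M' c a * M a b) (E c b))"
      by (rule sum.cong[OF refl], rule sum.cong[OF refl], rule eq)
    also have "\<dots> = (\<Sum>b\<in>?I. \<Sum>a\<in>?I. \<Sum>c\<in>?I. pm_scale (M' c a * M a b) (E c b))" by (rule sum.swap)
    also have "\<dots> = (\<Sum>b\<in>?I. \<Sum>c\<in>?I. \<Sum>a\<in>?I. pm_scale (M' c a * M a b) (E c b))"
      by (rule sum.cong[OF refl], rule sum.swap)
    also have "\<dots> = (\<Sum>c\<in>?I. \<Sum>b\<in>?I. \<Sum>a\<in>?I. pm_scale (M' c a * M a b) (E c b))" by (rule sum.swap)
    finally show ?thesis by (simp add: units mat_mult_def pm.scale_sum_left)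
  qed
  have "jordan_schwinger N (\<lambda>a b. mat_mult N M M' a b - mat_mult N M' M a b) = jordan_schwinger N (mat_mult N M M') - jordan_schwinger N (mat_mult N M' M)"
    by (simp add: units pm.scale_left_diff_distrib sum_subtractf)
  then have "commutator (jordan_schwinger N M) (jordan_schwinger N M') - jordan_schwinger N (\<lambda>a b. mat_mult N M M' a b - mat_mult N M' M a b) =
      commutator (jordan_schwinger N M) (jordan_schwinger N M') - jordan_schwinger N (mat_mult N M M') + jordan_schwinger N (mat_mult N M' M)" by simp
  also have "\<dots> = (\<Sum>a\<in>?I. \<Sum>b\<in>?I. \<Sum>c\<in>?I. \<Sum>d\<in>?I. pm_scale (M a b * M' c d) (T a b c d))"
    unfolding 1 2 3 T_def
    by (simp only: sum_subtractf sum.distrib pm.scale_right_diff_distrib pm.scale_right_distrib)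
  finally show ?thesis using T by simp
qed

section \<open>The Weyl algebra acting on polynomials\<close>

definition nth_prime :: "nat \<Rightarrow> nat" where
  "nth_prime i = enumerate {p. prime p} i"

lemma prime_nth_prime [simp]: "prime (nth_prime i)"
  using enumerate_in_set[OF primes_infinite] by (simp add: nth_prime_def)

lemma nth_prime_eq_iff [simp]: "nth_prime i = nth_prime j \<longleftrightarrow> i = j"
  unfolding nth_prime_def
  using strict_mono_enumerate[OF primes_infinite] strict_mono_eq by blast

text \<open>
  Polynomials in the variables \<open>q\<^sub>0, q\<^sub>1, \<dots>\<close> are coded by finitely supported functions on the naturals:
  the monomial \<open>\<Prod>\<^sub>i q\<^sub>i\<^bsup>e i\<^esup>\<close> corresponds to the positive integer \<open>\<Prod>\<^sub>i (nth_prime i)\<^bsup>e i\<^esup>\<close>, and the integer \<open>n\<close>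
  has basis index \<open>n - 1\<close>, so that the naturals index all monomials. In particular \<open>monomial 1\<close> is the
  constant polynomial and \<open>monomial (nth_prime i)\<close> is \<open>q\<^sub>i\<close>.
\<close>

definition monomial :: "nat \<Rightarrow> (nat \<Rightarrow>\<^sub>0 'k::field)" where
  "monomial n = Poly_Mapping.single (n - 1) 1"

lemma single_eq_monomial: "Poly_Mapping.single k 1 = monomial (Suc k)"
  by (simp add: monomial_def)

text \<open>
  \<open>Weyl_Q i\<close> multiplies by \<open>q\<^sub>i\<close> and \<open>Weyl_P i\<close> is the partial derivative, the exponent of \<open>q\<^sub>i\<close> being
  a prime multiplicity. If the exponent is \<open>0\<close>, the division is inexact, but then the
  coefficient is \<open>0\<close>, as it should be for a derivative.
\<close>

primrec weyl_op :: "weyl_gen \<Rightarrow> (nat \<Rightarrow>\<^sub>0 'k::field) \<Rightarrow> (nat \<Rightarrow>\<^sub>0 'k)" where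
  "weyl_op (Weyl_P i) = lin_ext (\<lambda>k. pm_scale (of_nat (multiplicity (nth_prime i) (Suc k))) (monomial (Suc k div nth_prime i)))"
| "weyl_op (Weyl_Q i) = lin_ext (\<lambda>k. monomial (Suc k * nth_prime i))"

lemma linear_weyl_op: "pm_linear (weyl_op x)"
  by (cases x) (simp_all add: linear_lin_ext)

lemma weyl_op_P:
  assumes "n > 0"
  shows "weyl_op (Weyl_P i) (monomial n) = pm_scale (of_nat (multiplicity (nth_prime i) n)) (monomial (n div nth_prime i))"
  using assms by (cases n) (simp_all add: monomial_def[of "Suc _"])

lemma weyl_op_Q:
  assumes "n > 0" shows "weyl_op (Weyl_Q i) (monomial n) = monomial (n * nth_prime i)"
  using assms by (cases n) (simp_all add: monomial_def[of "Suc _"])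

declare weyl_op.simps [simp del]

lemmas weyl_op_simps [simp] = pm.linear_0[OF linear_weyl_op] pm.linear_add[OF linear_weyl_op] pm.linear_scale[OF linear_weyl_op]
  pm.linear_sum[OF linear_weyl_op]

lemma weyl_op_commutation_basis:
  fixes n :: nat assumes n: "n > 0"
  shows "weyl_op (Weyl_P i) (weyl_op (Weyl_Q j) (monomial n)) = weyl_op (Weyl_Q j) (weyl_op (Weyl_P i) (monomial n)) + (if i = j then monomial n else (0 :: _ \<Rightarrow>\<^sub>0 'k::field))"
    "weyl_op (Weyl_P i) (weyl_op (Weyl_P j) (monomial n)) = weyl_op (Weyl_P j) (weyl_op (Weyl_P i) (monomial n :: _ \<Rightarrow>\<^sub>0 'k))"
    "weyl_op (Weyl_Q i) (weyl_op (Weyl_Q j) (monomial n)) = weyl_op (Weyl_Q j) (weyl_op (Weyl_Q i) (monomial n :: _ \<Rightarrow>\<^sub>0 'k))"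
proof -
  let ?p = nth_prime
  have pos: "?p i > 0" for i using prime_gt_0_nat[OF prime_nth_prime] .
  have mult: "multiplicity (?p i) (m * ?p j) = multiplicity (?p i) m + (if i = j then 1 else 0)" if "m > 0" for m i j
    using that pos[of j] prime_nth_prime[of i] prime_nth_prime[of j]
    by (subst prime_elem_multiplicity_mult_distrib)
      (auto simp: prime_multiplicity_other multiplicity_prime prime_imp_prime_elem simp del: prime_nth_prime)
  have not: "multiplicity (?p i) m = 0" if "\<not> ?p i dvd m" for i m
    using that by (rule not_dvd_imp_multiplicity_0)
  have Pm: "weyl_op (Weyl_P i) (monomial (m * ?p i)) = pm_scale (of_nat (Suc (multiplicity (?p i) m))) (monomial m :: _ \<Rightarrow>\<^sub>0 'k)"
    if "m > 0" for m i
    using that pos[of i] by (subst weyl_op_P) (auto simp: mult)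
  have P0: "weyl_op (Weyl_P i) (monomial m) = (0 :: _ \<Rightarrow>\<^sub>0 'k)" if "m > 0" "\<not> ?p i dvd m" for m i
    using that by (subst weyl_op_P) (auto simp: not)
  have cases: "(\<exists>m>0. l = m * ?p i) \<or> \<not> ?p i dvd l" if "l > 0" for l i
    using that by (auto simp: dvd_def mult.commute)
  have mult': "multiplicity (?p i) (m * ?p j) = multiplicity (?p i) m" "m * ?p j > 0" if "m > 0" "i \<noteq> j" for m i j
    using that pos[of j] mult[of m i j] by simp_all
  show "weyl_op (Weyl_Q i) (weyl_op (Weyl_Q j) (monomial n)) = weyl_op (Weyl_Q j) (weyl_op (Weyl_Q i) (monomial n :: _ \<Rightarrow>\<^sub>0 'k))"
    using n pos by (simp add: weyl_op_Q mult_ac)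
  have ndvd: "\<not> ?p i dvd m * ?p j" if "i \<noteq> j" "\<not> ?p i dvd m" for i j m
    using that by (simp add: prime_dvd_mult_iff primes_dvd_imp_eq) (metis nth_prime_eq_iff prime_nth_prime primes_dvd_imp_eq)
  show "weyl_op (Weyl_P i) (weyl_op (Weyl_Q j) (monomial n)) = weyl_op (Weyl_Q j) (weyl_op (Weyl_P i) (monomial n)) + (if i = j then monomial n else (0 :: _ \<Rightarrow>\<^sub>0 'k))"
  proof (cases "i = j")
    case True
    show ?thesis using cases[OF n, of i]
    proof
      assume "\<exists>m>0. n = m * ?p i"
      then obtain m where m: "m > 0" "n = m * ?p i" by blast
      have "weyl_op (Weyl_P i) (weyl_op (Weyl_Q j) (monomial n)) = pm_scale (of_nat (Suc (multiplicity (?p i) n))) (monomial n :: _ \<Rightarrow>\<^sub>0 'k)"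
        using n True by (simp only: weyl_op_Q Pm)
      moreover have "multiplicity (?p i) n = Suc (multiplicity (?p i) m)" using mult[OF m(1), of i i] m(2) by simp
      then have "weyl_op (Weyl_Q j) (weyl_op (Weyl_P i) (monomial n)) = pm_scale (of_nat (multiplicity (?p i) n)) (monomial n :: _ \<Rightarrow>\<^sub>0 'k)"
        unfolding m(2) using m(1) True by (simp only: Pm weyl_op_simps weyl_op_Q)
      ultimately show ?thesis using True
        by (simp add: pm.scale_left_distrib add.commute)
    next
      assume "\<not> ?p i dvd n"
      then show ?thesis using True not n by (simp add: weyl_op_Q Pm P0)
    qed
  next
    case False
    show ?thesis using cases[OF n, of i]
    proof
      assume "\<exists>m>0. n = m * ?p i"
      then obtain m where m: "m > 0" "n = m * ?p i" by blast
      have "weyl_op (Weyl_P i) (monomial (m * ?p j * ?p i)) = pm_scale (of_nat (Suc (multiplicity (?p i) m))) (monomial (m * ?p j) :: _ \<Rightarrow>\<^sub>0 'k)"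
        using Pm[OF mult'(2)[OF m(1) False], of i] by (simp only: mult'(1)[OF m(1) False])
      moreover have "weyl_op (Weyl_Q j) (monomial n) = (monomial (m * ?p j * ?p i) :: _ \<Rightarrow>\<^sub>0 'k)"
        using n by (simp only: weyl_op_Q) (simp only: m(2) mult_ac)
      moreover have "weyl_op (Weyl_Q j) (weyl_op (Weyl_P i) (monomial n)) = pm_scale (of_nat (Suc (multiplicity (?p i) m))) (monomial (m * ?p j) :: _ \<Rightarrow>\<^sub>0 'k)"
        unfolding m(2) using m(1) by (simp only: Pm weyl_op_simps weyl_op_Q)
      ultimately show ?thesis using False by simp
    next
      assume "\<not> ?p i dvd n"
      then show ?thesis using False n pos ndvd by (simp add: weyl_op_Q P0)
    qed
  qed
  show "weyl_op (Weyl_P i) (weyl_op (Weyl_P j) (monomial n)) = weyl_op (Weyl_P j) (weyl_op (Weyl_P i) (monomial n :: _ \<Rightarrow>\<^sub>0 'k))"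
  proof (cases "i = j")
    case False
    have zero: "weyl_op (Weyl_P i) (weyl_op (Weyl_P j) (monomial n)) = (0 :: _ \<Rightarrow>\<^sub>0 'k)" if ij: "i \<noteq> j" "\<not> ?p i dvd n" for i j
      using cases[OF n, of j]
    proof
      assume "\<exists>m>0. n = m * ?p j"
      then obtain m where m: "m > 0" "n = m * ?p j" by blast
      then have "\<not> ?p i dvd m" using ij by auto
      then show ?thesis unfolding m(2) using m(1) by (simp add: Pm P0)
    next
      assume "\<not> ?p j dvd n"
      then show ?thesis using n by (simp add: P0)
    qed
    show ?thesis
    proof (cases "?p i dvd n \<and> ?p j dvd n")
      case True
      then obtain m where m: "n = m * ?p i" by (auto simp: dvd_def mult.commute)
      then have "?p j dvd m" using True False by (metis nth_prime_eq_iff prime_nth_prime prime_dvd_mult_iff primes_dvd_imp_eq)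
      then obtain l where l: "m = l * ?p j" by (auto simp: dvd_def mult.commute)
      have l0: "l > 0" using n by (auto simp: m l intro: Nat.gr0I)
      have n': "n = l * ?p i * ?p j" by (simp add: m l mult_ac)
      have nn: "n = l * ?p j * ?p i" by (simp add: m l)
      have "weyl_op (Weyl_P i) (weyl_op (Weyl_P j) (monomial n)) =
          pm_scale (of_nat (Suc (multiplicity (?p j) l)) * of_nat (Suc (multiplicity (?p i) l))) (monomial l :: _ \<Rightarrow>\<^sub>0 'k)"
        unfolding n' using False by (simp only: Pm[OF mult'(2)[OF l0 not_sym]] Pm[OF l0] weyl_op_simps mult'(1)[OF l0 not_sym] pm.scale_scale not_False_eq_True)
      moreover have "weyl_op (Weyl_P j) (weyl_op (Weyl_P i) (monomial n)) =
          pm_scale (of_nat (Suc (multiplicity (?p i) l)) * of_nat (Suc (multiplicity (?p j) l))) (monomial l :: _ \<Rightarrow>\<^sub>0 'k)"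
        unfolding nn using False by (simp only: Pm[OF mult'(2)[OF l0]] Pm[OF l0] weyl_op_simps mult'(1)[OF l0] pm.scale_scale not_False_eq_True)
      ultimately show ?thesis by (simp only: mult.commute)
    next
      case F: False
      then have "\<not> ?p i dvd n \<or> \<not> ?p j dvd n" by blast
      then show ?thesis
      proof
        assume "\<not> ?p i dvd n"
        then show ?thesis using zero[of i j] False n by (simp add: P0)
      next
        assume "\<not> ?p j dvd n"
        then show ?thesis using zero[of j i] False n by (simp add: P0)
      qed
    qed
  qed simp
qed

lemma weyl_op_commutation:
  "weyl_op (Weyl_P i) (weyl_op (Weyl_Q j) v) = weyl_op (Weyl_Q j) (weyl_op (Weyl_P i) v) + (if i = j then v else 0)"
  "weyl_op (Weyl_P i) (weyl_op (Weyl_P j) v) = weyl_op (Weyl_P j) (weyl_op (Weyl_P i) v)"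
  "weyl_op (Weyl_Q i) (weyl_op (Weyl_Q j) v) = weyl_op (Weyl_Q j) (weyl_op (Weyl_Q i) v)"
proof -
  note c = pm_linear_compose[OF linear_weyl_op linear_weyl_op]
  have "pm_linear (\<lambda>v. weyl_op (Weyl_Q j) (weyl_op (Weyl_P i) v) + (if i = j then v else 0))"
    by (rule pm_linearI) (simp_all only: pm.linear_add[OF c] pm.linear_scale[OF c], auto simp: pm.scale_right_distrib)
  then show "weyl_op (Weyl_P i) (weyl_op (Weyl_Q j) v) = weyl_op (Weyl_Q j) (weyl_op (Weyl_P i) v) + (if i = j then v else 0)"
    by (rule pm_linear_eqI[OF c _ subset_UNIV]) (simp only: single_eq_monomial weyl_op_commutation_basis(1)[OF zero_less_Suc])
  show "weyl_op (Weyl_P i) (weyl_op (Weyl_P j) v) = weyl_op (Weyl_P j) (weyl_op (Weyl_P i) v)"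
    by (rule pm_linear_eqI[OF c c subset_UNIV]) (simp only: single_eq_monomial weyl_op_commutation_basis(2)[OF zero_less_Suc, of i j])
  show "weyl_op (Weyl_Q i) (weyl_op (Weyl_Q j) v) = weyl_op (Weyl_Q j) (weyl_op (Weyl_Q i) v)"
    by (rule pm_linear_eqI[OF c c subset_UNIV]) (simp only: single_eq_monomial weyl_op_commutation_basis(3)[OF zero_less_Suc, of i j])
qed

definition weyl_act :: "(weyl_gen list \<Rightarrow>\<^sub>0 'k::field) \<Rightarrow> (nat \<Rightarrow>\<^sub>0 'k) \<Rightarrow> (nat \<Rightarrow>\<^sub>0 'k)" where
  "weyl_act f v = lin_ext (\<lambda>w. foldr weyl_op w v) f"

lemma weyl_act_simps [simp]:
  "weyl_act 0 v = 0" "weyl_act (f + g) v = weyl_act f v + weyl_act g v" "weyl_act (f - g) v = weyl_act f v - weyl_act g v"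
  "weyl_act (pm_scale c f) v = pm_scale c (weyl_act f v)" "weyl_act (sum h A) v = (\<Sum>i\<in>A. weyl_act (h i) v)"
  "weyl_act (letter x) v = weyl_op x v"
  by (simp_all add: weyl_act_def letter_def)

lemma weyl_act_single: "weyl_act (Poly_Mapping.single w 1) v = foldr weyl_op w v"
  by (simp add: weyl_act_def)

lemma weyl_act_one [simp]: "weyl_act 1 v = v"
  using weyl_act_single[of "[]" v] by simp

lemma linear_weyl_act: "pm_linear (weyl_act f)"
proof -
  have "pm_linear (foldr weyl_op w)" for w
    by (induction w) (auto intro: pm_linearI simp: weyl_op_simps pm.linear_add pm.linear_scale)
  then show ?thesis unfolding weyl_act_def by (rule linear_lin_ext_param)
qed

lemmas weyl_act_linear [simp] = pm.linear_0[OF linear_weyl_act] pm.linear_add[OF linear_weyl_act]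
  pm.linear_scale[OF linear_weyl_act] pm.linear_sum[OF linear_weyl_act]

lemma weyl_act_mult [simp]: "weyl_act (f * g) v = weyl_act f (weyl_act g v)"
proof -
  have l: "pm_linear (\<lambda>f. weyl_act f v)" for v :: "nat \<Rightarrow>\<^sub>0 'a" by (rule pm_linearI) simp_all
  have 1: "weyl_act (Poly_Mapping.single w 1 * g) v = weyl_act (Poly_Mapping.single w 1) (weyl_act g v)" for w
    by (rule pm_linear_eqI[OF pm_linear_compose[OF l linear_times(2)] pm_linear_compose[OF linear_weyl_act l],
         where S = UNIV and f = g])
      (simp_all add: mult_single plus_list_def weyl_act_single)
  show ?thesis
    by (rule pm_linear_eqI[OF pm_linear_compose[OF l linear_times(1)] l, where S = UNIV and f = f])
      (simp_all add: 1)
qed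

lemma weyl_act_ideal:
  assumes "f \<in> weyl_ideal N" shows "weyl_act f v = 0"
proof -
  let ?S = "lists (weyl_gens N)"
  let ?K = "{f. Poly_Mapping.keys f \<subseteq> ?S \<and> (\<forall>v :: nat \<Rightarrow>\<^sub>0 'a. weyl_act f v = 0)}"
  have c: "carrier (free_assoc (weyl_gens N) :: ('a, _) module) = {f. Poly_Mapping.keys f \<subseteq> ?S}"
    by (auto simp: free_assoc_def)
  have "weyl_ideal N \<subseteq> ?K"
    unfolding weyl_ideal_def
  proof (rule gen_ideal_least)
    show "alg_ideal ?K (free_assoc (weyl_gens N))"
      unfolding nonassoc_algebra.alg_ideal_iff[OF nonassoc_algebra_free_assoc] c
      by (simp add: keys_subset) blast
    show "weyl_relations N \<subseteq> ?K"
    proof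
      fix f :: "weyl_gen list \<Rightarrow>\<^sub>0 'a" assume f: "f \<in> weyl_relations N"
      then have "Poly_Mapping.keys f \<subseteq> ?S" using weyl_relations_subset c by blast
      moreover have "weyl_act f v = 0" for v
      proof -
        consider i j where "f = letter (Weyl_P i) * letter (Weyl_Q j) - letter (Weyl_Q j) * letter (Weyl_P i) - (if i = j then 1 else 0)"
          | i j where "f = letter (Weyl_P i) * letter (Weyl_P j) - letter (Weyl_P j) * letter (Weyl_P i)"
          | i j where "f = letter (Weyl_Q i) * letter (Weyl_Q j) - letter (Weyl_Q j) * letter (Weyl_Q i)"
          using f unfolding weyl_relations_def Let_def pm_bilin_append single_Nil_one by blast
        then show ?thesis
        proof cases
          case 1 then show ?thesis by (simp add: weyl_op_commutation(1))
        next
          case (2 i j) then show ?thesis by (simp add: weyl_op_commutation(2)[of i j])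
        next
          case (3 i j) then show ?thesis by (simp add: weyl_op_commutation(3)[of i j])
        qed
      qed
      ultimately show "f \<in> ?K" by blast
    qed
  qed
  then show ?thesis using assms by blast
qed

text \<open>
  On linear polynomials \<open>p\<^sub>b\<close> returns the coefficient of \<open>q\<^sub>b\<close>, and then \<open>q\<^sub>a\<close> produces \<open>q\<^sub>a\<close>.
\<close>

lemma weyl_act_jordan_schwinger:
  assumes "b \<in> {1..N}"
  shows "weyl_act (jordan_schwinger N M) (monomial (nth_prime b)) = (\<Sum>a\<in>{1..N}. pm_scale (M a b) (monomial (nth_prime a)))"
proof -
  have pos: "nth_prime i > 0" for i using prime_gt_0_nat[OF prime_nth_prime] .
  have "multiplicity (nth_prime c) (nth_prime b) = (if c = b then 1 else 0)" for c
    using multiplicity_prime[OF prime_imp_prime_elem[OF prime_nth_prime]] 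
      prime_multiplicity_other[OF prime_nth_prime prime_nth_prime, of c b] by auto
  then have P: "weyl_op (Weyl_P c) (monomial (nth_prime b)) = (if c = b then monomial 1 else (0 :: _ \<Rightarrow>\<^sub>0 'a))" for c
    using pos[of b] by (simp add: weyl_op_P)
  have "weyl_op (Weyl_Q a) (weyl_op (Weyl_P c) (monomial (nth_prime b))) = (if c = b then monomial (nth_prime a) else (0 :: _ \<Rightarrow>\<^sub>0 'a))" for a c
    by (simp add: P weyl_op_Q)
  then show ?thesis using assms
    by (simp add: jordan_schwinger_def if_distrib[of "pm_scale _"] cong: if_cong)
qed

section \<open>The Yang-Mills algebra as a quotient of bracket polynomials\<close>

text \<open>
  The index sets \<open>{1..n}\<close> and membership in the algebra of bracket polynomials are to stay folded
  during simplification, so that the closure rules below apply.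
\<close>

declare One_nat_def [simp del]
declare free_nonassoc_simps(1) [simp del]

abbreviation bracket_alg :: "nat \<Rightarrow> ('k::field, nat bracketing \<Rightarrow>\<^sub>0 'k) module" where
  "bracket_alg n \<equiv> free_nonassoc {1..n}"

definition lie_ideal :: "nat \<Rightarrow> (nat bracketing \<Rightarrow>\<^sub>0 'k::field) set" where
  "lie_ideal n = gen_ideal (bracket_alg n) (lie_relations (bracket_alg n))"

definition lie_class :: "nat \<Rightarrow> (nat bracketing \<Rightarrow>\<^sub>0 'k::field) \<Rightarrow> (nat bracketing \<Rightarrow>\<^sub>0 'k) set" where
  "lie_class n g = lie_ideal n +>\<^bsub>(bracket_alg n :: ('k, _) module)\<^esub> g"

definition ym_ideal :: "nat \<Rightarrow> (nat bracketing \<Rightarrow>\<^sub>0 'k::field) set set" where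
  "ym_ideal n = gen_ideal (free_lie {1..n::nat}) (ym_relations n)"

text \<open>
  Every element of the Yang-Mills algebra is the class of a bracket polynomial. The two quotients in its
  definition are treated as one epimorphism from bracket polynomials.
\<close>

definition ym_class :: "nat \<Rightarrow> (nat bracketing \<Rightarrow>\<^sub>0 'k::field) \<Rightarrow> 'k ym_elem" where
  "ym_class n g = ym_ideal n +>\<^bsub>(free_lie {1..n::nat} :: ('k, _) module)\<^esub> lie_class n g"

definition ym_relator :: "nat \<Rightarrow> nat \<Rightarrow> (nat bracketing \<Rightarrow>\<^sub>0 'k::field)" where
  "ym_relator n j = (\<Sum>i\<in>{1..n}. Poly_Mapping.single (Br (Gen i) (Br (Gen i) (Gen j))) 1)"

interpretation bracket_alg: nonassoc_algebra "bracket_alg n :: ('k::field, _) module"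
  by (rule nonassoc_algebra_free_nonassoc)

lemma bracket_alg_closed [simp]:
  "0 \<in> carrier (bracket_alg n :: ('k::field, _) module)"
  "f \<in> carrier (bracket_alg n) \<Longrightarrow> g \<in> carrier (bracket_alg n) \<Longrightarrow> f + g \<in> carrier (bracket_alg n :: ('k::field, _) module)"
  "f \<in> carrier (bracket_alg n) \<Longrightarrow> g \<in> carrier (bracket_alg n) \<Longrightarrow> pm_bilin Br f g \<in> carrier (bracket_alg n :: ('k::field, _) module)"
  "f \<in> carrier (bracket_alg n) \<Longrightarrow> pm_scale c f \<in> carrier (bracket_alg n :: ('k::field, _) module)"
  "set_bracketing t \<subseteq> {1..n} \<Longrightarrow> Poly_Mapping.single t 1 \<in> carrier (bracket_alg n :: ('k::field, _) module)"
  using bracket_alg.zero_closed[of n] bracket_alg.a_closed[of f n g] bracket_alg.mult_closed[of f n g] bracket_alg.smult_closed[of f n c]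
  by (auto simp: free_nonassoc_simps(1))

lemma lie_relations_subset: "lie_relations (bracket_alg n :: ('k::field, _) module) \<subseteq> carrier (bracket_alg n)"
  unfolding lie_relations_def by auto

lemma alg_ideal_lie: "alg_ideal (lie_ideal n) (bracket_alg n :: ('k::field, _) module)"
  unfolding lie_ideal_def by (rule bracket_alg.alg_ideal_gen_ideal[OF lie_relations_subset])

lemma lie_class_epi: "alg_epi (bracket_alg n :: ('k::field, _) module) (free_lie {1..n::nat}) (lie_class n)"
proof -
  have "free_lie {1..n} = quot_alg (bracket_alg n) (lie_ideal n :: (_ \<Rightarrow>\<^sub>0 'k) set)" by (simp add: free_lie_def lie_ideal_def)
  then show ?thesis
    using alg_epi_quot[OF nonassoc_algebra_free_nonassoc alg_ideal_lie] by (simp add: lie_class_def[abs_def])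
qed

lemma nonassoc_algebra_free_lie: "nonassoc_algebra (free_lie {1..n::nat} :: ('k::field, _) module)"
  by (rule alg_epi_algebra[OF nonassoc_algebra_free_nonassoc lie_class_epi])

lemma bracket_alg_sum_closed: "(\<And>i. i \<in> S \<Longrightarrow> g i \<in> carrier (bracket_alg n)) \<Longrightarrow> sum g S \<in> carrier (bracket_alg n :: ('k::field, _) module)"
  by (induction S rule: infinite_finite_induct) auto

lemma ym_relator_closed: "j \<in> {1..n} \<Longrightarrow> ym_relator n j \<in> carrier (bracket_alg n :: ('k::field, _) module)"
  unfolding ym_relator_def by (rule bracket_alg_sum_closed) simp

lemma finsum_bracket_alg:
  assumes "finite S" "\<And>i. i \<in> S \<Longrightarrow> g i \<in> carrier (bracket_alg n :: ('k::field, _) module)"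
  shows "finsum (bracket_alg n) g S = sum g S"
  using assms
proof (induction S rule: finite_induct)
  case empty
  show ?case using bracket_alg.finsum_empty[of n g] by simp
next
  case (insert i S)
  have "finsum (bracket_alg n) g (insert i S) = g i \<oplus>\<^bsub>bracket_alg n\<^esub> finsum (bracket_alg n) g S"
    using insert by (intro bracket_alg.finsum_insert) auto
  then show ?case using insert by simp
qed

lemma ym_relations_eq: "ym_relations n = lie_class n ` (ym_relator n :: _ \<Rightarrow> _ \<Rightarrow>\<^sub>0 'k::field) ` {1..n}"
proof -
  let ?g = "\<lambda>i. Poly_Mapping.single (Gen i) (1 :: 'k) :: nat bracketing \<Rightarrow>\<^sub>0 'k"
  let ?L = "free_lie {1..n} :: ('k, _) module"
  have m: "lie_class n f \<otimes>\<^bsub>?L\<^esub> lie_class n h = lie_class n (pm_bilin Br f h)"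
    if "f \<in> carrier (bracket_alg n)" "h \<in> carrier (bracket_alg n)" for f h
    using lie_class_epi[of n, where ?'k = 'k] that by (simp add: alg_epi_def)
  have "(\<Oplus>\<^bsub>?L\<^esub>i\<in>{1..n}. lie_gen {1..n} i \<otimes>\<^bsub>?L\<^esub> (lie_gen {1..n} i \<otimes>\<^bsub>?L\<^esub> lie_gen {1..n} j)) = lie_class n (ym_relator n j)"
    if j: "j \<in> {1..n}" for j
  proof -
    have gen: "lie_gen {1..n} i = lie_class n (?g i)" for i
      by (simp add: lie_gen_def lie_class_def lie_ideal_def)
    have "lie_gen {1..n} i \<otimes>\<^bsub>?L\<^esub> (lie_gen {1..n} i \<otimes>\<^bsub>?L\<^esub> lie_gen {1..n} j) =
        lie_class n (Poly_Mapping.single (Br (Gen i) (Br (Gen i) (Gen j))) 1)" if "i \<in> {1..n}" for i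
      using that j by (simp add: gen m)
    moreover have "lie_class n (Poly_Mapping.single (Br (Gen i) (Br (Gen i) (Gen j))) 1) \<in> carrier ?L" if "i \<in> {1..n}" for i
      using that j lie_class_epi[of n, where ?'k = 'k] by (auto simp: alg_epi_def)
    ultimately have "(\<Oplus>\<^bsub>?L\<^esub>i\<in>{1..n}. lie_gen {1..n} i \<otimes>\<^bsub>?L\<^esub> (lie_gen {1..n} i \<otimes>\<^bsub>?L\<^esub> lie_gen {1..n} j)) =
       (\<Oplus>\<^bsub>?L\<^esub>i\<in>{1..n}. lie_class n (Poly_Mapping.single (Br (Gen i) (Br (Gen i) (Gen j))) 1))"
      by (intro abelian_monoid.finsum_cong' abelian_group.axioms(1) nonassoc_algebra.axioms(1) nonassoc_algebra_free_lie) auto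
    also have "\<dots> = lie_class n (finsum (bracket_alg n) (\<lambda>i. Poly_Mapping.single (Br (Gen i) (Br (Gen i) (Gen j))) 1) {1..n})"
      by (rule alg_epi_finsum[OF nonassoc_algebra_free_nonassoc lie_class_epi]) (use j in auto)
    also have "finsum (bracket_alg n) (\<lambda>i. Poly_Mapping.single (Br (Gen i) (Br (Gen i) (Gen j))) 1) {1..n} = ym_relator n j"
      unfolding ym_relator_def by (rule finsum_bracket_alg) (use j in auto)
    finally show ?thesis .
  qed
  then show ?thesis
    unfolding ym_relations_def Let_def Setcompr_eq_image image_image by (intro image_cong refl)
qed

lemma ym_relations_subset: "ym_relations n \<subseteq> carrier (free_lie {1..n::nat} :: ('k::field, _) module)"
proof -
  have "carrier (free_lie {1..n} :: ('k, _) module) = lie_class n ` carrier (bracket_alg n)"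
    using lie_class_epi[of n, where ?'k = 'k] by (simp add: alg_epi_def)
  then show ?thesis by (simp only: ym_relations_eq) (intro image_mono, auto simp: ym_relator_closed)
qed

lemma alg_ideal_ym: "alg_ideal (ym_ideal n) (free_lie {1..n::nat} :: ('k::field, _) module)"
  unfolding ym_ideal_def
  by (rule nonassoc_algebra.alg_ideal_gen_ideal[OF nonassoc_algebra_free_lie ym_relations_subset])

lemma ym_class_epi: "alg_epi (bracket_alg n :: ('k::field, _) module) (ym n) (ym_class n)"
proof -
  have "ym n = quot_alg (free_lie {1..n::nat}) (ym_ideal n :: (_ \<Rightarrow>\<^sub>0 'k) set set)" by (simp add: ym_def ym_ideal_def)
  then show ?thesis
    using alg_epi_compose[OF lie_class_epi alg_epi_quot[OF nonassoc_algebra_free_lie alg_ideal_ym]]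
    by (simp add: ym_class_def[abs_def])
qed

lemma nonassoc_algebra_ym: "nonassoc_algebra (ym n :: ('k::field, _) module)"
  by (rule alg_epi_algebra[OF nonassoc_algebra_free_nonassoc ym_class_epi])

lemma ym_alternating:
  assumes "x \<in> carrier (ym n)" shows "x \<otimes>\<^bsub>ym n\<^esub> x = \<zero>\<^bsub>(ym n :: ('k::field, _) module)\<^esub>"
proof -
  obtain g where g: "g \<in> carrier (bracket_alg n)" "x = ym_class n g"
    using assms ym_class_epi[of n, where ?'k = 'k] by (auto simp: alg_epi_def)
  have "pm_bilin Br g g \<in> lie_relations (bracket_alg n)" using g(1) unfolding lie_relations_def by auto
  then have "pm_bilin Br g g \<in> lie_ideal n" unfolding lie_ideal_def by (rule subsetD[OF gen_ideal_superset])
  moreover have "(0 :: nat bracketing \<Rightarrow>\<^sub>0 'k) \<in> lie_ideal n"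
    using bracket_alg.ideal_zero[OF alg_ideal_lie[of n, where ?'k = 'k]] by simp
  ultimately have "lie_class n (pm_bilin Br g g) = lie_class n 0"
    unfolding lie_class_def by (simp only: coset_of_member[OF nonassoc_algebra_free_nonassoc alg_ideal_lie])
  then have "ym_class n (pm_bilin Br g g) = ym_class n 0" by (simp add: ym_class_def)
  then show ?thesis using g ym_class_epi[of n, where ?'k = 'k] by (simp add: alg_epi_def)
qed

lemma alg_ideal_lower_central: "alg_ideal (lower_central (ym n) m) (ym n :: ('k::field, _) module)"
  by (rule nonassoc_algebra.alternating_lower_central[OF nonassoc_algebra_ym ym_alternating])

section \<open>The Yang-Mills relations among words\<close>

text \<open>
  The Yang-Mills relations among words. The letters outside \<open>{1..n}\<close> are killed as well, so that words
  over all naturals may be used, without restriction to a subalgebra.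
\<close>

definition ym_words :: "nat \<Rightarrow> (nat list \<Rightarrow>\<^sub>0 'k::field) set" where
  "ym_words n = word_ideal (expand ` ym_relator n ` {1..n} \<union> letter ` (- {1..n}))"

lemma two_sided_ym_words: "two_sided (ym_words n)"
  unfolding ym_words_def by (rule two_sided_word_ideal)

lemma commutator_mem: "two_sided J \<Longrightarrow> f \<in> J \<Longrightarrow> commutator f g \<in> J" "two_sided J \<Longrightarrow> f \<in> J \<Longrightarrow> commutator g f \<in> J"
  unfolding commutator_def by (intro two_sided_simps(3,5,6); assumption)+

text \<open>
  Expansion turns brackets into commutators, so two-sided ideals pull back to ideals. Applied to \<open>{0}\<close>, to
  the ideal of the Yang-Mills relations and to its truncations, this bounds the kernels of the three successive
  quotients of the algebra of bracket polynomials.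
\<close>

lemma alg_ideal_expand_preimage:
  assumes "two_sided J"
  shows "alg_ideal {g \<in> carrier (bracket_alg n). expand g \<in> J} (bracket_alg n)"
  unfolding bracket_alg.alg_ideal_iff
  by (simp add: expand_bracket two_sided_simps(1,2,4)[OF assms] commutator_mem[OF assms])

text \<open>
  Commutators satisfy the laws of a Lie bracket.
\<close>

lemma expand_lie_ideal:
  fixes g :: "nat bracketing \<Rightarrow>\<^sub>0 'k::field"
  assumes "g \<in> lie_ideal n" shows "expand g = 0"
proof -
  let ?P = "{g \<in> carrier (bracket_alg n). expand g \<in> {0 :: nat list \<Rightarrow>\<^sub>0 'k}}"
  have "lie_ideal n \<subseteq> ?P"
    unfolding lie_ideal_def
  proof (rule gen_ideal_least)
    show "alg_ideal ?P (bracket_alg n)"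
      by (rule alg_ideal_expand_preimage) (auto simp: two_sided_def)
    have "expand g = 0" if "g \<in> lie_relations (bracket_alg n)" for g :: "nat bracketing \<Rightarrow>\<^sub>0 'k"
      using that by (auto simp: lie_relations_def expand_bracket commutator_def algebra_simps)
    then show "lie_relations (bracket_alg n) \<subseteq> ?P"
      using lie_relations_subset[of n, where ?'k = 'k] by blast
  qed
  then show ?thesis using assms by blast
qed

lemma lie_class_eqD:
  assumes "g \<in> carrier (bracket_alg n)" "h \<in> carrier (bracket_alg n)" "lie_class n g = lie_class n h"
  shows "expand g = expand h"
proof -
  obtain i where "i \<in> lie_ideal n" "g = i + h"
    using assms bracket_alg.coset_eq_iff[OF alg_ideal_lie assms(1,2)] by (auto simp: lie_class_def)
  then show ?thesis by (simp add: expand_lie_ideal)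
qed

text \<open>
  The image under an epimorphism of the ideal pulled back from \<open>ym_words n\<close> is an ideal that contains the
  Yang-Mills relations, hence it contains the ideal that they generate.
\<close>

lemma ym_class_eqD:
  assumes g: "g \<in> carrier (bracket_alg n)" "h \<in> carrier (bracket_alg n)" "ym_class n g = ym_class n (h :: _ \<Rightarrow>\<^sub>0 'k::field)"
  shows "expand g - expand h \<in> ym_words n"
proof -
  let ?P = "{g \<in> carrier (bracket_alg n). expand g \<in> (ym_words n :: (_ \<Rightarrow>\<^sub>0 'k) set)}"
  have J: "ym_ideal n \<subseteq> lie_class n ` ?P"
    unfolding ym_ideal_def
  proof (rule gen_ideal_least)
    show "alg_ideal (lie_class n ` ?P) (free_lie {1..n::nat})"
      by (rule alg_epi_ideal[OF nonassoc_algebra_free_nonassoc lie_class_epi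
            alg_ideal_expand_preimage[OF two_sided_ym_words]])
    have "expand (ym_relator n j) \<in> ym_words n" if "j \<in> {1..n}" for j
      using that unfolding ym_words_def by (intro subsetD[OF word_ideal_base]) blast
    then show "ym_relations n \<subseteq> lie_class n ` ?P" using ym_relator_closed unfolding ym_relations_eq by blast
  qed
  have epi: "alg_epi (bracket_alg n :: ('k, _) module) (free_lie {1..n::nat}) (lie_class n)" by (rule lie_class_epi)
  then have "lie_class n g \<in> carrier (free_lie {1..n::nat})" "lie_class n h \<in> carrier (free_lie {1..n::nat})"
    using g by (auto simp: alg_epi_def)
  from nonassoc_algebra.coset_eq_iff[OF nonassoc_algebra_free_lie alg_ideal_ym this] g(3)
  obtain j where j: "j \<in> ym_ideal n" "lie_class n g = j \<oplus>\<^bsub>free_lie {1..n}\<^esub> lie_class n h"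
    by (auto simp: ym_class_def)
  then obtain p where p: "p \<in> carrier (bracket_alg n)" "expand p \<in> ym_words n" "j = lie_class n p" using J by blast
  then have "lie_class n g = lie_class n (p + h)" using j(2) epi g(2) by (simp add: alg_epi_def)
  then have "expand g = expand (p + h)" using g p bracket_alg.a_closed[of p n h] by (intro lie_class_eqD) auto
  then show ?thesis using p by simp
qed

lemma br_word_homog: "\<exists>d\<ge>1. homog d (br_word t :: 'x list \<Rightarrow>\<^sub>0 'k::field)"
proof (induction t)
  case (Gen x)
  then show ?case using homog_letter by (intro exI[of _ 1]) auto
next
  case (Br s t)
  then obtain d e where "d \<ge> 1" "homog d (br_word s :: 'x list \<Rightarrow>\<^sub>0 'k)" "homog e (br_word t :: 'x list \<Rightarrow>\<^sub>0 'k)"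
    by blast
  then show ?case by (intro exI[of _ "d + e"]) (simp add: homog_comm)
qed

lemma expand_trunc_0: "two_sided J \<Longrightarrow> expand (g :: nat bracketing \<Rightarrow>\<^sub>0 'a::field) \<in> trunc_ideal J 0"
proof -
  assume J: "two_sided J"
  have "degree_part 0 (br_word t :: nat list \<Rightarrow>\<^sub>0 'a) = 0" for t
  proof -
    obtain d where "d \<ge> 1" "homog d (br_word t :: nat list \<Rightarrow>\<^sub>0 'a)" using br_word_homog by blast
    then show ?thesis by (simp add: degree_part_homog)
  qed
  note br = this
  have "degree_part 0 (expand g) = 0" using subset_UNIV[of "Poly_Mapping.keys g"]
    by (induction rule: pm_induct) (simp_all add: br)
  then show ?thesis using two_sided_simps(1)[OF J] by (simp add: trunc_ideal_def)
qed

lemma ym_words_degree_part: "f \<in> ym_words n \<Longrightarrow> degree_part d f \<in> ym_words n"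
  unfolding ym_words_def
proof (erule word_ideal_degree_part[rotated])
  fix r :: "nat list \<Rightarrow>\<^sub>0 'a" assume "r \<in> expand ` ym_relator n ` {1..n} \<union> letter ` (- {1..n})"
  then consider j where "r = expand (ym_relator n j)" | i where "r = letter i" by blast
  then show "\<exists>e. homog e r"
  proof cases
    case (1 j)
    have "homog (1 + (1 + 1)) (commutator (letter i) (commutator (letter i) (letter j)) :: _ \<Rightarrow>\<^sub>0 'a)" for i
      by (intro homog_comm homog_letter)
    then show ?thesis unfolding 1 ym_relator_def by (auto intro!: homog_sum)
  next
    case (2 i)
    show ?thesis unfolding 2 by (rule exI, rule homog_letter)
  qed
qed

lemma ym_words_trunc: "ym_words n \<subseteq> trunc_ideal (ym_words n) m"
  by (auto simp: trunc_ideal_def ym_words_degree_part)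

text \<open>
  A bracket of degree \<open>d\<close> expands into words of length \<open>d\<close>, and the bracketing of \<open>m + 1\<close> elements has
  no part of degree at most \<open>m\<close>. So the \<open>m\<close>-th term of the lower central series acts by zero on the
  quotient of words by \<open>trunc_ideal (ym_words n) m\<close>.
\<close>

lemma lower_central_expand:
  "lower_central (ym n) m \<subseteq> ym_class n ` {g \<in> carrier (bracket_alg n). expand g \<in> trunc_ideal (ym_words n :: (_ \<Rightarrow>\<^sub>0 'k::field) set) m}"
proof (induction m)
  case 0
  have "carrier (ym n :: ('k, _) module) = ym_class n ` carrier (bracket_alg n)"
    using ym_class_epi[of n, where ?'k = 'k] by (simp add: alg_epi_def)
  then show ?case by (simp add: expand_trunc_0[OF two_sided_ym_words])
next
  case (Suc m)
  let ?P = "\<lambda>m. {g \<in> carrier (bracket_alg n). expand g \<in> trunc_ideal (ym_words n :: (_ \<Rightarrow>\<^sub>0 'k) set) m}"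
  have epi: "alg_epi (bracket_alg n :: ('k, _) module) (ym n) (ym_class n)" by (rule ym_class_epi)
  have "alg_ideal (ym_class n ` ?P (Suc m)) (ym n)"
    by (intro alg_epi_ideal[OF nonassoc_algebra_free_nonassoc epi] alg_ideal_expand_preimage
         two_sided_trunc_ideal two_sided_ym_words)
  then have "submodule (ym_class n ` ?P (Suc m)) (ring_of_type_algebra :: 'k ring) (ym n)" by (simp add: alg_ideal_def)
  moreover have "x \<otimes>\<^bsub>ym n\<^esub> y \<in> ym_class n ` ?P (Suc m)" if xy: "x \<in> carrier (ym n)" "y \<in> lower_central (ym n) m" for x y :: "'k ym_elem"
  proof -
    obtain g where g: "g \<in> carrier (bracket_alg n)" "x = ym_class n g" using xy(1) epi by (auto simp: alg_epi_def)
    obtain h where h: "h \<in> ?P m" "y = ym_class n h" using xy(2) Suc by blast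
    have "x \<otimes>\<^bsub>ym n\<^esub> y = ym_class n (pm_bilin Br g h)" using g h epi by (simp add: alg_epi_def)
    moreover have "pm_bilin Br g h \<in> carrier (bracket_alg n)" using bracket_alg.mult_closed[of g n h] g h by simp
    moreover have "expand (pm_bilin Br g h) \<in> trunc_ideal (ym_words n) (Suc m)"
      unfolding expand_bracket commutator_def
      using trunc_ideal_mult[OF two_sided_ym_words expand_trunc_0[OF two_sided_ym_words]] h(1)
      by (intro two_sided_simps(3)[OF two_sided_trunc_ideal[OF two_sided_ym_words]]) auto
    ultimately show ?thesis by blast
  qed
  ultimately show ?case by (simp add: lin_span_def) blast
qed

definition nilp_class :: "nat \<Rightarrow> nat \<Rightarrow> (nat bracketing \<Rightarrow>\<^sub>0 'k::field) \<Rightarrow> 'k ym_elem set" where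
  "nilp_class n m g = lower_central (ym n) m +>\<^bsub>(ym n :: ('k, _) module)\<^esub> ym_class n g"

lemma nilp_class_epi:
  "alg_epi (bracket_alg n :: ('k::field, _) module) (quot_alg (ym n) (lower_central (ym n) m)) (nilp_class n m)"
  using alg_epi_compose[OF ym_class_epi alg_epi_quot[OF nonassoc_algebra_ym alg_ideal_lower_central]]
  by (simp add: nilp_class_def[abs_def])

text \<open>
  The kernel of the epimorphism onto the nilpotent quotient consists of a part from the lower central series
  and a part from the Yang-Mills relations; both lie in the truncated ideal.
\<close>

lemma nilp_class_eqD:
  assumes g: "g \<in> carrier (bracket_alg n)" "h \<in> carrier (bracket_alg n)" "nilp_class n m g = nilp_class n m (h :: _ \<Rightarrow>\<^sub>0 'k::field)"
  shows "expand g - expand h \<in> trunc_ideal (ym_words n) m"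
proof -
  have epi: "alg_epi (bracket_alg n :: ('k, _) module) (ym n) (ym_class n)" by (rule ym_class_epi)
  then have "ym_class n g \<in> carrier (ym n)" "ym_class n h \<in> carrier (ym n)"
    using g by (auto simp: alg_epi_def)
  from nonassoc_algebra.coset_eq_iff[OF nonassoc_algebra_ym alg_ideal_lower_central this] g(3)
  obtain j where j: "j \<in> lower_central (ym n) m" "ym_class n g = j \<oplus>\<^bsub>ym n\<^esub> ym_class n h"
    by (auto simp: nilp_class_def)
  then obtain p where p: "p \<in> carrier (bracket_alg n)" "expand p \<in> trunc_ideal (ym_words n) m" "j = ym_class n p"
    using lower_central_expand by blast
  then have "ym_class n g = ym_class n (p + h)" using j(2) epi g(2) by (simp add: alg_epi_def)
  then have "expand g - expand (p + h) \<in> ym_words n" using g p bracket_alg.a_closed[of p n h] by (intro ym_class_eqD) auto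
  then have "expand g - expand (p + h) \<in> trunc_ideal (ym_words n) m" using ym_words_trunc by blast
  then have "expand g - expand (p + h) + expand p \<in> trunc_ideal (ym_words n) m"
    using p two_sided_simps(2)[OF two_sided_trunc_ideal[OF two_sided_ym_words]] by blast
  then show ?thesis by simp
qed

section \<open>Quotients of free associative algebras\<close>

lemma coset_free_assoc_iff:
  fixes f g :: "'x list \<Rightarrow>\<^sub>0 'k::field"
  assumes I: "alg_ideal I (free_assoc S)" and fg: "Poly_Mapping.keys f \<subseteq> lists S" "Poly_Mapping.keys g \<subseteq> lists S"
  shows "I +>\<^bsub>(free_assoc S :: ('k, _) module)\<^esub> f = I +>\<^bsub>(free_assoc S :: ('k, _) module)\<^esub> g \<longleftrightarrow> f - g \<in> I"
proof -
  have "I +>\<^bsub>(free_assoc S :: ('k, _) module)\<^esub> f = I +>\<^bsub>(free_assoc S :: ('k, _) module)\<^esub> g \<longleftrightarrow> (\<exists>i\<in>I. f = i + g)"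
    using nonassoc_algebra.coset_eq_iff[OF nonassoc_algebra_free_assoc I, of f g] fg by simp
  also have "\<dots> \<longleftrightarrow> f - g \<in> I" by (metis add_diff_cancel_right' diff_add_cancel)
  finally show ?thesis .
qed

lemma mem_coset_free_assoc:
  "g \<in> I +>\<^bsub>(free_assoc S :: ('k::field, _) module)\<^esub> f \<longleftrightarrow> (\<exists>i\<in>I. g = i + f)"
  by (auto simp: a_r_coset_def')

lemma keys_word_hom:
  assumes "Poly_Mapping.keys f \<subseteq> lists S" "\<And>x. x \<in> S \<Longrightarrow> Poly_Mapping.keys (\<phi> x) \<subseteq> lists S'"
  shows "Poly_Mapping.keys (word_hom \<phi> f) \<subseteq> lists S'"
  using assms(1)
proof (induction rule: pm_induct)
  case (basis u)
  then show ?case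
  proof (induction u)
    case (Cons x u)
    then show ?case by (simp add: word_hom_single keys_mult_subset assms(2))
  qed (simp add: keys_one_subset)
qed (simp_all add: keys_subset)

lemma word_hom_cong:
  assumes "Poly_Mapping.keys f \<subseteq> lists S" "\<And>x. x \<in> S \<Longrightarrow> \<phi> x = \<phi>' x"
  shows "word_hom \<phi> f = word_hom \<phi>' f"
proof (rule pm_linear_eqI[OF linear_word_hom linear_word_hom assms(1)])
  fix u assume "u \<in> lists S"
  then have "map \<phi> u = map \<phi>' u" using assms(2) by (induction u) auto
  then show "word_hom \<phi> (Poly_Mapping.single u 1) = word_hom \<phi>' (Poly_Mapping.single u 1)" by (simp only: word_hom_single)
qed

lemma word_hom_word_hom: "word_hom \<phi> (word_hom \<psi> f) = word_hom (\<lambda>x. word_hom \<phi> (\<psi> x)) f"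
proof (rule pm_linear_eqI[OF pm_linear_compose[OF linear_word_hom linear_word_hom] linear_word_hom subset_UNIV])
  fix u
  show "word_hom \<phi> (word_hom \<psi> (Poly_Mapping.single u 1)) = word_hom (\<lambda>x. word_hom \<phi> (\<psi> x)) (Poly_Mapping.single u 1)"
    by (induction u) (simp_all add: single_Cons)
qed

lemma alg_ideal_word_hom_preimage:
  fixes \<phi> :: "'x \<Rightarrow> 'y list \<Rightarrow>\<^sub>0 'k::field"
  assumes I: "alg_ideal I (free_assoc S')" and \<phi>: "\<And>x. x \<in> S \<Longrightarrow> Poly_Mapping.keys (\<phi> x) \<subseteq> lists S'"
  shows "alg_ideal {f \<in> carrier (free_assoc S). word_hom \<phi> f \<in> I} (free_assoc S)"
  unfolding nonassoc_algebra.alg_ideal_iff[OF nonassoc_algebra_free_assoc]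
  by (simp add: carrier_free_assoc Collect_mono_iff keys_subset alg_ideal_free_assoc(2-6)[OF I] keys_word_hom[OF _ \<phi>])

lemma alg_epi_free_assoc_quot:
  assumes "alg_ideal I (free_assoc S :: ('k::field, _) module)"
  shows "alg_epi (free_assoc S) (quot_alg (free_assoc S) I) (\<lambda>f. I +>\<^bsub>(free_assoc S :: ('k, _) module)\<^esub> f)"
  by (rule alg_epi_quot[OF nonassoc_algebra_free_assoc assms])

lemma quot_free_assoc_simps:
  fixes I :: "('x list \<Rightarrow>\<^sub>0 'k::field) set"
  assumes I: "alg_ideal I (free_assoc S)"
  defines "Q \<equiv> quot_alg (free_assoc S) I" and "cl \<equiv> \<lambda>f. I +>\<^bsub>(free_assoc S :: ('k, _) module)\<^esub> f"
  shows "carrier Q = cl ` {f. Poly_Mapping.keys f \<subseteq> lists S}" "\<zero>\<^bsub>Q\<^esub> = cl 0" "\<one>\<^bsub>Q\<^esub> = cl 1"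
    "Poly_Mapping.keys f \<subseteq> lists S \<Longrightarrow> Poly_Mapping.keys g \<subseteq> lists S \<Longrightarrow> cl f \<oplus>\<^bsub>Q\<^esub> cl g = cl (f + g)"
    "Poly_Mapping.keys f \<subseteq> lists S \<Longrightarrow> Poly_Mapping.keys g \<subseteq> lists S \<Longrightarrow> cl f \<otimes>\<^bsub>Q\<^esub> cl g = cl (f * g)"
    "Poly_Mapping.keys f \<subseteq> lists S \<Longrightarrow> c \<odot>\<^bsub>Q\<^esub> cl f = cl (pm_scale c f)"
  using alg_epi_free_assoc_quot[OF I] unfolding Q_def cl_def alg_epi_def carrier_free_assoc
  by (simp_all add: quot_alg_def[of _ I])

lemma ring_quot_free_assoc:
  assumes I: "alg_ideal I (free_assoc S :: ('k::field, _) module)"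
  shows "ring (quot_alg (free_assoc S) I)"
  by (rule alg_epi_ring[OF ring_free_assoc alg_epi_free_assoc_quot[OF I]]) (simp add: quot_alg_def)

text \<open>
  The map on cosets induced by a map that is constant on each of them.
\<close>

definition coset_lift :: "('a \<Rightarrow> 'b) \<Rightarrow> 'a set \<Rightarrow> 'b" where
  "coset_lift H B = H (SOME x. x \<in> B)"

lemma coset_lift:
  fixes I :: "('x list \<Rightarrow>\<^sub>0 'k::field) set"
  assumes I: "alg_ideal I (free_assoc S)" and H: "\<And>i. i \<in> I \<Longrightarrow> H (i + f) = H f"
  shows "coset_lift H (I +>\<^bsub>(free_assoc S :: ('k, _) module)\<^esub> f) = H f"
proof -
  let ?B = "I +>\<^bsub>(free_assoc S :: ('k, _) module)\<^esub> f"
  have "f \<in> ?B" unfolding mem_coset_free_assoc using alg_ideal_free_assoc(2)[OF I] by (intro bexI[of _ 0]) simp_all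
  then have "(SOME x. x \<in> ?B) \<in> ?B" by (rule someI)
  then show ?thesis unfolding coset_lift_def mem_coset_free_assoc using H by metis
qed

lemma coset_lift_alg_hom:
  fixes I :: "('x list \<Rightarrow>\<^sub>0 'k::field) set"
  assumes I: "alg_ideal I (free_assoc S)"
    and H: "\<And>f i. Poly_Mapping.keys f \<subseteq> lists S \<Longrightarrow> i \<in> I \<Longrightarrow> H (i + f) = H f"
      "\<And>f. Poly_Mapping.keys f \<subseteq> lists S \<Longrightarrow> H f \<in> carrier B"
      "\<And>f g. Poly_Mapping.keys f \<subseteq> lists S \<Longrightarrow> Poly_Mapping.keys g \<subseteq> lists S \<Longrightarrow> H (f + g) = H f \<oplus>\<^bsub>B\<^esub> H g"
      "\<And>f g. Poly_Mapping.keys f \<subseteq> lists S \<Longrightarrow> Poly_Mapping.keys g \<subseteq> lists S \<Longrightarrow> H (f * g) = H f \<otimes>\<^bsub>B\<^esub> H g"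
      "\<And>c f. Poly_Mapping.keys f \<subseteq> lists S \<Longrightarrow> H (pm_scale c f) = c \<odot>\<^bsub>B\<^esub> H f"
      "H 1 = \<one>\<^bsub>B\<^esub>"
  shows "coset_lift H \<in> alg_hom (quot_alg (free_assoc S) I) B"
proof -
  note [simp] = quot_free_assoc_simps[OF I]
  have l [simp]: "coset_lift H (I +>\<^bsub>(free_assoc S :: ('k, _) module)\<^esub> f) = H f" if "Poly_Mapping.keys f \<subseteq> lists S" for f
    by (rule coset_lift[OF I H(1)[OF that]])
  show ?thesis unfolding alg_hom_def ring_hom_def
    by (auto simp: H keys_subset keys_one_subset)
qed

section \<open>Enveloping algebras\<close>

lemma uenv_relations_subset:
  fixes L :: "('k::field, 'a) module"
  assumes "nonassoc_algebra L"
  shows "uenv_relations L \<subseteq> carrier (free_assoc (carrier L))"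
proof -
  interpret nonassoc_algebra L by fact
  have l: "Poly_Mapping.keys (letter x :: _ \<Rightarrow>\<^sub>0 'k) \<subseteq> lists (carrier L)" if "x \<in> carrier L" for x
    using that by (simp add: keys_letter)
  note k = keys_diff_subset keys_mult_subset keys_scale_subset l a_closed mult_closed smult_closed
  have "Poly_Mapping.keys r \<subseteq> lists (carrier L)" if "r \<in> uenv_relations L" for r
  proof -
    consider x y where "x \<in> carrier L" "y \<in> carrier L" "r = letter (x \<oplus>\<^bsub>L\<^esub> y) - letter x - letter y"
      | c x where "x \<in> carrier L" "r = letter (c \<odot>\<^bsub>L\<^esub> x) - pm_scale c (letter x)"
      | x y where "x \<in> carrier L" "y \<in> carrier L" "r = letter x * letter y - letter y * letter x - letter (x \<otimes>\<^bsub>L\<^esub> y)"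
      using \<open>r \<in> uenv_relations L\<close> unfolding uenv_relations_def pm_bilin_append by blast
    then show ?thesis by cases (simp_all only:, (intro k; assumption)+)
  qed
  then show ?thesis unfolding carrier_free_assoc by blast
qed

lemma alg_ideal_uenv:
  "nonassoc_algebra L \<Longrightarrow> alg_ideal (uenv_ideal L) (free_assoc (carrier L))"
  unfolding uenv_ideal_def
  by (rule nonassoc_algebra.alg_ideal_gen_ideal[OF nonassoc_algebra_free_assoc uenv_relations_subset])

lemma uenv_ideal_relations:
  assumes "x \<in> carrier L" "y \<in> carrier L"
  shows "letter (x \<oplus>\<^bsub>L\<^esub> y) - letter x - letter y \<in> uenv_ideal L"
    "letter (c \<odot>\<^bsub>L\<^esub> x) - pm_scale c (letter x) \<in> uenv_ideal L"
    "commutator (letter x) (letter y) - letter (x \<otimes>\<^bsub>L\<^esub> y) \<in> uenv_ideal L"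
proof -
  have s: "uenv_relations L \<subseteq> uenv_ideal L" unfolding uenv_ideal_def by (rule gen_ideal_superset)
  show "letter (x \<oplus>\<^bsub>L\<^esub> y) - letter x - letter y \<in> uenv_ideal L"
    "letter (c \<odot>\<^bsub>L\<^esub> x) - pm_scale c (letter x) \<in> uenv_ideal L"
    "commutator (letter x) (letter y) - letter (x \<otimes>\<^bsub>L\<^esub> y) \<in> uenv_ideal L"
    by (rule subsetD[OF s], use assms in \<open>unfold uenv_relations_def pm_bilin_append commutator_def, blast\<close>)+
qed

text \<open>
  The universal property of the enveloping algebra: a map on letters that is linear and sends brackets to
  commutators, all modulo an ideal \<open>I\<close>, induces a homomorphism modulo \<open>I\<close>.
\<close>

lemma word_hom_uenv_ideal:
  fixes \<phi> :: "'a \<Rightarrow> 'y list \<Rightarrow>\<^sub>0 'k::field"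
  assumes L: "nonassoc_algebra L" and I: "alg_ideal I (free_assoc S)"
    and \<phi>: "\<And>x. x \<in> carrier L \<Longrightarrow> Poly_Mapping.keys (\<phi> x) \<subseteq> lists S"
    and rel: "\<And>x y. x \<in> carrier L \<Longrightarrow> y \<in> carrier L \<Longrightarrow> \<phi> (x \<oplus>\<^bsub>L\<^esub> y) - \<phi> x - \<phi> y \<in> I"
      "\<And>c x. x \<in> carrier L \<Longrightarrow> \<phi> (c \<odot>\<^bsub>L\<^esub> x) - pm_scale c (\<phi> x) \<in> I"
      "\<And>x y. x \<in> carrier L \<Longrightarrow> y \<in> carrier L \<Longrightarrow> commutator (\<phi> x) (\<phi> y) - \<phi> (x \<otimes>\<^bsub>L\<^esub> y) \<in> I"
    and f: "f \<in> uenv_ideal L"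
  shows "word_hom \<phi> f \<in> I"
proof -
  have "uenv_ideal L \<subseteq> {f \<in> carrier (free_assoc (carrier L)). word_hom \<phi> f \<in> I}"
    unfolding uenv_ideal_def
  proof (rule gen_ideal_least[OF alg_ideal_word_hom_preimage[OF I \<phi>]])
    have "word_hom \<phi> r \<in> I" if "r \<in> uenv_relations L" for r
    proof -
      consider x y where "x \<in> carrier L" "y \<in> carrier L" "r = letter (x \<oplus>\<^bsub>L\<^esub> y) - letter x - letter y"
        | c x where "x \<in> carrier L" "r = letter (c \<odot>\<^bsub>L\<^esub> x) - pm_scale c (letter x)"
        | x y where "x \<in> carrier L" "y \<in> carrier L" "r = letter x * letter y - letter y * letter x - letter (x \<otimes>\<^bsub>L\<^esub> y)"
        using \<open>r \<in> uenv_relations L\<close> unfolding uenv_relations_def pm_bilin_append by blast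
      then show ?thesis
      proof cases
        case 1 then show ?thesis using rel(1) by simp
      next
        case 2 then show ?thesis using rel(2) by simp
      next
        case 3 then show ?thesis using rel(3) by (simp add: commutator_def)
      qed
    qed
    then show "uenv_relations L \<subseteq> {f \<in> carrier (free_assoc (carrier L)). word_hom \<phi> f \<in> I}"
      using uenv_relations_subset[OF L] by blast
  qed
  then show ?thesis using f by blast
qed

definition uenv_class :: "('k::field, 'a) module \<Rightarrow> ('a list \<Rightarrow>\<^sub>0 'k) \<Rightarrow> ('a list \<Rightarrow>\<^sub>0 'k) set" where
  "uenv_class L f = uenv_ideal L +>\<^bsub>(free_assoc (carrier L) :: ('k, _) module)\<^esub> f"

lemma uenv_map_class:
  fixes L :: "('k::field, 'a) module" and L' :: "('k, 'b) module"
  assumes L: "nonassoc_algebra L" and h: "alg_epi L L' h" and f: "Poly_Mapping.keys f \<subseteq> lists (carrier L)"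
  shows "uenv_map L' h (uenv_class L f) = uenv_class L' (word_hom (\<lambda>x. letter (h x)) f)"
proof -
  let ?e = "word_hom (\<lambda>x. letter (h x))"
  have L': "nonassoc_algebra L'" by (rule alg_epi_algebra[OF L h])
  have hc: "h x \<in> carrier L'" if "x \<in> carrier L" for x using h that by (auto simp: alg_epi_def)
  have hk: "Poly_Mapping.keys (letter (h x) :: _ \<Rightarrow>\<^sub>0 'k) \<subseteq> lists (carrier L')" if "x \<in> carrier L" for x
    using hc[OF that] by (simp add: keys_letter)
  have "?e i \<in> uenv_ideal L'" if "i \<in> uenv_ideal L" for i
  proof (rule word_hom_uenv_ideal[OF L alg_ideal_uenv[OF L'] hk _ _ _ that])
    fix x y c assume xy: "x \<in> carrier L" "y \<in> carrier L"
    show "letter (h (x \<oplus>\<^bsub>L\<^esub> y)) - letter (h x) - letter (h y) \<in> uenv_ideal L'"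
      "commutator (letter (h x)) (letter (h y)) - letter (h (x \<otimes>\<^bsub>L\<^esub> y)) \<in> uenv_ideal L'"
      using uenv_ideal_relations[OF hc[OF xy(1)] hc[OF xy(2)]] h xy by (simp_all add: alg_epi_def)
  next
    fix x c assume x: "x \<in> carrier L"
    show "letter (h (c \<odot>\<^bsub>L\<^esub> x)) - pm_scale c (letter (h x)) \<in> uenv_ideal L'"
      using uenv_ideal_relations(2)[OF hc[OF x] hc[OF x]] h x by (simp add: alg_epi_def)
  qed
  note rel = this
  have eq: "uenv_class L' (?e (i + f)) = uenv_class L' (?e f)" if i: "i \<in> uenv_ideal L" for i
  proof -
    have "Poly_Mapping.keys i \<subseteq> lists (carrier L)" using alg_ideal_free_assoc(1)[OF alg_ideal_uenv[OF L]] i by blast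
    then have k: "Poly_Mapping.keys (?e i) \<subseteq> lists (carrier L')" by (rule keys_word_hom[OF _ hk])
    have k': "Poly_Mapping.keys (?e f) \<subseteq> lists (carrier L')" by (rule keys_word_hom[OF f hk])
    have "uenv_class L' (?e i + ?e f) = uenv_class L' (?e f)"
      unfolding uenv_class_def coset_free_assoc_iff[OF alg_ideal_uenv[OF L'] keys_add_subset[OF k k'] k']
      by (simp add: rel i)
    then show ?thesis by simp
  qed
  have "f \<in> uenv_class L f" unfolding uenv_class_def mem_coset_free_assoc
    using alg_ideal_free_assoc(2)[OF alg_ideal_uenv[OF L]] by (intro bexI[of _ 0]) simp_all
  moreover have "uenv_class L' (?e g) = uenv_class L' (?e f)" if "g \<in> uenv_class L f" for g
    using that eq unfolding uenv_class_def[of L] mem_coset_free_assoc by blast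
  ultimately show ?thesis unfolding uenv_map_def pm_lin_eq_word_hom uenv_class_def[of L', symmetric] by blast
qed

section \<open>The enveloping algebra of the Yang-Mills algebra and words\<close>

text \<open>
  The generators of the Yang-Mills algebra, to be substituted for the letters of words. The value \<open>0\<close> on
  letters outside \<open>{1..n}\<close> matches \<open>ym_words\<close>, where these letters are relations.
\<close>

definition gen_letter :: "nat \<Rightarrow> nat \<Rightarrow> ('k::field ym_elem list \<Rightarrow>\<^sub>0 'k)" where
  "gen_letter n i = (if i \<in> {1..n} then letter (ym_class n (Poly_Mapping.single (Gen i) 1)) else 0)"

lemma ym_class_simps:
  "f \<in> carrier (bracket_alg n) \<Longrightarrow> ym_class n f \<in> carrier (ym n :: ('k::field, _) module)"
  "f \<in> carrier (bracket_alg n) \<Longrightarrow> g \<in> carrier (bracket_alg n) \<Longrightarrow> ym_class n f \<oplus>\<^bsub>(ym n :: ('k::field, _) module)\<^esub> ym_class n g = ym_class n (f + g)"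
  "f \<in> carrier (bracket_alg n) \<Longrightarrow> g \<in> carrier (bracket_alg n) \<Longrightarrow> ym_class n f \<otimes>\<^bsub>(ym n :: ('k::field, _) module)\<^esub> ym_class n g = ym_class n (pm_bilin Br f g)"
  "f \<in> carrier (bracket_alg n) \<Longrightarrow> c \<odot>\<^bsub>(ym n :: ('k::field, _) module)\<^esub> ym_class n f = ym_class n (pm_scale c f)"
  using ym_class_epi[of n, where ?'k = 'k] by (auto simp: alg_epi_def)

lemma keys_gen_letter: "Poly_Mapping.keys (gen_letter n i :: _ \<Rightarrow>\<^sub>0 'k::field) \<subseteq> lists (carrier (ym n :: ('k, _) module))"
  using ym_class_simps(1)[of "Poly_Mapping.single (Gen i) (1::'k)" n]
  by (auto simp: gen_letter_def keys_letter)

lemmas uenv_ym_simps = alg_ideal_free_assoc[OF alg_ideal_uenv[OF nonassoc_algebra_ym]]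

lemma keys_letter_ym: "g \<in> carrier (bracket_alg n) \<Longrightarrow> Poly_Mapping.keys (letter (ym_class n g) :: _ \<Rightarrow>\<^sub>0 'k::field) \<subseteq> lists (carrier (ym n :: ('k, _) module))"
  by (simp add: keys_letter ym_class_simps)

lemma keys_word_hom_gen_letter: "Poly_Mapping.keys (word_hom (gen_letter n) f :: _ \<Rightarrow>\<^sub>0 'k::field) \<subseteq> lists (carrier (ym n :: ('k, _) module))"
  by (rule keys_word_hom[where S = UNIV]) (simp_all add: keys_gen_letter)

lemma letter_zero: "letter (ym_class n 0) \<in> uenv_ideal (ym n :: ('k::field, _) module)"
  using uenv_ideal_relations(2)[OF ym_class_simps(1) ym_class_simps(1), of "0 :: nat bracketing \<Rightarrow>\<^sub>0 'k" n 0 0]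
  by (simp add: ym_class_simps)

text \<open>
  Expanding a bracket polynomial into words and replacing the letters by the generators gives back the
  element of the Yang-Mills algebra, as an element of the enveloping algebra: there a bracket is the
  commutator of its arguments.
\<close>

lemma word_hom_gen_letter_expand:
  assumes "g \<in> carrier (bracket_alg n)"
  shows "word_hom (gen_letter n) (expand g) - letter (ym_class n g) \<in> uenv_ideal (ym n :: ('k::field, _) module)"
proof -
  let ?U = "uenv_ideal (ym n :: ('k, _) module)"
  let ?S = "{t. set_bracketing t \<subseteq> {1..n}}"
  have mem: "f \<in> carrier (bracket_alg n)" if "Poly_Mapping.keys f \<subseteq> ?S" for f :: "nat bracketing \<Rightarrow>\<^sub>0 'k"
    using that by (simp add: free_nonassoc_simps(1))
  have single: "word_hom (gen_letter n) (br_word t) - letter (ym_class n (Poly_Mapping.single t 1)) \<in> ?U" if "t \<in> ?S" for t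
    using that
  proof (induction t)
    case (Gen i)
    then show ?case by (simp add: gen_letter_def uenv_ym_simps)
  next
    case (Br s t)
    let ?s = "Poly_Mapping.single s (1::'k)" and ?t = "Poly_Mapping.single t (1::'k)"
    let ?a = "word_hom (gen_letter n) (br_word s) :: _ \<Rightarrow>\<^sub>0 'k" and ?b = "word_hom (gen_letter n) (br_word t) :: _ \<Rightarrow>\<^sub>0 'k"
    let ?x = "letter (ym_class n ?s) :: _ \<Rightarrow>\<^sub>0 'k" and ?y = "letter (ym_class n ?t) :: _ \<Rightarrow>\<^sub>0 'k"
    have st: "?s \<in> carrier (bracket_alg n)" "?t \<in> carrier (bracket_alg n)" using Br.prems by auto
    note k = keys_letter_ym[OF st(1)] keys_letter_ym[OF st(2)] keys_word_hom_gen_letter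
    have ab: "?a - ?x \<in> ?U" "?b - ?y \<in> ?U" using Br by auto
    \<comment> \<open>\<open>[a, b] - [x, y]\<close>, written through the differences \<open>a - x\<close> and \<open>b - y\<close>\<close>
    have "(?a - ?x) * ?b + ?x * (?b - ?y) - ((?b - ?y) * ?a + ?y * (?a - ?x)) \<in> ?U"
      by (intro uenv_ym_simps(3,5,6,8) ab k)
    moreover have "commutator ?x ?y - letter (ym_class n (pm_bilin Br ?s ?t)) \<in> ?U"
      using uenv_ideal_relations(3)[OF ym_class_simps(1) ym_class_simps(1), OF st] by (simp only: ym_class_simps st)
    ultimately have "(?a - ?x) * ?b + ?x * (?b - ?y) - ((?b - ?y) * ?a + ?y * (?a - ?x)) +
      (commutator ?x ?y - letter (ym_class n (pm_bilin Br ?s ?t))) \<in> ?U" by (rule uenv_ym_simps(3))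
    then show ?case by (simp add: commutator_def algebra_simps)
  qed
  have "Poly_Mapping.keys g \<subseteq> ?S" using assms by (simp add: free_nonassoc_simps(1))
  then show ?thesis
  proof (induction rule: pm_induct)
    case zero
    then show ?case using uenv_ym_simps(7)[OF letter_zero] by simp
  next
    case (basis t)
    then show ?case by (simp only: expand_single single)
  next
    case (add f g)
    let ?l = "\<lambda>f. letter (ym_class n f) :: _ \<Rightarrow>\<^sub>0 'k"
    have "letter (ym_class n (f + g)) - ?l f - ?l g \<in> ?U"
      using uenv_ideal_relations(1)[OF ym_class_simps(1) ym_class_simps(1), OF mem[OF add.hyps(1)] mem[OF add.hyps(2)]]
      by (simp add: ym_class_simps mem add.hyps)
    then have "(word_hom (gen_letter n) (expand f) - ?l f) + (word_hom (gen_letter n) (expand g) - ?l g) - (?l (f + g) - ?l f - ?l g) \<in> ?U"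
      by (rule uenv_ym_simps(8)[OF uenv_ym_simps(3)[OF add.IH]])
    then show ?case by (simp add: algebra_simps)
  next
    case (scale c f)
    let ?l = "\<lambda>f. letter (ym_class n f) :: _ \<Rightarrow>\<^sub>0 'k"
    have "?l (pm_scale c f) - pm_scale c (?l f) \<in> ?U"
      using uenv_ideal_relations(2)[OF ym_class_simps(1) ym_class_simps(1), OF mem[OF scale.hyps] mem[OF scale.hyps], of c]
      by (simp add: ym_class_simps mem scale.hyps)
    then have "pm_scale c (word_hom (gen_letter n) (expand f) - ?l f) - (?l (pm_scale c f) - pm_scale c (?l f)) \<in> ?U"
      by (rule uenv_ym_simps(8)[OF uenv_ym_simps(4)[OF scale.IH]])
    then show ?case by (simp add: pm.scale_right_diff_distrib)
  qed
qed

text \<open>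
  The Yang-Mills relations hold in the enveloping algebra, because their classes are zero in the
  Yang-Mills algebra.
\<close>

lemma word_hom_gen_letter_ym_words:
  assumes "f \<in> ym_words n" shows "word_hom (gen_letter n) f \<in> uenv_ideal (ym n :: ('k::field, _) module)"
  using assms unfolding ym_words_def word_ideal_def
proof (induction rule: pm.span_induct_alt)
  case base
  then show ?case by (simp add: uenv_ym_simps)
next
  case (step c y z)
  then obtain u r v where y: "y = Poly_Mapping.single u 1 * r * Poly_Mapping.single v 1"
    and r: "r \<in> expand ` ym_relator n ` {1..n} \<union> letter ` (- {1..n})" by blast
  have "word_hom (gen_letter n) r \<in> uenv_ideal (ym n)"
    using r
  proof
    assume "r \<in> expand ` ym_relator n ` {1..n}"
    then obtain j where j: "j \<in> {1..n}" "r = expand (ym_relator n j)" by blast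
    have cl: "ym_relator n j \<in> carrier (bracket_alg n :: ('k, _) module)" by (rule ym_relator_closed[OF j(1)])
    have "lie_class n (ym_relator n j :: _ \<Rightarrow>\<^sub>0 'k) \<in> ym_relations n" using j(1) by (auto simp: ym_relations_eq)
    then have "lie_class n (ym_relator n j :: _ \<Rightarrow>\<^sub>0 'k) \<in> ym_ideal n"
      unfolding ym_ideal_def by (rule subsetD[OF gen_ideal_superset])
    moreover have "\<zero>\<^bsub>(free_lie {1..n} :: ('k, _) module)\<^esub> \<in> ym_ideal n"
      by (rule nonassoc_algebra.ideal_zero[OF nonassoc_algebra_free_lie alg_ideal_ym])
    then have "lie_class n (0 :: _ \<Rightarrow>\<^sub>0 'k) \<in> ym_ideal n"
      using lie_class_epi[of n, where ?'k = 'k] by (simp add: alg_epi_def)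
    ultimately have "ym_class n (ym_relator n j :: _ \<Rightarrow>\<^sub>0 'k) = ym_class n 0"
      unfolding ym_class_def by (simp only: coset_of_member[OF nonassoc_algebra_free_lie alg_ideal_ym])
    then have "letter (ym_class n (ym_relator n j)) \<in> uenv_ideal (ym n :: ('k, _) module)" using letter_zero by simp
    from uenv_ym_simps(3)[OF word_hom_gen_letter_expand[OF cl] this] show ?thesis by (simp add: j)
  next
    assume "r \<in> letter ` (- {1..n})"
    then show ?thesis by (auto simp: gen_letter_def uenv_ym_simps)
  qed
  then have "word_hom (gen_letter n) y \<in> uenv_ideal (ym n)"
    unfolding y word_hom_mult by (intro uenv_ym_simps(5,6) keys_word_hom_gen_letter)
  then show ?case using step by (simp add: uenv_ym_simps)
qed

text \<open>
  An arbitrary choice of representatives, not a linear one. This suffices because its values are only taken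
  in quotients where representatives of the same element agree.
\<close>

definition ym_rep :: "nat \<Rightarrow> 'k::field ym_elem \<Rightarrow> (nat bracketing \<Rightarrow>\<^sub>0 'k)" where
  "ym_rep n y = (SOME g. g \<in> carrier (bracket_alg n) \<and> ym_class n g = y)"

lemma ym_rep:
  assumes "y \<in> carrier (ym n :: ('k::field, _) module)"
  shows "ym_rep n y \<in> carrier (bracket_alg n)" "ym_class n (ym_rep n y) = y"
proof -
  have "\<exists>g. g \<in> carrier (bracket_alg n) \<and> ym_class n g = y" using assms ym_class_epi[of n, where ?'k = 'k] by (auto simp: alg_epi_def)
  then show "ym_rep n y \<in> carrier (bracket_alg n)" "ym_class n (ym_rep n y) = y"
    unfolding ym_rep_def by (metis (mono_tags, lifting) someI_ex)+
qed

text \<open>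
  This is the injectivity of the map from the enveloping algebra to words modulo the Yang-Mills relations.
  Substituting generators for letters is a left inverse: it sends the rewritten \<open>f\<close> back to \<open>f\<close>, and it
  sends the relations to zero.
\<close>

lemma uenv_ym_separation:
  fixes f :: "'k::field ym_elem list \<Rightarrow>\<^sub>0 'k"
  assumes f: "Poly_Mapping.keys f \<subseteq> lists (carrier (ym n :: ('k, _) module))" and nz: "f \<notin> uenv_ideal (ym n)"
  shows "word_hom (\<lambda>y. expand (ym_rep n y)) f \<notin> ym_words n"
proof -
  let ?\<phi> = "\<lambda>y :: 'k ym_elem. expand (ym_rep n y)"
  let ?U = "uenv_ideal (ym n :: ('k, _) module)"
  have "word_hom (gen_letter n) (word_hom ?\<phi> f) - f \<in> ?U" using f
  proof (induction rule: pm_induct)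
    case (basis u)
    then show ?case
    proof (induction u)
      case Nil then show ?case by (simp add: uenv_ym_simps)
    next
      case (Cons y u)
      let ?a = "word_hom (gen_letter n) (?\<phi> y) :: _ \<Rightarrow>\<^sub>0 'k" and ?u = "Poly_Mapping.single u (1::'k)"
      have y: "y \<in> carrier (ym n)" using Cons by simp
      have k: "Poly_Mapping.keys (letter y :: _ \<Rightarrow>\<^sub>0 'k) \<subseteq> lists (carrier (ym n :: ('k, _) module))"
        using y by (simp add: keys_letter)
      have "?a - letter y \<in> ?U" using word_hom_gen_letter_expand[OF ym_rep(1)[OF y]] ym_rep(2)[OF y] by simp
      moreover have "word_hom (gen_letter n) (word_hom ?\<phi> ?u) - ?u \<in> ?U" using Cons by simp
      ultimately have "(?a - letter y) * word_hom (gen_letter n) (word_hom ?\<phi> ?u) + letter y * (word_hom (gen_letter n) (word_hom ?\<phi> ?u) - ?u) \<in> ?U"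
        by (intro uenv_ym_simps(3,5,6) k keys_word_hom_gen_letter)
      then show ?case by (simp add: single_Cons algebra_simps)
    qed
  next
    case (add f g)
    from uenv_ym_simps(3)[OF add.IH] show ?case by (simp add: algebra_simps)
  next
    case (scale c f)
    from uenv_ym_simps(4)[OF scale.IH, of c] show ?case by (simp add: pm.scale_right_diff_distrib)
  qed (simp add: uenv_ym_simps)
  moreover have "word_hom (gen_letter n) (word_hom ?\<phi> f) \<in> ?U" if "word_hom ?\<phi> f \<in> ym_words n" using that by (rule word_hom_gen_letter_ym_words)
  ultimately show ?thesis using nz uenv_ym_simps(8)[of "word_hom (gen_letter n) (word_hom ?\<phi> f)" n "word_hom (gen_letter n) (word_hom ?\<phi> f) - f"] by auto
qed

section \<open>Weyl algebra modules of the Yang-Mills algebra\<close>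

text \<open>
  Words that are too long have no part of degree at most \<open>m\<close>, and words with a letter outside \<open>{1..n}\<close> are
  relations. Finitely many words are left.
\<close>

lemma trunc_ym_words_cofinite:
  "pm.span (trunc_ideal (ym_words n) m \<union> (\<lambda>u. Poly_Mapping.single u 1) ` {u \<in> lists {1..n}. length u \<le> m}) = (UNIV :: (nat list \<Rightarrow>\<^sub>0 'k::field) set)"
    (is "pm.span (?K \<union> ?W) = UNIV")
proof -
  have basis: "Poly_Mapping.single u 1 \<in> ?K \<union> ?W" for u :: "nat list"
  proof -
    consider "length u > m" | "u \<notin> lists {1..n}" | "u \<in> lists {1..n}" "length u \<le> m" by linarith
    then show ?thesis
    proof cases
      case 1
      then have "degree_part d (Poly_Mapping.single u (1::'k)) = 0" if "d \<le> m" for d using that by (simp add: degree_part_single)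
      then show ?thesis by (simp add: trunc_ideal_def two_sided_simps(1)[OF two_sided_ym_words])
    next
      case 2
      then obtain i where "i \<in> set u" "i \<notin> {1..n}" by (auto simp: in_lists_conv_set)
      then obtain v w where u: "u = v @ i # w" by (auto dest: split_list)
      have "letter i \<in> (ym_words n :: (nat list \<Rightarrow>\<^sub>0 'k) set)"
        unfolding ym_words_def using \<open>i \<notin> {1..n}\<close> by (intro subsetD[OF word_ideal_base]) blast
      then have "Poly_Mapping.single v 1 * letter i * Poly_Mapping.single w 1 \<in> (ym_words n :: (nat list \<Rightarrow>\<^sub>0 'k) set)"
        by (intro two_sided_simps(5,6)[OF two_sided_ym_words])
      moreover have "Poly_Mapping.single v 1 * letter i * Poly_Mapping.single w 1 = Poly_Mapping.single u (1::'k)"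
        by (simp add: u letter_def mult_single plus_list_def)
      ultimately show ?thesis using ym_words_trunc[of n m] by auto
    next
      case 3
      then show ?thesis by blast
    qed
  qed
  have "f \<in> pm.span (?K \<union> ?W)" for f
    using subset_UNIV[of "Poly_Mapping.keys f"]
    by (induction rule: pm_induct) (simp_all only: pm.span_zero pm.span_add pm.span_scale pm.span_base[OF basis])
  then show ?thesis by blast
qed

lemma finite_short_words: "finite {u \<in> lists {1..n::nat}. length u \<le> m}"
  using finite_lists_length_le[of "{1..n}" m] by (simp add: lists_eq_set)

context word_matrix_rep
begin

definition weyl_elem :: "('x list \<Rightarrow>\<^sub>0 'k) \<Rightarrow> (weyl_gen list \<Rightarrow>\<^sub>0 'k)" where
  "weyl_elem t = jordan_schwinger N (\<mu> t)"

lemma linear_weyl_elem: "pm_linear weyl_elem"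
  by (rule pm_linearI)
    (simp_all add: weyl_elem_def jordan_schwinger_def mu_add mu_scale pm.scale_left_distrib sum.distrib pm.scale_sum_right)

lemmas weyl_elem_simps = pm.linear_0[OF linear_weyl_elem] pm.linear_add[OF linear_weyl_elem]
  pm.linear_scale[OF linear_weyl_elem] pm.linear_diff[OF linear_weyl_elem]

lemma mu_zero: "\<mu> 0 a b = 0"
  using mu_scale[of 0 0] by simp

lemma mu_diff: "\<mu> (s - t) a b = \<mu> s a b - \<mu> t a b"
  using mu_add[of "s - t" t] by (simp add: algebra_simps)

lemma weyl_elem_comm: "commutator (weyl_elem s) (weyl_elem t) - weyl_elem (commutator s t) \<in> weyl_ideal N"
proof -
  have "weyl_elem (commutator s t) = jordan_schwinger N (\<lambda>a b. mat_mult N (\<mu> s) (\<mu> t) a b - mat_mult N (\<mu> t) (\<mu> s) a b)"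
    unfolding weyl_elem_def jordan_schwinger_def
    by (intro sum.cong refl) (simp add: commutator_def mu_diff mu_mult mat_mult_def)
  then show ?thesis using jordan_schwinger_commutator[of N "\<mu> s" "\<mu> t"] by (simp add: weyl_elem_def)
qed

lemma weyl_elem_zero: "(\<And>a b. a \<in> {1..N} \<Longrightarrow> b \<in> {1..N} \<Longrightarrow> \<mu> t a b = 0) \<Longrightarrow> weyl_elem t = 0"
  by (simp add: weyl_elem_def jordan_schwinger_def)

text \<open>
  On linear polynomials the Weyl elements multiply as the matrices do, since each of them preserves the
  space of linear polynomials. So the Weyl algebra module contains the matrix representation, although
  products of Weyl elements have higher order as differential operators.
\<close>

lemma weyl_act_linear_part:
  assumes "b \<in> {1..N}"
  shows "weyl_act (word_hom (\<lambda>y. weyl_elem (\<phi> y)) f) (monomial (nth_prime b)) =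
    (\<Sum>a\<in>{1..N}. pm_scale (\<mu> (word_hom \<phi> f) a b) (monomial (nth_prime a)))"
  using subset_UNIV[of "Poly_Mapping.keys f"]
proof (induction rule: pm_induct)
  case zero
  then show ?case by (simp add: mu_zero)
next
  case (basis u)
  show ?case
  proof (induction u)
    case Nil
    show ?case using assms by (simp add: mu_one if_distrib[of "\<lambda>c. pm_scale c _"] cong: if_cong)
  next
    case (Cons y u)
    let ?t = "word_hom \<phi> (Poly_Mapping.single u 1)"
    have "weyl_act (word_hom (\<lambda>y. weyl_elem (\<phi> y)) (Poly_Mapping.single (y # u) 1)) (monomial (nth_prime b)) =
       (\<Sum>c\<in>{1..N}. pm_scale (\<mu> ?t c b) (\<Sum>a\<in>{1..N}. pm_scale (\<mu> (\<phi> y) a c) (monomial (nth_prime a))))"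
      unfolding single_Cons word_hom_mult word_hom_letter weyl_act_mult Cons weyl_act_linear
      by (intro sum.cong refl) (simp only: weyl_elem_def weyl_act_jordan_schwinger)
    also have "\<dots> = (\<Sum>c\<in>{1..N}. \<Sum>a\<in>{1..N}. pm_scale (\<mu> (\<phi> y) a c * \<mu> ?t c b) (monomial (nth_prime a)))"
      by (simp add: pm.scale_sum_right mult.commute)
    also have "\<dots> = (\<Sum>a\<in>{1..N}. \<Sum>c\<in>{1..N}. pm_scale (\<mu> (\<phi> y) a c * \<mu> ?t c b) (monomial (nth_prime a)))"
      by (rule sum.swap)
    also have "\<dots> = (\<Sum>a\<in>{1..N}. pm_scale (\<mu> (\<phi> y * ?t) a b) (monomial (nth_prime a)))"
      using assms by (simp add: mu_mult pm.scale_sum_left)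
    finally show ?case by (simp add: single_Cons)
  qed
next
  case (add f g)
  then show ?case by (simp add: mu_add pm.scale_left_distrib sum.distrib)
next
  case (scale c f)
  then show ?case by (simp add: mu_scale pm.scale_sum_right)
qed

lemma weyl_act_nonzero:
  assumes "a \<in> {1..N}" "b \<in> {1..N}" "\<mu> (word_hom \<phi> f) a b \<noteq> 0"
  shows "weyl_act (word_hom (\<lambda>y. weyl_elem (\<phi> y)) f) (monomial (nth_prime b)) \<noteq> 0"
proof -
  have pos: "nth_prime i > 0" for i using prime_gt_0_nat[OF prime_nth_prime] .
  have lk: "Poly_Mapping.lookup (monomial (nth_prime c) :: _ \<Rightarrow>\<^sub>0 'k) (nth_prime a - 1) = (if c = a then 1 else 0)" for c
    using pos[of c] pos[of a] nth_prime_eq_iff[of c a] by (auto simp: monomial_def lookup_single when_def simp del: nth_prime_eq_iff)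
  have "Poly_Mapping.lookup (weyl_act (word_hom (\<lambda>y. weyl_elem (\<phi> y)) f) (monomial (nth_prime b))) (nth_prime a - 1) = \<mu> (word_hom \<phi> f) a b"
    unfolding weyl_act_linear_part[OF assms(2)] lookup_sum lookup_pm_scale lk
    using assms(1) by (simp add: if_distrib[of "\<lambda>x. _ * x"] cong: if_cong)
  then show ?thesis using assms(3) by auto
qed

end

definition poly_space :: "('k::field, nat \<Rightarrow>\<^sub>0 'k) module" where
  "poly_space = \<lparr>carrier = UNIV, monoid.mult = (\<lambda>_ _. 0), one = 0, zero = 0, add = (+), module.smult = pm_scale\<rparr>"

text \<open>
  The operations \<open>monoid.mult\<close> and \<open>one\<close> are those of \<open>poly_space\<close>, so that the underlying space of the
  module and \<open>poly_space\<close> are equal as records.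
\<close>

definition act_module :: "('a \<Rightarrow> (nat \<Rightarrow>\<^sub>0 'k::field) \<Rightarrow> (nat \<Rightarrow>\<^sub>0 'k)) \<Rightarrow> ('a, nat \<Rightarrow>\<^sub>0 'k) module" where
  "act_module h = \<lparr>carrier = UNIV, monoid.mult = (\<lambda>_ _. 0), one = 0, zero = 0, add = (+), module.smult = h\<rparr>"

lemma End_poly_space:
  "carrier (End_alg (poly_space :: ('k::field, _) module)) = {h. pm_linear h}"
  "h \<otimes>\<^bsub>End_alg (poly_space :: ('k::field, _) module)\<^esub> h' = (\<lambda>v. h (h' v))"
  "h \<oplus>\<^bsub>End_alg (poly_space :: ('k::field, _) module)\<^esub> h' = (\<lambda>v. h v + h' v)"
  "c \<odot>\<^bsub>End_alg (poly_space :: ('k::field, _) module)\<^esub> h = (\<lambda>v. pm_scale c (h v))"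
  "\<one>\<^bsub>End_alg (poly_space :: ('k::field, _) module)\<^esub> = (\<lambda>v. v)"
  "\<zero>\<^bsub>End_alg (poly_space :: ('k::field, _) module)\<^esub> = (\<lambda>v. 0)"
  by (auto simp: End_alg_def poly_space_def compose_def Vector_Spaces.linear_iff vector_space_pm_scale)

lemma weyl_act_hom: "coset_lift weyl_act \<in> alg_hom (weyl_algebra N) (End_alg (poly_space :: ('k::field, _) module))"
  unfolding weyl_algebra_eq
  by (rule coset_lift_alg_hom[OF alg_ideal_weyl])
    (auto simp: End_poly_space linear_weyl_act weyl_act_ideal fun_eq_iff)

lemma act_module_left_module:
  fixes I :: "('x list \<Rightarrow>\<^sub>0 'k::field) set"
  assumes I: "alg_ideal I (free_assoc S)"
    and h: "\<And>f. Poly_Mapping.keys f \<subseteq> lists S \<Longrightarrow> h (I +>\<^bsub>(free_assoc S :: ('k, _) module)\<^esub> f) = weyl_act (word_hom \<psi> f)"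
  shows "left_module (quot_alg (free_assoc S) I) (act_module h)"
    "underlying_space (quot_alg (free_assoc S) I) (act_module h) = poly_space"
proof -
  note q = quot_free_assoc_simps[OF I]
  have "abelian_group (act_module h)"
    by (rule abelian_group_pm[where S = UNIV]) (auto simp: act_module_def)
  moreover have "left_module_axioms (quot_alg (free_assoc S) I) (act_module h)"
    by (rule left_module_axioms.intro) (auto simp: act_module_def q h keys_subset keys_one_subset)
  ultimately show "left_module (quot_alg (free_assoc S) I) (act_module h)"
    by (intro left_module.intro ring_quot_free_assoc[OF I])
  have "(\<lambda>c x. h (c \<odot>\<^bsub>quot_alg (free_assoc S) I\<^esub> \<one>\<^bsub>quot_alg (free_assoc S) I\<^esub>) x) = (pm_scale :: 'k \<Rightarrow> (nat \<Rightarrow>\<^sub>0 'k) \<Rightarrow> _)"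
    by (intro ext) (simp add: q h keys_one_subset keys_subset del: keys_one)
  then show "underlying_space (quot_alg (free_assoc S) I) (act_module h) = poly_space"
    by (simp add: underlying_space_def act_module_def poly_space_def)
qed

lemma uenv_eq: "uenv L = quot_alg (free_assoc (carrier L)) (uenv_ideal L)"
  by (simp add: uenv_def)

theorem proposition4p12:
  fixes n :: nat
    and a :: "'k::{alg_closed_field, field_char_0} uym_elem"
  assumes "n \<ge> 3"
    and "a \<in> carrier (uenv (ym n))"
    and "a \<noteq> \<zero>\<^bsub>uenv (ym n)\<^esub>"
  shows "\<exists>M :: ('k uym_elem, nat \<Rightarrow>\<^sub>0 'k) module. M \<in> YM_W n \<and>
    module_action M a \<noteq> \<zero>\<^bsub>End_alg (underlying_space (uenv (ym n)) M)\<^esub>"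
proof -
  let ?L = "ym n :: ('k, 'k ym_elem) module"
  let ?\<phi> = "\<lambda>y :: 'k ym_elem. expand (ym_rep n y)"
  have U: "alg_ideal (uenv_ideal ?L) (free_assoc (carrier ?L))" by (rule alg_ideal_uenv[OF nonassoc_algebra_ym])
  obtain f where f: "Poly_Mapping.keys f \<subseteq> lists (carrier ?L)" "a = uenv_class ?L f"
    using assms(2) unfolding uenv_eq quot_free_assoc_simps(1)[OF U] uenv_class_def by blast
  have "f \<notin> uenv_ideal ?L"
  proof
    assume "f \<in> uenv_ideal ?L"
    then have "a = uenv_class ?L 0"
      unfolding f(2) uenv_class_def coset_free_assoc_iff[OF U f(1) keys_zero[THEN equalityD1, THEN order.trans, OF empty_subsetI]] by simp
    then show False using assms(3) unfolding uenv_eq quot_free_assoc_simps(2)[OF U] uenv_class_def by simp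
  qed
  from uenv_ym_separation[OF f(1) this]
  have "word_hom ?\<phi> f \<notin> ym_words n" .
  from trunc_ideal_separates[OF two_sided_ym_words this]
  obtain m where m: "m \<ge> 1" "word_hom ?\<phi> f \<notin> trunc_ideal (ym_words n) m" by blast
  let ?K = "trunc_ideal (ym_words n) m :: (nat list \<Rightarrow>\<^sub>0 'k) set"
  have proper: "?K \<noteq> UNIV" using m(2) by blast
  obtain N \<mu> where N: "N \<ge> 1" and \<mu>: "word_matrix_rep N \<mu>"
    and ker: "\<And>t. t \<in> ?K \<longleftrightarrow> (\<forall>a\<in>{1..N}. \<forall>b\<in>{1..N}. \<mu> t a b = 0)"
    by (rule two_sided_matrix_rep[OF two_sided_trunc_ideal[OF two_sided_ym_words] proper
      finite_imageI[OF finite_short_words] trunc_ym_words_cofinite]) (rule that)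
  interpret word_matrix_rep N \<mu> by (rule \<mu>)
  let ?C = "lower_central ?L m"
  let ?A = "quot_alg ?L ?C"
  have A: "nonassoc_algebra ?A" by (rule alg_epi_algebra[OF nonassoc_algebra_free_nonassoc nilp_class_epi])
  have epi: "alg_epi (bracket_alg n) ?A (nilp_class n m)" by (rule nilp_class_epi)
  \<comment> \<open>any representative will do: the expansions of two of them differ by an element of the kernel of \<open>\<mu>\<close>\<close>
  define rep where "rep Y = (SOME g :: nat bracketing \<Rightarrow>\<^sub>0 'k. g \<in> carrier (bracket_alg n) \<and> nilp_class n m g = Y)" for Y
  define \<psi> where "\<psi> Y = weyl_elem (expand (rep Y))" for Y
  have \<psi>: "\<psi> (nilp_class n m g) = weyl_elem (expand g)" if g: "g \<in> carrier (bracket_alg n)" for g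
  proof -
    have "rep (nilp_class n m g) \<in> carrier (bracket_alg n) \<and> nilp_class n m (rep (nilp_class n m g)) = nilp_class n m g"
      unfolding rep_def by (rule someI[of _ g]) (use g in simp)
    then have "expand (rep (nilp_class n m g)) - expand g \<in> ?K" using g by (intro nilp_class_eqD) auto
    then have "weyl_elem (expand (rep (nilp_class n m g)) - expand g) = 0" using ker by (intro weyl_elem_zero) blast
    then show ?thesis by (simp add: \<psi>_def weyl_elem_simps)
  qed
  have \<psi>k: "Poly_Mapping.keys (\<psi> Y) \<subseteq> lists (weyl_gens N)" for Y
    unfolding \<psi>_def weyl_elem_def by (rule keys_jordan_schwinger)
  have Afn: "carrier ?A = nilp_class n m ` carrier (bracket_alg n)" using epi by (simp add: alg_epi_def)
  \<comment> \<open>\<open>\<psi>\<close> is a Lie homomorphism into the Weyl algebra, hence it extends to the enveloping algebra\<close>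
  have rel: "word_hom \<psi> i \<in> weyl_ideal N" if i: "i \<in> uenv_ideal ?A" for i
  proof (rule word_hom_uenv_ideal[OF A alg_ideal_weyl \<psi>k _ _ _ i])
    fix Z Y assume "Z \<in> carrier ?A" "Y \<in> carrier ?A"
    then obtain g h where gh: "g \<in> carrier (bracket_alg n)" "h \<in> carrier (bracket_alg n)" "Z = nilp_class n m g" "Y = nilp_class n m h"
      unfolding Afn by blast
    have e: "Z \<oplus>\<^bsub>?A\<^esub> Y = nilp_class n m (g + h)" "Z \<otimes>\<^bsub>?A\<^esub> Y = nilp_class n m (pm_bilin Br g h)"
      using epi gh by (simp_all add: alg_epi_def)
    have v: "\<psi> Z = weyl_elem (expand g)" "\<psi> Y = weyl_elem (expand h)"
      "\<psi> (Z \<oplus>\<^bsub>?A\<^esub> Y) = weyl_elem (expand g) + weyl_elem (expand h)"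
      "\<psi> (Z \<otimes>\<^bsub>?A\<^esub> Y) = weyl_elem (commutator (expand g) (expand h))"
      unfolding e by (simp_all only: gh(3,4) \<psi> gh(1,2) bracket_alg_closed expand_simps expand_bracket weyl_elem_simps)
    show "\<psi> (Z \<oplus>\<^bsub>?A\<^esub> Y) - \<psi> Z - \<psi> Y \<in> weyl_ideal N"
      unfolding v by (simp add: weyl_ideal_simps)
    show "commutator (\<psi> Z) (\<psi> Y) - \<psi> (Z \<otimes>\<^bsub>?A\<^esub> Y) \<in> weyl_ideal N"
      unfolding v by (rule weyl_elem_comm)
  next
    fix c Z assume "Z \<in> carrier ?A"
    then obtain g where g: "g \<in> carrier (bracket_alg n)" "Z = nilp_class n m g" unfolding Afn by blast
    have e: "c \<odot>\<^bsub>?A\<^esub> Z = nilp_class n m (pm_scale c g)" using epi g by (simp add: alg_epi_def)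
    have v: "\<psi> Z = weyl_elem (expand g)" "\<psi> (c \<odot>\<^bsub>?A\<^esub> Z) = pm_scale c (weyl_elem (expand g))"
      unfolding e by (simp_all only: g(2) \<psi> g(1) bracket_alg_closed expand_simps weyl_elem_simps)
    show "\<psi> (c \<odot>\<^bsub>?A\<^esub> Z) - pm_scale c (\<psi> Z) \<in> weyl_ideal N"
      unfolding v by (simp add: weyl_ideal_simps)
  qed
  let ?W = "free_assoc (weyl_gens N) :: ('k, _) module"
  define H where "H f = weyl_ideal N +>\<^bsub>?W\<^esub> word_hom \<psi> f" for f
  note UA = alg_ideal_uenv[OF A]
  have Hi: "H (i + f) = H f" if "i \<in> uenv_ideal ?A" for i f
  proof -
    have k: "Poly_Mapping.keys (word_hom \<psi> g) \<subseteq> lists (weyl_gens N)" for g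
      by (rule keys_word_hom[where S = UNIV]) (simp_all add: \<psi>k)
    show ?thesis unfolding H_def coset_free_assoc_iff[OF alg_ideal_weyl k k] using rel[OF that] by simp
  qed
  define \<alpha> where "\<alpha> = coset_lift H"
  define \<beta> where "\<beta> = coset_lift (weyl_act :: _ \<Rightarrow> _ \<Rightarrow> nat \<Rightarrow>\<^sub>0 'k)"
  have kev: "Poly_Mapping.keys (word_hom \<psi> g) \<subseteq> lists (weyl_gens N)" for g
    by (rule keys_word_hom[where S = UNIV]) (simp_all add: \<psi>k)
  have \<alpha>: "\<alpha> \<in> alg_hom (uenv ?A) (weyl_algebra N)"
    unfolding \<alpha>_def uenv_eq weyl_algebra_eq
    by (rule coset_lift_alg_hom[OF UA Hi]) (simp_all add: H_def quot_free_assoc_simps[OF alg_ideal_weyl] kev)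
  have \<beta>: "\<beta> \<in> alg_hom (weyl_algebra N) (End_alg poly_space)"
    unfolding \<beta>_def by (rule weyl_act_hom)
  define h where "h u = \<beta> (\<alpha> (uenv_quot_map ?L ?C u))" for u
  let ?c = "\<lambda>y. ?C +>\<^bsub>?L\<^esub> y"
  have h: "h (uenv_class ?L g) = weyl_act (word_hom (\<lambda>y. \<psi> (?c y)) g)" if g: "Poly_Mapping.keys g \<subseteq> lists (carrier ?L)" for g
  proof -
    have "uenv_quot_map ?L ?C (uenv_class ?L g) = uenv_class ?A (word_hom (\<lambda>y. letter (?c y)) g)"
      unfolding uenv_quot_map_def
      by (rule uenv_map_class[OF nonassoc_algebra_ym alg_epi_quot[OF nonassoc_algebra_ym alg_ideal_lower_central] g])
    moreover have "\<alpha> (uenv_class ?A q) = H q" for q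
      unfolding \<alpha>_def uenv_class_def by (rule coset_lift[OF UA]) (rule Hi)
    moreover have "\<beta> (H q) = weyl_act (word_hom \<psi> q)" for q
      unfolding \<beta>_def H_def by (rule coset_lift[OF alg_ideal_weyl]) (simp add: fun_eq_iff weyl_act_ideal)
    ultimately show ?thesis by (simp add: h_def word_hom_word_hom)
  qed
  let ?M = "act_module h"
  note M = act_module_left_module[OF U h[unfolded uenv_class_def], folded uenv_eq]
  have act: "module_action ?M u = h u" for u by (simp add: module_action_def act_module_def restrict_def)
  have "\<forall>u\<in>carrier (uenv ?L). module_action ?M u = \<beta> (\<alpha> (uenv_quot_map ?L ?C u))" by (simp add: act h_def)
  moreover have "\<beta> \<in> alg_hom (weyl_algebra N) (End_alg (underlying_space (uenv ?L) ?M))" using \<beta> M(2) by simp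
  ultimately have "?M \<in> YM_W n"
    unfolding YM_W_def using M(1) N m(1) \<alpha> by blast
  moreover have "module_action ?M a \<noteq> \<zero>\<^bsub>End_alg (underlying_space (uenv ?L) ?M)\<^esub>"
  proof -
    obtain b c where bc: "b \<in> {1..N}" "c \<in> {1..N}" "\<mu> (word_hom ?\<phi> f) b c \<noteq> 0" using m(2) ker by blast
    \<comment> \<open>on the classes of elements of the Yang-Mills algebra \<open>\<psi>\<close> may be computed from \<open>ym_rep\<close>\<close>
    have "\<psi> (?c y) = weyl_elem (?\<phi> y)" if y: "y \<in> carrier ?L" for y
    proof -
      have "?c y = nilp_class n m (ym_rep n y)" using ym_rep(2)[OF y] by (simp add: nilp_class_def)
      then show ?thesis using \<psi>[OF ym_rep(1)[OF y]] by simp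
    qed
    then have "h a = weyl_act (word_hom (\<lambda>y. weyl_elem (?\<phi> y)) f)"
      unfolding f(2) h[OF f(1)] by (intro arg_cong[of _ _ weyl_act] word_hom_cong[OF f(1)])
    then have "h a (monomial (nth_prime c)) \<noteq> 0" using weyl_act_nonzero[OF bc] by simp
    moreover have "\<zero>\<^bsub>End_alg (underlying_space (uenv ?L) ?M)\<^esub> = (\<lambda>v. 0)" using M(2) End_poly_space(6) by simp
    ultimately show ?thesis unfolding act by auto
  qed
  ultimately show ?thesis by blast
qed

end
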